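(* Let $(R,\mathfrak m)$ be a Noetherian local ring of dimension $d>0$, let $r\ge 1$ be an integer, and let $I_1,\dots,I_r$ be arbitrary $\mathfrak m$-primary ideals of $R$. Then $$e^{r-1}(R/I_1\oplus\cdots\oplus R/I_r)=e\big(R/(I_1+\cdots+I_r)\big),$$ where the right-hand side is the Hilbert–Samuel multiplicity $e(I_1+\cdots+I_r)$ of the ideal $I_1+\cdots+I_r$. In particular, if $I_1,\dots,I_{r-1}\subset I_r$, then $$e^{r-1}(R/I_1\oplus\cdots\oplus R/I_r)=e(R/I_r),$$ the Hilbert–Samuel multiplicity of $I_r$.
   Context: Let $(R,\mathfrak m)$ be a Noetherian local ring of dimension $d>0$, and let $\ell_R$ denote length. Let $C$ be a nonzero $R$-module of finite length, and let $\varphi:R^n\to R^r$ be an $R$-linear map of free modules with $C=\operatorname{Coker}\varphi$. Put $F=R^r$ and $M=\operatorname{Im}\varphi\subset F$. Let $S=\operatorname{Sym}_R(F)$ (a polynomial ring in $r$ variables over $R$) with degree $p$ component $S_p$, and let $M^p\subset S_p$ be the degree $p$ component of the $R$-subalgebra $R[M]=\operatorname{Im}\operatorname{Sym}_R(\varphi)$ of $S$ generated by $M\subset S_1=F$. The two-variable Buchsbaum–Rim function is $$\Lambda(p,q)=\ell_R(S_{p+q}/M^pS_q),\qquad p,q\ge 0 .$$ It is known that for all sufficiently large $p,q$ it agrees with a polynomial in $p,q$ of total degree $d+r-1$. For $j=0,1,\dots,d+r-1$, the $j$-th (associated) Buchsbaum–Rim multiplicity of $C$ is $$e^j(C)=\big(\text{the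 coefficient of }p^{d+r-1-j}q^j\text{ in this polynomial}\big)\cdot (d+r-1-j)!\,j!,$$ which is known to be independent of the choice of $\varphi$. For $C=R/I_1\oplus\cdots\oplus R/I_r$ one may take $\varphi$ with $M=I_1\oplus\cdots\oplus I_r\subset F=R^r$. For an $\mathfrak m$-primary ideal $I$, $e(R/I)$ is the Buchsbaum–Rim multiplicity $e^0(R/I)$ of the cyclic module $R/I$, which coincides with the Hilbert–Samuel multiplicity $e(I)$, i.e. $d!$ times the coefficient of $p^d$ in the polynomial that agrees with $\ell_R(R/I^p)$ for large $p$. *)

theory Defs
  imports
    "HOL-Computational_Algebra.Polynomial"
    "HOL-Library.Poly_Mapping"
    "HOL-Library.Extended_Real"
begin

section \<open>Commutative algebra over a ring type\<close>

text \<open>The ring \<open>R\<close> is a type of class \<open>comm_ring_1\<close>, regarded as a module over itself.\<close>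

abbreviation is_ideal :: "'a::comm_ring_1 set \<Rightarrow> bool"
  where "is_ideal \<equiv> module.subspace (*)"

abbreviation ideal_generated :: "'a::comm_ring_1 set \<Rightarrow> 'a set"
  where "ideal_generated \<equiv> module.span (*)"

definition noetherian :: "'a::comm_ring_1 itself \<Rightarrow> bool"
  where "noetherian _ \<longleftrightarrow>
    (\<forall>I::'a set. is_ideal I \<longrightarrow> (\<exists>B. finite B \<and> I = ideal_generated B))"

definition prime_ideal :: "'a::comm_ring_1 set \<Rightarrow> bool"
  where "prime_ideal P \<longleftrightarrow>
    is_ideal P \<and> P \<noteq> UNIV \<and> (\<forall>x y. x * y \<in> P \<longrightarrow> x \<in> P \<or> y \<in> P)"

definition maximal_ideal :: "'a::comm_ring_1 set \<Rightarrow> bool"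
  where "maximal_ideal \<mm> \<longleftrightarrow>
    is_ideal \<mm> \<and> \<mm> \<noteq> UNIV \<and> (\<forall>J. is_ideal J \<and> \<mm> \<subset> J \<longrightarrow> J = UNIV)"

definition local_ring :: "'a::comm_ring_1 set \<Rightarrow> bool"
  where "local_ring \<mm> \<longleftrightarrow> maximal_ideal \<mm> \<and> (\<forall>\<nn>. maximal_ideal \<nn> \<longrightarrow> \<nn> = \<mm>)"

definition krull_dim :: "'a::comm_ring_1 itself \<Rightarrow> enat"
  where "krull_dim _ =
    (SUP k \<in> {k. \<exists>P::nat \<Rightarrow> 'a set. (\<forall>i\<le>k. prime_ideal (P i)) \<and> (\<forall>i<k. P i \<subset> P (Suc i))}. enat k)"

definition radical_ideal :: "'a::comm_ring_1 set \<Rightarrow> 'a set"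
  where "radical_ideal I = {x. \<exists>n. x ^ n \<in> I}"

definition primary_ideal :: "'a::comm_ring_1 set \<Rightarrow> bool"
  where "primary_ideal I \<longleftrightarrow>
    is_ideal I \<and> I \<noteq> UNIV \<and> (\<forall>x y. x * y \<in> I \<longrightarrow> x \<in> I \<or> y \<in> radical_ideal I)"

definition primary_to :: "'a::comm_ring_1 set \<Rightarrow> 'a set \<Rightarrow> bool"
  where "primary_to \<mm> I \<longleftrightarrow> primary_ideal I \<and> radical_ideal I = \<mm>"

definition ideal_sum :: "nat \<Rightarrow> (nat \<Rightarrow> 'a::comm_ring_1 set) \<Rightarrow> 'a set"
  where "ideal_sum r I = {\<Sum>i=1..r. x i | x. \<forall>i\<in>{1..r}. x i \<in> I i}"

primrec ideal_power :: "'a::comm_ring_1 set \<Rightarrow> nat \<Rightarrow> 'a set"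
  where
    "ideal_power I 0 = UNIV"
  | "ideal_power I (Suc p) = ideal_generated {a * b | a b. a \<in> I \<and> b \<in> ideal_power I p}"

text \<open>For submodules \<open>N' \<subseteq> N\<close>, the length of \<open>N/N'\<close>: the submodules of the quotient are the
  submodules between \<open>N'\<close> and \<open>N\<close>, and the length is the supremum of the lengths of strict
  chains of these. It is \<open>\<infinity>\<close> if there is no bound.\<close>

definition quotient_length ::
    "('a::comm_ring_1 \<Rightarrow> 'b::ab_group_add \<Rightarrow> 'b) \<Rightarrow> 'b set \<Rightarrow> 'b set \<Rightarrow> enat"
  where "quotient_length scale N N' =
    (SUP k \<in> {k. \<exists>L. (\<forall>i\<le>k. module.subspace scale (L i) \<and> N' \<subseteq> L i \<and> L i \<subseteq> N) \<and>
                     (\<forall>i<k. L i \<subset> L (Suc i))}. enat k)"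


section \<open>Hilbert--Samuel multiplicity\<close>

definition hilbert_samuel_poly :: "'a::comm_ring_1 set \<Rightarrow> real poly"
  where "hilbert_samuel_poly I = (THE P. \<exists>N. \<forall>p\<ge>N.
    ereal_of_enat (quotient_length (*) UNIV (ideal_power I p)) = ereal (poly P (real p)))"

text \<open>The parameter \<open>d\<close> is the dimension of the ring, here and below.\<close>

definition hilbert_samuel_mult :: "nat \<Rightarrow> 'a::comm_ring_1 set \<Rightarrow> real"
  where "hilbert_samuel_mult d I = fact d * coeff (hilbert_samuel_poly I) d"


section \<open>The symmetric algebra of a free module\<close>

text \<open>\<open>Sym(R\<^sup>r)\<close> is the polynomial ring in \<open>x\<^sub>1, \<dots>, x\<^sub>r\<close> over \<open>R\<close>; exponent vectors are finitely
  supported functions on \<open>nat\<close>.\<close>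

type_synonym 'a mpoly = "(nat \<Rightarrow>\<^sub>0 nat) \<Rightarrow>\<^sub>0 'a"

definition const_poly :: "'a::comm_ring_1 \<Rightarrow> 'a mpoly"
  where "const_poly c = Poly_Mapping.single 0 c"

definition var_poly :: "nat \<Rightarrow> 'a::comm_ring_1 mpoly"
  where "var_poly i = Poly_Mapping.single (Poly_Mapping.single i 1) 1"

definition poly_scale :: "'a::comm_ring_1 \<Rightarrow> 'a mpoly \<Rightarrow> 'a mpoly"
  where "poly_scale c f = const_poly c * f"

definition sym_component :: "nat \<Rightarrow> nat \<Rightarrow> 'a::comm_ring_1 mpoly set"
  where "sym_component r p = {f. \<forall>\<alpha>\<in>Poly_Mapping.keys f.
    Poly_Mapping.keys \<alpha> \<subseteq> {1..r} \<and> (\<Sum>i=1..r. Poly_Mapping.lookup \<alpha> i) = p}"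

text \<open>An element of \<open>F = R\<^sup>r\<close> is a function on \<open>nat\<close> vanishing outside \<open>{1..r}\<close>; this map is
  the identification of \<open>F\<close> with the degree 1 component of \<open>Sym(F)\<close>.\<close>

definition linear_form :: "nat \<Rightarrow> (nat \<Rightarrow> 'a::comm_ring_1) \<Rightarrow> 'a mpoly"
  where "linear_form r v = (\<Sum>i=1..r. poly_scale (v i) (var_poly i))"

text \<open>The \<open>R\<close>-subalgebra generated by a set of polynomials.\<close>

inductive_set subalgebra_generated :: "'a::comm_ring_1 mpoly set \<Rightarrow> 'a mpoly set"
  for G :: "'a mpoly set"
  where
    const: "const_poly c \<in> subalgebra_generated G"
  | gen: "g \<in> G \<Longrightarrow> g \<in> subalgebra_generated G"
  | add: "f \<in> subalgebra_generated G \<Longrightarrow> g \<in> subalgebra_generated G \<Longrightarrow>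
      f + g \<in> subalgebra_generated G"
  | mult: "f \<in> subalgebra_generated G \<Longrightarrow> g \<in> subalgebra_generated G \<Longrightarrow>
      f * g \<in> subalgebra_generated G"


section \<open>Buchsbaum--Rim multiplicities\<close>

text \<open>Let \<open>M\<close> be a submodule of \<open>F = R\<^sup>r\<close> and \<open>C = F/M\<close>. Over a Noetherian ring such an \<open>M\<close> is
  the image of some linear map \<open>\<phi>: R\<^sup>n \<rightarrow> R\<^sup>r\<close>, with cokernel \<open>C\<close>, and the Buchsbaum--Rim function
  of \<open>\<phi>\<close> depends only on \<open>r\<close> and \<open>M\<close>. So the data \<open>r, M\<close> stand for a presentation of \<open>C\<close>.\<close>

definition rees_component :: "nat \<Rightarrow> (nat \<Rightarrow> 'a::comm_ring_1) set \<Rightarrow> nat \<Rightarrow> 'a mpoly set"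
  where "rees_component r M p = subalgebra_generated (linear_form r ` M) \<inter> sym_component r p"

definition rees_sym_product ::
    "nat \<Rightarrow> (nat \<Rightarrow> 'a::comm_ring_1) set \<Rightarrow> nat \<Rightarrow> nat \<Rightarrow> 'a mpoly set"
  where "rees_sym_product r M p q =
    module.span poly_scale {f * g | f g. f \<in> rees_component r M p \<and> g \<in> sym_component r q}"

definition buchsbaum_rim_function ::
    "nat \<Rightarrow> (nat \<Rightarrow> 'a::comm_ring_1) set \<Rightarrow> nat \<Rightarrow> nat \<Rightarrow> enat"
  where "buchsbaum_rim_function r M p q =
    quotient_length poly_scale (sym_component r (p + q)) (rees_sym_product r M p q)"

text \<open>A polynomial in \<open>p, q\<close> is a polynomial in \<open>p\<close> whose coefficients are polynomials in \<open>q\<close>;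
  the coefficient of \<open>p\<^sup>a q\<^sup>b\<close> in \<open>P\<close> is \<open>coeff (coeff P a) b\<close>.\<close>

definition buchsbaum_rim_poly ::
    "nat \<Rightarrow> (nat \<Rightarrow> 'a::comm_ring_1) set \<Rightarrow> real poly poly"
  where "buchsbaum_rim_poly r M = (THE P. \<exists>N. \<forall>p\<ge>N. \<forall>q\<ge>N.
    ereal_of_enat (buchsbaum_rim_function r M p q) =
      ereal (poly (poly P [:real p:]) (real q)))"

text \<open>\<open>e\<^sup>j(R\<^sup>r/M)\<close> for \<open>j \<le> d + r - 1\<close>.\<close>

definition buchsbaum_rim_mult ::
    "nat \<Rightarrow> nat \<Rightarrow> (nat \<Rightarrow> 'a::comm_ring_1) set \<Rightarrow> nat \<Rightarrow> real"
  where "buchsbaum_rim_mult d r M j =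
    coeff (coeff (buchsbaum_rim_poly r M) (d + r - 1 - j)) j * fact (d + r - 1 - j) * fact j"

text \<open>\<open>I\<^sub>1 \<oplus> \<dots> \<oplus> I\<^sub>r \<subseteq> R\<^sup>r\<close>, the presentation of \<open>R/I\<^sub>1 \<oplus> \<dots> \<oplus> R/I\<^sub>r\<close>.\<close>

definition ideal_direct_sum :: "nat \<Rightarrow> (nat \<Rightarrow> 'a::comm_ring_1 set) \<Rightarrow> (nat \<Rightarrow> 'a) set"
  where "ideal_direct_sum r I =
    {v. (\<forall>i\<in>{1..r}. v i \<in> I i) \<and> (\<forall>i. i \<notin> {1..r} \<longrightarrow> v i = 0)}"

text \<open>The multiplicity \<open>e(R/I) = e\<^sup>0(R/I)\<close> of a cyclic module, presented by \<open>I \<subseteq> R\<^sup>1\<close>.\<close>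

definition cyclic_buchsbaum_rim_mult :: "nat \<Rightarrow> 'a::comm_ring_1 set \<Rightarrow> real"
  where "cyclic_buchsbaum_rim_mult d I = buchsbaum_rim_mult d 1 (ideal_direct_sum 1 (\<lambda>_. I)) 0"

end

theory Submission
  imports Defs
begin

text \<open>
Write \<open>|\<gamma>| = \<gamma>\<^sub>1 + \<dots> + \<gamma>\<^sub>r\<close> for an exponent vector \<open>\<gamma>\<close>, and let \<open>I = I\<^sub>1 + \<dots> + I\<^sub>r\<close>. Since
\<open>M = I\<^sub>1 \<oplus> \<dots> \<oplus> I\<^sub>r\<close> is a direct sum along the coordinates, \<open>M\<^sup>p S\<^sub>q\<close> is spanned by its multihomogeneous
elements: in multidegree \<open>\<gamma>\<close> it consists of \<open>J p \<gamma> \<cdot> x\<^sup>\<gamma>\<close>, where the ideal \<open>J p \<gamma>\<close> is generated by the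
products of \<open>p\<close> factors from the \<open>I\<^sub>i\<close> among which at most \<open>\<gamma>\<^sub>i\<close> come from \<open>I\<^sub>i\<close>. Hence
\<open>\<Lambda>(p,q)\<close> is the sum of the colengths of \<open>J p \<gamma>\<close> over all \<open>\<gamma>\<close> with \<open>|\<gamma>| = p + q\<close>
(\<open>buchsbaum_rim_function_eq\<close>).

Fix \<open>p\<close> and let \<open>q\<close> grow. The ideal \<open>J p \<gamma>\<close> does not change when the entries of \<open>\<gamma>\<close> are cut off at a
large bound, and it is the full power \<open>I\<^sup>p\<close> as soon as all \<open>\<gamma>\<^sub>i \<ge> p\<close>, which is the case for most
\<open>\<gamma>\<close>. So \<open>\<Lambda>(p,q)\<close> is a polynomial of degree at most \<open>r - 1\<close> in \<open>q\<close> for large \<open>q\<close>, and its coefficient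
at \<open>q\<^sup>r\<^sup>-\<^sup>1\<close> is the colength of \<open>I\<^sup>p\<close> divided by \<open>(r - 1)!\<close> (\<open>\<Lambda>_fixed_p\<close>). Therefore, if
\<open>P\<close> is the Buchsbaum--Rim polynomial in two variables, its coefficient at \<open>q\<^sup>r\<^sup>-\<^sup>1\<close> is a polynomial in \<open>p\<close>
which is the Hilbert--Samuel polynomial of \<open>I\<close> divided by \<open>(r - 1)!\<close>, and comparing the coefficients at
\<open>p\<^sup>d\<close> gives the theorem (\<open>buchsbaum_rim_mult_eq\<close>). The case \<open>r = 1\<close> of the same argument identifies
\<open>e\<^sup>0(R/I)\<close> with \<open>e(I)\<close>.

It remains to show that \<open>\<Lambda>\<close> does agree with a polynomial for large \<open>p\<close> and \<open>q\<close>
(\<open>\<Lambda>_eventually_poly2\<close>). Choose finitely many generators of the \<open>I\<^sub>i\<close>, one variable for each, and one more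
variable for each coordinate \<open>x\<^sub>i\<close>. The chain \<open>R = J 0 \<gamma> \<supseteq> J 1 \<gamma> \<supseteq> \<dots> \<supseteq> J p \<gamma>\<close> is refined by adding
the monomials in the generators one at a time, in lexicographic order. Each step has a cyclic quotient
\<open>R / colon \<alpha>\<close> (\<open>quotient_length_layer\<close>), where \<open>colon \<alpha>\<close> grows with the exponent vector \<open>\<alpha>\<close>, just as
the ideal of leading coefficients at a monomial does in the theory of Groebner bases. By the
ascending chain condition, \<open>colon \<alpha>\<close> depends only on the entries of \<open>\<alpha>\<close> cut off at some bound
(\<open>noetherian_truncation\<close>). So \<open>\<Lambda>(p,q)\<close> is a sum, over exponent vectors of prescribed degrees,
of weights that depend only on the entries cut off at a bound, and such sums are polynomials for large
\<open>p\<close> and \<open>q\<close> (\<open>eventually_poly2_truncated_sum\<close>).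
\<close>

abbreviation (input) lookup :: "('e \<Rightarrow>\<^sub>0 'b::zero) \<Rightarrow> 'e \<Rightarrow> 'b"
  where "lookup \<equiv> Poly_Mapping.lookup"

abbreviation (input) keys :: "('e \<Rightarrow>\<^sub>0 'b::zero) \<Rightarrow> 'e set"
  where "keys \<equiv> Poly_Mapping.keys"

abbreviation (input) single :: "'e \<Rightarrow> 'b \<Rightarrow> ('e \<Rightarrow>\<^sub>0 'b::zero)"
  where "single \<equiv> Poly_Mapping.single"

section \<open>Length of quotient modules\<close>

definition has_submodule_chain ::
    "('a::comm_ring_1 \<Rightarrow> 'b::ab_group_add \<Rightarrow> 'b) \<Rightarrow> 'b set \<Rightarrow> 'b set \<Rightarrow> nat \<Rightarrow> bool"
  where "has_submodule_chain scale N N' k \<longleftrightarrow>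
    (\<exists>L. (\<forall>i\<le>k. module.subspace scale (L i) \<and> N' \<subseteq> L i \<and> L i \<subseteq> N) \<and>
         (\<forall>i<k. L i \<subset> L (Suc i)))"

lemma has_submodule_chain_antimono:
  "has_submodule_chain scale N N' k \<Longrightarrow> j \<le> k \<Longrightarrow> has_submodule_chain scale N N' j"
  unfolding has_submodule_chain_def by (meson less_le_trans order_trans)

context module
begin

text \<open>The lengths of strict chains are closed under passing to smaller numbers. Therefore comparing
  lengths amounts to comparing which chains exist, for finite and infinite lengths alike.\<close>

lemma enat_le_quotient_length_iff:
  assumes "subspace N" "N' \<subseteq> N"
  shows "enat k \<le> quotient_length scale N N' \<longleftrightarrow> has_submodule_chain scale N N' k"
proof
  assume le: "enat k \<le> quotient_length scale N N'"
  show "has_submodule_chain scale N N' k"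
  proof (rule ccontr)
    assume neg: "\<not> has_submodule_chain scale N N' k"
    have "has_submodule_chain scale N N' 0"
      unfolding has_submodule_chain_def using assms by (intro exI[of _ "\<lambda>_. N"]) auto
    with neg have "k > 0" by (cases k) auto
    have "quotient_length scale N N' \<le> enat (k - 1)"
      unfolding quotient_length_def has_submodule_chain_def[symmetric]
    proof (rule SUP_least)
      fix j assume "j \<in> {k. has_submodule_chain scale N N' k}"
      then have "j < k" using neg has_submodule_chain_antimono by (metis mem_Collect_eq not_less)
      then show "enat j \<le> enat (k - 1)" by simp
    qed
    with le have "enat k \<le> enat (k - 1)" by (rule order_trans)
    with \<open>k > 0\<close> show False by simp
  qed
next
  assume "has_submodule_chain scale N N' k"
  then show "enat k \<le> quotient_length scale N N'"
    unfolding quotient_length_def has_submodule_chain_def[symmetric]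
    by (intro SUP_upper) simp
qed

text \<open>Dropping the repetitions from a weakly increasing chain leaves a strict one.\<close>

lemma has_submodule_chain_of_weak_chain:
  assumes "\<forall>i\<le>k. subspace (L i) \<and> N' \<subseteq> L i \<and> L i \<subseteq> N" "\<forall>i<k. L i \<subseteq> L (Suc i)"
  shows "has_submodule_chain scale N N' (card {i. i < k \<and> L i \<noteq> L (Suc i)})"
proof -
  have "\<exists>M. (\<forall>i\<le>card {i. i < k \<and> L i \<noteq> L (Suc i)}. subspace (M i) \<and> N' \<subseteq> M i \<and> M i \<subseteq> N) \<and>
      (\<forall>i<card {i. i < k \<and> L i \<noteq> L (Suc i)}. M i \<subset> M (Suc i)) \<and>
      M (card {i. i < k \<and> L i \<noteq> L (Suc i)}) = L k"
    using assms
  proof (induction k)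
    case 0
    then show ?case by (intro exI[of _ L]) auto
  next
    case (Suc k)
    define c where "c = card {i. i < k \<and> L i \<noteq> L (Suc i)}"
    obtain M where M: "\<forall>i\<le>c. subspace (M i) \<and> N' \<subseteq> M i \<and> M i \<subseteq> N"
        "\<forall>i<c. M i \<subset> M (Suc i)" "M c = L k"
      using Suc.IH[folded c_def] Suc.prems by auto
    show ?case
    proof (cases "L k = L (Suc k)")
      case True
      then have "{i. i < Suc k \<and> L i \<noteq> L (Suc i)} = {i. i < k \<and> L i \<noteq> L (Suc i)}"
        by (auto simp: less_Suc_eq)
      then have c: "card {i. i < Suc k \<and> L i \<noteq> L (Suc i)} = c" by (simp add: c_def)
      show ?thesis unfolding c using M True by (intro exI[of _ M]) auto
    next
      case False
      then have "{i. i < Suc k \<and> L i \<noteq> L (Suc i)} = insert k {i. i < k \<and> L i \<noteq> L (Suc i)}"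
        by (auto simp: less_Suc_eq)
      then have c: "card {i. i < Suc k \<and> L i \<noteq> L (Suc i)} = Suc c" by (simp add: c_def)
      have "L k \<subset> L (Suc k)" using False Suc.prems(2) by auto
      then show ?thesis unfolding c using M Suc.prems(1)
        by (intro exI[of _ "M(Suc c := L (Suc k))"]) (auto simp: le_Suc_eq less_Suc_eq)
    qed
  qed
  then show ?thesis unfolding has_submodule_chain_def by blast
qed

text \<open>Intersecting a chain with \<open>N'\<close> and adding \<open>N'\<close> to it gives two weak chains. By the modular
  law, each strict step of the given chain remains strict in at least one of them.\<close>

lemma split_submodule_chain:
  assumes "subspace N" "subspace N'" "N'' \<subseteq> N'" "N' \<subseteq> N" "has_submodule_chain scale N N'' k"
  shows "\<exists>i j. has_submodule_chain scale N N' i \<and> has_submodule_chain scale N' N'' j \<and> k \<le> i + j"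
proof -
  obtain L where L: "\<And>i. i \<le> k \<Longrightarrow> subspace (L i) \<and> N'' \<subseteq> L i \<and> L i \<subseteq> N"
      "\<And>i. i < k \<Longrightarrow> L i \<subset> L (Suc i)"
    using assms(5) unfolding has_submodule_chain_def by blast
  define A where "A i = L i \<inter> N'" for i
  define B where "B i = span (L i \<union> N')" for i
  have A: "has_submodule_chain scale N' N'' (card {i. i < k \<and> A i \<noteq> A (Suc i)})"
  proof (intro has_submodule_chain_of_weak_chain allI impI)
    show "A i \<subseteq> A (Suc i)" if "i < k" for i using L(2)[OF that] by (auto simp: A_def)
  qed (use L(1) assms in \<open>auto simp: A_def subspace_inter\<close>)
  have B: "has_submodule_chain scale N N' (card {i. i < k \<and> B i \<noteq> B (Suc i)})"
  proof (intro has_submodule_chain_of_weak_chain allI impI conjI)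
    fix i assume "i \<le> k"
    show "subspace (B i)" by (simp add: B_def)
    show "N' \<subseteq> B i" unfolding B_def using span_superset by blast
    show "B i \<subseteq> N" unfolding B_def using L(1)[OF \<open>i \<le> k\<close>] assms by (intro span_minimal) auto
  next
    fix i assume "i < k"
    show "B i \<subseteq> B (Suc i)" unfolding B_def using L(2)[OF \<open>i < k\<close>] by (intro span_mono) auto
  qed
  have "{..<k} \<subseteq> {i. i < k \<and> B i \<noteq> B (Suc i)} \<union> {i. i < k \<and> A i \<noteq> A (Suc i)}"
  proof
    fix i assume "i \<in> {..<k}"
    then have i: "i < k" by simp
    \<comment> \<open>the modular law\<close>
    have "A i \<noteq> A (Suc i) \<or> B i \<noteq> B (Suc i)"
    proof (rule ccontr)
      assume "\<not> (A i \<noteq> A (Suc i) \<or> B i \<noteq> B (Suc i))"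
      then have AB: "A i = A (Suc i)" "B i = B (Suc i)" by auto
      obtain l where l: "l \<in> L (Suc i)" "l \<notin> L i" using L(2)[OF i] by blast
      have "l \<in> B (Suc i)" unfolding B_def using l by (intro span_base) auto
      then have "l \<in> B i" using AB(2) by simp
      then obtain x y where xy: "l = x + y" "x \<in> L i" "y \<in> N'"
        using span_eq_iff[THEN iffD2, of "L i"] span_eq_iff[THEN iffD2, OF assms(2)] L(1)[of i] i
        unfolding B_def span_Un by (smt (verit) less_imp_le mem_Collect_eq)
      have "y = l - x" using xy by simp
      then have "y \<in> L (Suc i)"
        using l(1) xy(2) L(2)[OF i] L(1)[of "Suc i"] i
        by (metis Suc_leI psubsetE subsetD subspace_diff)
      then have "y \<in> L i" using xy(3) AB(1) by (auto simp: A_def)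
      then have "l \<in> L i" using xy L(1)[of i] i by (auto intro: subspace_add)
      with l(2) show False by simp
    qed
    with i show "i \<in> {i. i < k \<and> B i \<noteq> B (Suc i)} \<union> {i. i < k \<and> A i \<noteq> A (Suc i)}" by auto
  qed
  then have "card {..<k} \<le> card ({i. i < k \<and> B i \<noteq> B (Suc i)} \<union> {i. i < k \<and> A i \<noteq> A (Suc i)})"
    by (intro card_mono) auto
  also have "\<dots> \<le> card {i. i < k \<and> B i \<noteq> B (Suc i)} + card {i. i < k \<and> A i \<noteq> A (Suc i)}"
    by (rule card_Un_le)
  finally show ?thesis using A B by auto
qed

lemma join_submodule_chains:
  assumes "N'' \<subseteq> N'" "N' \<subseteq> N" "has_submodule_chain scale N N' i" "has_submodule_chain scale N' N'' j"
  shows "has_submodule_chain scale N N'' (i + j)"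
proof -
  obtain M where M: "\<And>t. t \<le> i \<Longrightarrow> subspace (M t) \<and> N' \<subseteq> M t \<and> M t \<subseteq> N"
      "\<And>t. t < i \<Longrightarrow> M t \<subset> M (Suc t)"
    using assms(3) unfolding has_submodule_chain_def by blast
  obtain L where L: "\<And>t. t \<le> j \<Longrightarrow> subspace (L t) \<and> N'' \<subseteq> L t \<and> L t \<subseteq> N'"
      "\<And>t. t < j \<Longrightarrow> L t \<subset> L (Suc t)"
    using assms(4) unfolding has_submodule_chain_def by blast
  define K where "K t = (if t \<le> j then L t else M (t - j))" for t
  have "subspace (K t) \<and> N'' \<subseteq> K t \<and> K t \<subseteq> N" if "t \<le> i + j" for t
  proof (cases "t \<le> j")
    case True
    then show ?thesis using L(1)[of t] assms by (auto simp: K_def)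
  next
    case False
    moreover have "t - j \<le> i" using that by simp
    ultimately show ?thesis using M(1)[of "t - j"] assms that by (simp add: K_def) blast
  qed
  moreover have "K t \<subset> K (Suc t)" if "t < i + j" for t
  proof -
    consider "t < j" | "t = j" | "t > j" by linarith
    then show ?thesis
    proof cases
      case 1
      then show ?thesis using L(2)[of t] by (auto simp: K_def)
    next
      case 2
      then have "i > 0" using that by simp
      then have "N' \<subset> M (Suc 0)" using M(1)[of 0] M(2)[of 0] by auto
      then show ?thesis using 2 L(1)[of j] by (auto simp: K_def)
    next
      case 3
      then show ?thesis using M(2)[of "t - j"] that by (auto simp: K_def Suc_diff_le)
    qed
  qed
  ultimately show ?thesis unfolding has_submodule_chain_def by blast
qed

end

lemma enat_le_iff_below: "(x::enat) \<le> y \<longleftrightarrow> (\<forall>k. enat k \<le> x \<longrightarrow> enat k \<le> y)"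
proof
  assume *: "\<forall>k. enat k \<le> x \<longrightarrow> enat k \<le> y"
  show "x \<le> y"
  proof (cases x)
    case (enat n)
    then show ?thesis using * by auto
  next
    case infinity
    then have "enat k \<le> y" for k using * by auto
    then have "y = \<infinity>" by (metis enat_ord_simps(1) not_less_eq_eq not_infinity_eq order_refl)
    then show ?thesis by simp
  qed
qed auto

lemma enat_add_le_iff_below:
  "(x::enat) + y \<le> z \<longleftrightarrow> (\<forall>i j. enat i \<le> x \<longrightarrow> enat j \<le> y \<longrightarrow> enat (i + j) \<le> z)"
proof
  assume *: "\<forall>i j. enat i \<le> x \<longrightarrow> enat j \<le> y \<longrightarrow> enat (i + j) \<le> z"
  show "x + y \<le> z"
    unfolding enat_le_iff_below[of "x + y"]
  proof (intro allI impI)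
    fix k assume k: "enat k \<le> x + y"
    have "\<exists>i j. enat i \<le> x \<and> enat j \<le> y \<and> k \<le> i + j"
    proof (cases x)
      case infinity
      then show ?thesis by (intro exI[of _ k] exI[of _ 0]) (auto simp: zero_enat_def[symmetric])
    next
      case (enat n)
      note x = enat
      show ?thesis
      proof (cases y)
        case infinity
        then show ?thesis by (intro exI[of _ 0] exI[of _ k]) (auto simp: zero_enat_def[symmetric])
      next
        case (enat m)
        then show ?thesis using x k by (intro exI[of _ n] exI[of _ m]) auto
      qed
    qed
    then show "enat k \<le> z" using * by (meson enat_ord_simps(1) order_trans)
  qed
next
  assume "x + y \<le> z"
  then show "\<forall>i j. enat i \<le> x \<longrightarrow> enat j \<le> y \<longrightarrow> enat (i + j) \<le> z"
    by (metis add_mono order_trans plus_enat_simps(1))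
qed

lemma module_mult: "module ((*) :: 'a::comm_ring_1 \<Rightarrow> 'a \<Rightarrow> 'a)"
  by unfold_locales (auto simp: algebra_simps)

interpretation R: module "(*) :: 'a::comm_ring_1 \<Rightarrow> 'a \<Rightarrow> 'a"
  by (rule module_mult)

text \<open>As a rewrite rule this is associativity in the direction opposite to \<open>mult.assoc\<close>; together
  they make the simplifier loop.\<close>

declare R.scale_scale [simp del]

context module
begin

lemma quotient_length_additive:
  assumes "subspace N" "subspace N'" "N'' \<subseteq> N'" "N' \<subseteq> N"
  shows "quotient_length scale N N'' = quotient_length scale N N' + quotient_length scale N' N''"
proof (rule antisym)
  note iff = enat_le_quotient_length_iff
  have sub: "N'' \<subseteq> N" using assms by simp
  show "quotient_length scale N N'' \<le> quotient_length scale N N' + quotient_length scale N' N''"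
    unfolding enat_le_iff_below[of "quotient_length scale N N''"]
  proof (intro allI impI)
    fix k assume "enat k \<le> quotient_length scale N N''"
    then have "has_submodule_chain scale N N'' k" using iff assms sub by simp
    then obtain i j where "has_submodule_chain scale N N' i" "has_submodule_chain scale N' N'' j" "k \<le> i + j"
      using split_submodule_chain[OF assms] by blast
    then have "enat i \<le> quotient_length scale N N'" "enat j \<le> quotient_length scale N' N''" "enat k \<le> enat i + enat j"
      using iff assms by simp_all
    then show "enat k \<le> quotient_length scale N N' + quotient_length scale N' N''"
      by (meson add_mono order_trans)
  qed
  show "quotient_length scale N N' + quotient_length scale N' N'' \<le> quotient_length scale N N''"
    unfolding enat_add_le_iff_below using iff assms sub join_submodule_chains[of N'' N' N] by simp
qed

lemma quotient_length_self:
  assumes "subspace N"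
  shows "quotient_length scale N N = 0"
proof -
  have "\<not> has_submodule_chain scale N N (Suc 0)"
    unfolding has_submodule_chain_def by auto
  then have "\<not> enat (Suc 0) \<le> quotient_length scale N N"
    using enat_le_quotient_length_iff[OF assms order_refl] by simp
  then show ?thesis by (metis One_nat_def ileI1 not_gr_zero one_enat_def one_eSuc)
qed

lemma subspace_colon:
  assumes "subspace N"
  shows "R.subspace {c. scale c g \<in> N}"
  using assms by (intro R.subspaceI) (auto simp: scale_left_distrib subspace_0 subspace_add subspace_scale simp flip: scale_scale)

text \<open>The quotient of \<open>N' + R g\<close> by \<open>N'\<close> is cyclic, hence isomorphic to \<open>R\<close> modulo the annihilator
  \<open>(N' : g)\<close> of its generator. Instead of an isomorphism, the proof uses the two maps
  \<open>L \<mapsto> (L : g)\<close> and \<open>L \<mapsto> N' + L g\<close>, which carry strict chains to strict chains.\<close>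

lemma quotient_length_cyclic:
  assumes N': "subspace N'"
  shows "quotient_length scale (span (insert g N')) N' = quotient_length (*) UNIV {c. scale c g \<in> N'}"
    (is "quotient_length scale ?N N' = quotient_length (*) UNIV ?K")
proof -
  have mem: "x \<in> ?N \<longleftrightarrow> (\<exists>c. x - scale c g \<in> N')" for x
    unfolding span_insert span_eq_iff[THEN iffD2, OF N'] by simp
  have sub: "N' \<subseteq> ?N" using span_superset by blast
  have "has_submodule_chain scale ?N N' k \<longleftrightarrow> has_submodule_chain (*) UNIV ?K k" for k
  proof
    assume "has_submodule_chain scale ?N N' k"
    then obtain L where L: "\<And>t. t \<le> k \<Longrightarrow> subspace (L t) \<and> N' \<subseteq> L t \<and> L t \<subseteq> ?N"
        "\<And>t. t < k \<Longrightarrow> L t \<subset> L (Suc t)"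
      unfolding has_submodule_chain_def by blast
    have "{c. scale c g \<in> L t} \<subset> {c. scale c g \<in> L (Suc t)}" if t: "t < k" for t
    proof -
      obtain l where l: "l \<in> L (Suc t)" "l \<notin> L t" using L(2)[OF t] by blast
      then obtain c where c: "l - scale c g \<in> N'" using L(1)[of "Suc t"] t mem by (meson Suc_leI subsetD)
      have "scale c g = l - (l - scale c g)" by simp
      then have "scale c g \<in> L (Suc t)"
        using l(1) c L(1)[of "Suc t"] t by (metis Suc_leI subsetD subspace_diff)
      moreover have "scale c g \<notin> L t"
      proof
        assume "scale c g \<in> L t"
        then have "(l - scale c g) + scale c g \<in> L t"
          using c L(1)[of t] t by (intro subspace_add) auto
        with l(2) show False by simp
      qed
      ultimately show ?thesis using L(2)[OF t] by auto
    qed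
    then show "has_submodule_chain (*) UNIV ?K k"
      unfolding has_submodule_chain_def using L(1)
      by (intro exI[of _ "\<lambda>t. {c. scale c g \<in> L t}"]) (auto intro: subspace_colon)
  next
    assume "has_submodule_chain (*) UNIV ?K k"
    then obtain L where L: "\<And>t. t \<le> k \<Longrightarrow> R.subspace (L t) \<and> ?K \<subseteq> L t"
        "\<And>t. t < k \<Longrightarrow> L t \<subset> L (Suc t)"
      unfolding has_submodule_chain_def by blast
    define M where "M t = {x. \<exists>c\<in>L t. x - scale c g \<in> N'}" for t
    have "subspace (M t) \<and> N' \<subseteq> M t \<and> M t \<subseteq> ?N" if "t \<le> k" for t
    proof (intro conjI)
      have L0: "R.subspace (L t)" using L(1) that by blast
      show "subspace (M t)"
      proof (rule subspaceI)
        show "0 \<in> M t" using R.subspace_0[OF L0] subspace_0[OF N'] by (auto simp: M_def intro!: bexI[of _ 0])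
      next
        fix x y assume "x \<in> M t" "y \<in> M t"
        then obtain c d where cd: "c \<in> L t" "d \<in> L t" "x - scale c g \<in> N'" "y - scale d g \<in> N'"
          by (auto simp: M_def)
        have "x + y - scale (c + d) g = (x - scale c g) + (y - scale d g)"
          by (simp add: scale_left_distrib)
        then have "x + y - scale (c + d) g \<in> N'" using subspace_add[OF N' cd(3,4)] by (simp only:)
        then show "x + y \<in> M t" using R.subspace_add[OF L0 cd(1,2)] by (auto simp: M_def)
      next
        fix b x assume "x \<in> M t"
        then obtain c where c: "c \<in> L t" "x - scale c g \<in> N'" by (auto simp: M_def)
        have "scale b x - scale (b * c) g \<in> N'"
          using subspace_scale[OF N' c(2), of b] by (simp add: scale_right_diff_distrib)
        then show "scale b x \<in> M t" using R.subspace_scale[OF L0 c(1), of b] by (auto simp: M_def)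
      qed
      show "N' \<subseteq> M t" using R.subspace_0[OF L0] by (auto simp: M_def intro!: bexI[of _ 0])
      show "M t \<subseteq> ?N" using mem by (auto simp: M_def)
    qed
    moreover have "M t \<subset> M (Suc t)" if t: "t < k" for t
    proof -
      obtain c where c: "c \<in> L (Suc t)" "c \<notin> L t" using L(2)[OF t] by blast
      have "scale c g \<in> M (Suc t)" using c(1) subspace_0[OF N'] by (auto simp: M_def intro!: bexI[of _ c])
      moreover have "scale c g \<notin> M t"
      proof
        assume "scale c g \<in> M t"
        then obtain b where b: "b \<in> L t" "scale c g - scale b g \<in> N'" by (auto simp: M_def)
        then have "c - b \<in> ?K" by (simp add: scale_left_diff_distrib)
        then have "(c - b) + b \<in> L t" using b(1) L(1)[of t] t by (intro R.subspace_add) auto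
        with c(2) show False by simp
      qed
      moreover have "M t \<subseteq> M (Suc t)" using L(2)[OF t] by (auto simp: M_def)
      ultimately show ?thesis by auto
    qed
    ultimately show "has_submodule_chain scale ?N N' k" unfolding has_submodule_chain_def by blast
  qed
  then show ?thesis unfolding quotient_length_def has_submodule_chain_def by simp
qed

text \<open>This computes lengths throughout: add the generators one after the other in increasing order, so
  that every step is cyclic.\<close>

lemma quotient_length_filtration:
  fixes g :: "'i::linorder \<Rightarrow> 'b"
  assumes "finite A" and N': "subspace N'"
  shows "quotient_length scale (span (N' \<union> g ` A)) N' =
    (\<Sum>\<alpha>\<in>A. quotient_length (*) UNIV {c. scale c (g \<alpha>) \<in> span (N' \<union> g ` {\<beta>\<in>A. \<beta> < \<alpha>})})"
  using assms(1)
proof (induction A rule: finite_linorder_max_induct)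
  case empty
  show ?case unfolding image_empty Un_empty_right span_eq_iff[THEN iffD2, OF N']
    by (simp add: quotient_length_self[OF N'])
next
  case (insert b A)
  define N where "N = span (N' \<union> g ` A)"
  have "span (N' \<union> g ` insert b A) = span (insert (g b) N)"
    unfolding N_def by (rule antisym; rule span_minimal)
      (auto intro: span_base span_mono[THEN subsetD, rotated])
  moreover have "N' \<subseteq> N" unfolding N_def using span_superset by blast
  ultimately have "quotient_length scale (span (N' \<union> g ` insert b A)) N' =
      quotient_length scale (span (insert (g b) N)) N + quotient_length scale N N'"
    using quotient_length_additive[of "span (insert (g b) N)" N N'] span_superset[of "insert (g b) N"]
    by (auto simp: N_def)
  moreover have "{\<beta> \<in> insert b A. \<beta> < b} = A" using insert.hyps by auto
  moreover have "{\<beta> \<in> insert b A. \<beta> < \<alpha>} = {\<beta> \<in> A. \<beta> < \<alpha>}" if "\<alpha> \<in> A" for \<alpha>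
    using insert.hyps that by auto
  moreover have "b \<notin> A" using insert.hyps by auto
  ultimately show ?case
    using insert.hyps insert.IH quotient_length_cyclic[of N "g b"] by (simp add: N_def)
qed

end

section \<open>Finite length over a Noetherian ring\<close>

lemma noetherian_ascending_chain:
  fixes Q :: "nat \<Rightarrow> 'a::comm_ring_1 set"
  assumes noeth: "noetherian TYPE('a)" and ideal: "\<And>n. is_ideal (Q n)" and step: "\<And>n. Q n \<subseteq> Q (Suc n)"
  shows "\<exists>N. \<forall>n\<ge>N. Q n = Q N"
proof -
  have mono: "Q m \<subseteq> Q n" if "m \<le> n" for m n
    using lift_Suc_mono_le[of Q, OF step that] .
  have "is_ideal (\<Union>n. Q n)"
  proof (rule R.subspaceI)
    show "0 \<in> (\<Union>n. Q n)" using R.subspace_0[OF ideal] by auto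
  next
    fix x y assume "x \<in> (\<Union>n. Q n)" "y \<in> (\<Union>n. Q n)"
    then obtain i j where "x \<in> Q i" "y \<in> Q j" by auto
    then have "x \<in> Q (max i j)" "y \<in> Q (max i j)"
      using mono[of i "max i j"] mono[of j "max i j"] by auto
    then show "x + y \<in> (\<Union>n. Q n)" using R.subspace_add[OF ideal] by blast
  next
    fix c x assume "x \<in> (\<Union>n. Q n)"
    then show "c * x \<in> (\<Union>n. Q n)" using R.subspace_scale[OF ideal] by blast
  qed
  from noeth[unfolded noetherian_def, rule_format, OF this]
  obtain B where B: "finite B" "(\<Union>n. Q n) = ideal_generated B"
    by (elim exE conjE)
  have "b \<in> (\<Union>n. Q n)" if "b \<in> B" for b unfolding B(2) by (rule R.span_base[OF that])
  then have "\<forall>b\<in>B. \<exists>n. b \<in> Q n" by simp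
  then obtain k where k: "\<And>b. b \<in> B \<Longrightarrow> b \<in> Q (k b)" by metis
  define N where "N = Max (insert 0 (k ` B))"
  have "B \<subseteq> Q N"
  proof
    fix b assume "b \<in> B"
    then have "k b \<le> N" unfolding N_def using B(1) by (intro Max_ge) auto
    then show "b \<in> Q N" using k[OF \<open>b \<in> B\<close>] mono by blast
  qed
  then have "(\<Union>n. Q n) \<subseteq> Q N" unfolding B(2) by (intro R.span_minimal ideal)
  then show ?thesis using mono by blast
qed

lemma noetherian_maximal_element:
  fixes S :: "'a::comm_ring_1 set set"
  assumes noeth: "noetherian TYPE('a)" and ideal: "\<And>Q. Q \<in> S \<Longrightarrow> is_ideal Q" and "S \<noteq> {}"
  obtains Q where "Q \<in> S" "\<And>Q'. Q' \<in> S \<Longrightarrow> Q \<subseteq> Q' \<Longrightarrow> Q' = Q"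
proof (rule ccontr)
  assume "\<not> thesis"
  then have "\<forall>Q\<in>S. \<exists>Q'\<in>S. Q \<subset> Q'" using that by (metis psubsetI)
  then obtain f where f: "\<And>Q. Q \<in> S \<Longrightarrow> f Q \<in> S \<and> Q \<subset> f Q" by metis
  obtain Q0 where "Q0 \<in> S" using assms(3) by blast
  define Q where "Q n = (f ^^ n) Q0" for n
  have Q: "Q n \<in> S" for n by (induction n) (auto simp: Q_def \<open>Q0 \<in> S\<close> f)
  have strict: "Q n \<subset> Q (Suc n)" for n using f[OF Q, of n] by (simp add: Q_def)
  obtain N where "\<forall>n\<ge>N. Q n = Q N"
    using noetherian_ascending_chain[OF noeth, of Q] ideal[OF Q] strict by blast
  then show False using strict[of N] by (metis le_Suc_eq order_refl psubset_eq)
qed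

lemma radical_ideal_mono: "Q \<subseteq> Q' \<Longrightarrow> radical_ideal Q \<subseteq> radical_ideal Q'"
  unfolding radical_ideal_def by auto

lemma quotient_length_maximal_ideal_finite:
  assumes "maximal_ideal \<mm>"
  shows "quotient_length (*) UNIV \<mm> \<noteq> \<infinity>"
proof -
  have "\<not> has_submodule_chain (*) UNIV \<mm> 2"
  proof
    assume "has_submodule_chain (*) UNIV \<mm> 2"
    then obtain L where L: "\<forall>i\<le>2. is_ideal (L i) \<and> \<mm> \<subseteq> L i \<and> L i \<subseteq> UNIV" "\<forall>i<2. L i \<subset> L (Suc i)"
      unfolding has_submodule_chain_def by (elim exE conjE) (rule that)
    have "L 0 \<subset> L 1" "L 1 \<subset> L 2" using L(2) by (simp_all add: numeral_2_eq_2)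
    moreover have "\<mm> \<subseteq> L 0" "is_ideal (L 1)" using L(1) by simp_all
    ultimately show False using assms unfolding maximal_ideal_def by blast
  qed
  then have "\<not> enat 2 \<le> quotient_length (*) UNIV \<mm>"
    using R.enat_le_quotient_length_iff[of UNIV \<mm> 2] by simp
  then show ?thesis by (intro notI) simp
qed

text \<open>Otherwise choose \<open>Q\<close> maximal among the counterexamples, and then \<open>x \<notin> Q\<close> with \<open>(Q : x)\<close> maximal.
  By the second choice \<open>(Q : x)\<close> contains every element that has a power in it, so it contains
  \<open>\<mm>\<close> and equals \<open>\<mm>\<close>. So \<open>(Q + R x) / Q\<close> has finite length, and so has \<open>R / (Q + R x)\<close> by the first
  choice.\<close>

lemma quotient_length_finite:
  fixes Q :: "'a::comm_ring_1 set"
  assumes noeth: "noetherian TYPE('a)" and max: "maximal_ideal \<mm>"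
    and Q: "is_ideal Q" "\<mm> \<subseteq> radical_ideal Q"
  shows "quotient_length (*) UNIV Q \<noteq> \<infinity>"
proof (rule ccontr)
  define S where "S = {Q. is_ideal Q \<and> \<mm> \<subseteq> radical_ideal Q \<and> quotient_length (*) UNIV Q = \<infinity>}"
  assume "\<not> ?thesis"
  then have "S \<noteq> {}" using Q by (auto simp: S_def)
  moreover have "is_ideal Q" if "Q \<in> S" for Q using that by (simp add: S_def)
  ultimately obtain Q where QS: "Q \<in> S" and Qmax: "\<And>Q'. Q' \<in> S \<Longrightarrow> Q \<subseteq> Q' \<Longrightarrow> Q' = Q"
    using noetherian_maximal_element[OF noeth, of S] by metis
  have Q: "is_ideal Q" "\<mm> \<subseteq> radical_ideal Q" "quotient_length (*) UNIV Q = \<infinity>"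
    using QS by (auto simp: S_def)
  have "Q \<noteq> UNIV" using Q(3) R.quotient_length_self[OF R.subspace_UNIV] by (metis infinity_ne_i0)
  define T where "T = (\<lambda>x. {c. c * x \<in> Q}) ` (- Q)"
  have "T \<noteq> {}" using \<open>Q \<noteq> UNIV\<close> by (auto simp: T_def)
  moreover have "is_ideal P" if "P \<in> T" for P
    using that R.subspace_colon[OF Q(1)] by (auto simp: T_def)
  ultimately obtain P where PT: "P \<in> T" and Pmax: "\<And>P'. P' \<in> T \<Longrightarrow> P \<subseteq> P' \<Longrightarrow> P' = P"
    using noetherian_maximal_element[OF noeth, of T] by metis
  obtain x where x: "x \<notin> Q" "P = {c. c * x \<in> Q}" using PT by (auto simp: T_def)
  have P: "is_ideal P" unfolding x(2) by (rule R.subspace_colon[OF Q(1)])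
  have "1 \<notin> P" using x by simp
  \<comment> \<open>The maximality of \<open>P = (Q : x)\<close> makes it radical: \<open>P \<subseteq> (Q : y\<^sup>n x)\<close>, with equality unless \<open>y\<^sup>n x \<in> Q\<close>.\<close>
  have power: "y ^ n \<in> P \<Longrightarrow> y \<in> P" for y n
  proof (induction n)
    case 0
    then show ?case using \<open>1 \<notin> P\<close> by simp
  next
    case (Suc n)
    show ?case
    proof (cases "y ^ n * x \<in> Q")
      case True
      then show ?thesis using Suc.IH x(2) by simp
    next
      case False
      have "P \<subseteq> {c. c * (y ^ n * x) \<in> Q}"
      proof
        fix c assume "c \<in> P"
        then have "c * x \<in> Q" by (simp add: x(2))
        then have "y ^ n * (c * x) \<in> Q" by (rule R.subspace_scale[OF Q(1)])
        moreover have "y ^ n * (c * x) = c * (y ^ n * x)" by (rule mult.left_commute)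
        ultimately show "c \<in> {c. c * (y ^ n * x) \<in> Q}" by (simp only: mem_Collect_eq)
      qed
      moreover have "{c. c * (y ^ n * x) \<in> Q} \<in> T" unfolding T_def using False by (intro imageI) simp
      ultimately have eq: "{c. c * (y ^ n * x) \<in> Q} = P" by (intro Pmax)
      have "y ^ Suc n * x \<in> Q" using Suc.prems by (simp only: x(2) mem_Collect_eq)
      then have "y * (y ^ n * x) \<in> Q" by (simp only: power_Suc mult.assoc)
      then have "y \<in> {c. c * (y ^ n * x) \<in> Q}" by (simp only: mem_Collect_eq)
      then show ?thesis by (simp only: eq)
    qed
  qed
  have "\<mm> \<subseteq> P"
  proof
    fix y assume "y \<in> \<mm>"
    then obtain n where "y ^ n \<in> Q" using Q(2) by (auto simp: radical_ideal_def)
    then have "x * y ^ n \<in> Q" by (rule R.subspace_scale[OF Q(1)])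
    then have "y ^ n \<in> P" unfolding x(2) by (simp add: mult.commute)
    then show "y \<in> P" by (rule power)
  qed
  then have "P = \<mm>" using max P \<open>1 \<notin> P\<close> by (auto simp: maximal_ideal_def)
  define Q' where "Q' = ideal_generated (insert x Q)"
  have sub: "Q \<subseteq> Q'" unfolding Q'_def using R.span_superset by blast
  have "x \<in> Q'" unfolding Q'_def by (intro R.span_base) simp
  then have "Q' \<notin> S" using Qmax[of Q'] sub x(1) by auto
  then have "quotient_length (*) UNIV Q' \<noteq> \<infinity>"
    using radical_ideal_mono[OF sub] Q(2) by (auto simp: S_def Q'_def)
  moreover have "quotient_length (*) Q' Q \<noteq> \<infinity>"
    unfolding Q'_def R.quotient_length_cyclic[OF Q(1)]
    using quotient_length_maximal_ideal_finite[OF max] x(2) \<open>P = \<mm>\<close> by simp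
  moreover have "quotient_length (*) UNIV Q = quotient_length (*) UNIV Q' + quotient_length (*) Q' Q"
    by (rule R.quotient_length_additive) (use sub in \<open>auto simp: Q'_def\<close>)
  ultimately show False using Q(3) by (cases "quotient_length (*) UNIV Q'"; cases "quotient_length (*) Q' Q") simp_all
qed

section \<open>Monotone families of ideals\<close>

definition truncate :: "nat \<Rightarrow> ('v \<Rightarrow>\<^sub>0 nat) \<Rightarrow> ('v \<Rightarrow>\<^sub>0 nat)"
  where "truncate N = Poly_Mapping.map (min N)"

lemma lookup_truncate [simp]: "lookup (truncate N \<alpha>) v = min N (lookup \<alpha> v)"
  by (simp add: truncate_def map.rep_eq when_def)

lemma keys_truncate: "keys (truncate N \<alpha>) \<subseteq> keys \<alpha>"
  by (auto simp: in_keys_iff)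

lemma truncate_truncate [simp]: "truncate M (truncate N \<alpha>) = truncate (min M N) \<alpha>"
  by (rule poly_mapping_eqI) (simp add: min.assoc)

lemma truncate_add_diff: "truncate N \<alpha> + (\<alpha> - truncate N \<alpha>) = \<alpha>"
  by (rule poly_mapping_eqI) (simp add: lookup_add lookup_minus)

lemma keys_add_nat: "keys (\<alpha> + \<beta> :: 'v \<Rightarrow>\<^sub>0 nat) = keys \<alpha> \<union> keys \<beta>"
  by (auto simp: in_keys_iff lookup_add)

lemma keys_diff_nat: "keys (\<alpha> - \<beta> :: 'v \<Rightarrow>\<^sub>0 nat) \<subseteq> keys \<alpha>"
  by (auto simp: in_keys_iff lookup_minus)

lemma split_exponent:
  fixes \<alpha> :: "'v \<Rightarrow>\<^sub>0 nat"
  assumes "keys \<alpha> \<subseteq> insert x V"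
  obtains \<beta> n where "keys \<beta> \<subseteq> V - {x}" "\<alpha> = \<beta> + single x n"
proof
  show "keys (Poly_Mapping.update x 0 \<alpha>) \<subseteq> V - {x}"
    using assms by (auto simp: keys_update)
  show "\<alpha> = Poly_Mapping.update x 0 \<alpha> + single x (lookup \<alpha> x)"
    by (rule poly_mapping_eqI) (auto simp: lookup_add lookup_update lookup_single when_def)
qed

lemma finite_bounded_exponents:
  assumes "finite V"
  shows "finite {\<alpha>::'v \<Rightarrow>\<^sub>0 nat. keys \<alpha> \<subseteq> V \<and> (\<forall>v. lookup \<alpha> v \<le> N)}" (is "finite ?A")
proof (rule finite_imageD)
  have "lookup ` ?A \<subseteq> {f. \<forall>x. (x \<in> V \<longrightarrow> f x \<in> {..N}) \<and> (x \<notin> V \<longrightarrow> f x = 0)}"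
    by (auto simp: in_keys_iff subset_iff)
  then show "finite (lookup ` ?A)"
    using finite_set_of_finite_funs[OF assms, of "{..N}" 0] finite_subset by blast
  show "inj_on lookup ?A" by (intro inj_onI poly_mapping_eqI) (rule fun_cong)
qed

lemma truncate_add_single:
  assumes "x \<notin> keys \<beta>"
  shows "truncate N (\<beta> + single x n) = truncate N \<beta> + single x (min N n)"
proof (rule poly_mapping_eqI)
  fix v
  show "lookup (truncate N (\<beta> + single x n)) v =
      lookup (truncate N \<beta> + single x (min N n)) v"
    using assms by (cases "v = x") (simp_all add: lookup_add lookup_single_not_eq in_keys_iff)
qed

text \<open>A combinatorial form of the Hilbert basis theorem: a monotone family of ideals indexed by exponent
  vectors in finitely many variables is determined by its values on a box. By induction on the
  number of variables, for the last variable \<open>x\<close>: the families obtained by fixing the exponent \<open>n\<close> of \<open>x\<close>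
  increase with \<open>n\<close> to a union \<open>U\<close>, which is itself determined by a finite box. On that box
  \<open>U\<close> is reached at some \<open>n\<^sub>0\<close>, and then monotonicity forces it to be reached at
  \<open>n\<^sub>0\<close> everywhere. So only the finitely many families with \<open>n \<le> n\<^sub>0\<close> remain to be considered.\<close>

lemma noetherian_truncation:
  fixes L :: "('v \<Rightarrow>\<^sub>0 nat) \<Rightarrow> 'a::comm_ring_1 set"
  assumes noeth: "noetherian TYPE('a)" and "finite V" and "\<And>\<alpha>. keys \<alpha> \<subseteq> V \<Longrightarrow> is_ideal (L \<alpha>)"
    and "\<And>\<alpha> \<beta>. keys \<alpha> \<subseteq> V \<Longrightarrow> keys \<beta> \<subseteq> V \<Longrightarrow> L \<alpha> \<subseteq> L (\<alpha> + \<beta>)"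
  shows "\<exists>N. \<forall>\<alpha>. keys \<alpha> \<subseteq> V \<longrightarrow> L \<alpha> = L (truncate N \<alpha>)"
  using assms(2-)
proof (induction V arbitrary: L rule: finite_induct)
  case empty
  have "truncate 0 0 = (0 :: 'v \<Rightarrow>\<^sub>0 nat)" by (rule poly_mapping_eqI) simp
  then show ?case by (intro exI[of _ 0]) simp
next
  case (insert x V)
  define s where "s n = single x n" for n :: nat
  have ks: "keys (s n) \<subseteq> insert x V" for n by (simp add: s_def)
  have s_add: "s (m + n) = s m + s n" for m n by (simp add: s_def single_add)
  have ideal: "is_ideal (L (\<beta> + s n))" if "keys \<beta> \<subseteq> V" for \<beta> n
    using that ks[of n] by (intro insert.prems) (auto simp: keys_add_nat)
  have mono: "L (\<beta> + s m) \<subseteq> L (\<beta> + \<gamma> + s n)"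
    if "keys \<beta> \<subseteq> V" "keys \<gamma> \<subseteq> V" "m \<le> n" for \<beta> \<gamma> m n
  proof -
    have "s n = s m + s (n - m)" using that by (simp flip: s_add)
    then have eq: "\<beta> + \<gamma> + s n = (\<beta> + s m) + (\<gamma> + s (n - m))" by (simp add: ac_simps)
    show ?thesis unfolding eq using that ks by (intro insert.prems) (auto simp: keys_add_nat)
  qed
  have mono0: "L (\<beta> + s m) \<subseteq> L (\<beta> + s n)" if "keys \<beta> \<subseteq> V" "m \<le> n" for \<beta> m n
    using mono[OF that(1), of 0] that(2) by simp
  define U where "U \<beta> = (\<Union>n. L (\<beta> + s n))" for \<beta>
  have stable: "\<exists>k. \<forall>n\<ge>k. L (\<beta> + s n) = U \<beta>" if \<beta>: "keys \<beta> \<subseteq> V" for \<beta>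
  proof -
    obtain k where k: "\<forall>n\<ge>k. L (\<beta> + s n) = L (\<beta> + s k)"
      using noetherian_ascending_chain[OF noeth, of "\<lambda>n. L (\<beta> + s n)"] ideal[OF \<beta>] mono0[OF \<beta>] by auto
    have "L (\<beta> + s n) \<subseteq> L (\<beta> + s k)" for n
      using mono0[OF \<beta>, of n "max n k"] k[rule_format, of "max n k"] by simp
    then have "U \<beta> = L (\<beta> + s k)" unfolding U_def by blast
    then have "L (\<beta> + s n) = U \<beta>" if "n \<ge> k" for n using k[rule_format, OF that] by (simp only:)
    then show ?thesis by (intro exI[of _ k] allI impI)
  qed
  define k where "k \<beta> = (SOME k. \<forall>n\<ge>k. L (\<beta> + s n) = U \<beta>)" for \<beta>
  have k: "L (\<beta> + s n) = U \<beta>" if "keys \<beta> \<subseteq> V" "n \<ge> k \<beta>" for \<beta> n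
    using someI_ex[OF stable[OF that(1)], folded k_def] that(2) by simp
  have "\<exists>N. \<forall>\<beta>. keys \<beta> \<subseteq> V \<longrightarrow> U \<beta> = U (truncate N \<beta>)"
  proof (rule insert.IH)
    fix \<beta> :: "'v \<Rightarrow>\<^sub>0 nat" assume "keys \<beta> \<subseteq> V"
    then show "is_ideal (U \<beta>)" using k[of \<beta> "k \<beta>"] ideal[of \<beta> "k \<beta>"] by simp
  next
    fix \<beta> \<gamma> :: "'v \<Rightarrow>\<^sub>0 nat" assume "keys \<beta> \<subseteq> V" "keys \<gamma> \<subseteq> V"
    then show "U \<beta> \<subseteq> U (\<beta> + \<gamma>)" unfolding U_def by (intro UN_mono order_refl mono)
  qed
  then obtain N' where N': "\<And>\<beta>. keys \<beta> \<subseteq> V \<Longrightarrow> U \<beta> = U (truncate N' \<beta>)" by blast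
  have "\<exists>N. \<forall>\<beta>. keys \<beta> \<subseteq> V \<longrightarrow> L (\<beta> + s n) = L (truncate N \<beta> + s n)" for n
    by (rule insert.IH) (rule ideal, assumption, rule mono, assumption+, rule order_refl)
  then have "\<exists>N. \<forall>n. \<forall>\<beta>. keys \<beta> \<subseteq> V \<longrightarrow> L (\<beta> + s n) = L (truncate (N n) \<beta> + s n)"
    by (intro choice allI)
  then obtain N where N: "\<And>n \<beta>. keys \<beta> \<subseteq> V \<Longrightarrow> L (\<beta> + s n) = L (truncate (N n) \<beta> + s n)"
    by blast
  define Box where "Box = {\<beta>::'v \<Rightarrow>\<^sub>0 nat. keys \<beta> \<subseteq> V \<and> (\<forall>v. lookup \<beta> v \<le> N')}"
  have "finite Box" unfolding Box_def by (rule finite_bounded_exponents) (rule insert.hyps)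
  define n0 where "n0 = Max (insert 0 (k ` Box))"
  have n0: "L (\<beta> + s n) = U \<beta>" if \<beta>: "keys \<beta> \<subseteq> V" and n: "n \<ge> n0" for \<beta> n
  proof
    show "L (\<beta> + s n) \<subseteq> U \<beta>" by (auto simp: U_def)
    have kt: "keys (truncate N' \<beta>) \<subseteq> V" using keys_truncate \<beta> by (rule order_trans)
    then have "truncate N' \<beta> \<in> Box" by (simp add: Box_def)
    then have "k (truncate N' \<beta>) \<le> n0" unfolding n0_def using \<open>finite Box\<close> by (intro Max_ge) auto
    then have "U \<beta> = L (truncate N' \<beta> + s n)" using N'[OF \<beta>] k[OF kt] n by simp
    also have "\<dots> \<subseteq> L (truncate N' \<beta> + (\<beta> - truncate N' \<beta>) + s n)"
      using kt order_trans[OF keys_diff_nat \<beta>] by (intro mono) simp_all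
    also have "\<dots> = L (\<beta> + s n)" by (simp add: truncate_add_diff)
    finally show "U \<beta> \<subseteq> L (\<beta> + s n)" .
  qed
  \<comment> \<open>beyond \<open>n0\<close> all families coincide with \<open>U\<close>, and below it the bounds \<open>N n\<close> apply\<close>
  define K where "K = Max (insert n0 (N ` {..n0}))"
  have K: "n0 \<le> K" "\<And>n. n \<le> n0 \<Longrightarrow> N n \<le> K" unfolding K_def by (auto intro!: Max_ge simp del: Max_insert)
  have trunc: "L (truncate K \<beta> + s n) = L (\<beta> + s n)" if \<beta>: "keys \<beta> \<subseteq> V" and n: "n \<le> n0" for \<beta> n
  proof -
    have kt: "keys (truncate K \<beta>) \<subseteq> V" using keys_truncate \<beta> by (rule order_trans)
    have "truncate (N n) (truncate K \<beta>) = truncate (N n) \<beta>" using K(2)[OF n] by (simp add: min_absorb1)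
    then have "L (truncate K \<beta> + s n) = L (truncate (N n) \<beta> + s n)" using N[OF kt, of n] by argo
    then show ?thesis using N[OF \<beta>, of n] by argo
  qed
  show ?case
  proof (intro exI[of _ K] allI impI)
    fix \<alpha> :: "'v \<Rightarrow>\<^sub>0 nat" assume "keys \<alpha> \<subseteq> insert x V"
    then obtain \<beta> n where \<beta>: "keys \<beta> \<subseteq> V - {x}" and \<alpha>: "\<alpha> = \<beta> + s n"
      unfolding s_def by (rule split_exponent)
    have \<beta>V: "keys \<beta> \<subseteq> V" "x \<notin> keys \<beta>" using \<beta> by auto
    have kt: "keys (truncate K \<beta>) \<subseteq> V" using keys_truncate \<beta>V(1) by (rule order_trans)
    have eq: "truncate K \<alpha> = truncate K \<beta> + s (min K n)"
      unfolding \<alpha> s_def by (rule truncate_add_single) (rule \<beta>V)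
    show "L \<alpha> = L (truncate K \<alpha>)"
    proof (cases "n \<le> n0")
      case True
      then have "min K n = n" using K(1) by simp
      have "L \<alpha> = L (truncate K \<beta> + s n)" unfolding \<alpha> using trunc[OF \<beta>V(1) True] by argo
      then show ?thesis unfolding eq \<open>min K n = n\<close> .
    next
      case False
      then have n: "n0 \<le> n" "n0 \<le> min K n" using K(1) by simp_all
      have "L \<alpha> = L (\<beta> + s n0)" unfolding \<alpha> using n0[OF \<beta>V(1) n(1)] n0[OF \<beta>V(1) order_refl] by argo
      also have "\<dots> = L (truncate K \<beta> + s n0)" using trunc[OF \<beta>V(1) order_refl] by argo
      also have "\<dots> = L (truncate K \<beta> + s (min K n))" using n0[OF kt n(2)] n0[OF kt order_refl] by argo
      finally show ?thesis unfolding eq .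
    qed
  qed
qed

section \<open>Eventually polynomial functions\<close>

text \<open>The number \<open>k\<close> is only a bound for the degree, so that \<open>c\<close> may vanish.\<close>

definition eventually_poly :: "nat \<Rightarrow> real \<Rightarrow> (nat \<Rightarrow> real) \<Rightarrow> bool"
  where "eventually_poly k c f \<longleftrightarrow>
    (\<exists>F N. degree F \<le> k \<and> coeff F k = c \<and> (\<forall>n\<ge>N. f n = poly F (real n)))"

lemma eventually_polyI:
  "degree F \<le> k \<Longrightarrow> coeff F k = c \<Longrightarrow> (\<And>n. n \<ge> N \<Longrightarrow> f n = poly F (real n)) \<Longrightarrow> eventually_poly k c f"
  unfolding eventually_poly_def by blast

lemma eventually_poly_cong:
  assumes "eventually_poly k c f" "\<And>n. n \<ge> M \<Longrightarrow> g n = f n"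
  shows "eventually_poly k c g"
proof -
  obtain F N where F: "degree F \<le> k" "coeff F k = c" "\<And>n. n \<ge> N \<Longrightarrow> f n = poly F (real n)"
    using assms(1) unfolding eventually_poly_def by blast
  show ?thesis by (rule eventually_polyI[OF F(1,2), of "max M N"]) (simp add: assms(2) F(3))
qed

lemma eventually_poly_add:
  assumes "eventually_poly k c f" "eventually_poly k d g"
  shows "eventually_poly k (c + d) (\<lambda>n. f n + g n)"
proof -
  obtain F N where F: "degree F \<le> k" "coeff F k = c" "\<And>n. n \<ge> N \<Longrightarrow> f n = poly F (real n)"
    using assms(1) unfolding eventually_poly_def by blast
  obtain G M where G: "degree G \<le> k" "coeff G k = d" "\<And>n. n \<ge> M \<Longrightarrow> g n = poly G (real n)"
    using assms(2) unfolding eventually_poly_def by blast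
  show ?thesis
    by (rule eventually_polyI[of "F + G" _ _ "max M N"]) (simp_all add: F G degree_add_le)
qed

lemma eventually_poly_raise_degree:
  assumes "eventually_poly k c f"
  shows "eventually_poly (Suc k) 0 f"
proof -
  obtain F N where F: "degree F \<le> k" "coeff F k = c" "\<And>n. n \<ge> N \<Longrightarrow> f n = poly F (real n)"
    using assms(1) unfolding eventually_poly_def by blast
  show ?thesis by (rule eventually_polyI[of F _ _ N]) (use F in \<open>auto simp: coeff_eq_0\<close>)
qed

lemma eventually_poly_sum_zero:
  assumes "\<And>i. i \<in> A \<Longrightarrow> eventually_poly k 0 (f i)"
  shows "eventually_poly k 0 (\<lambda>n. \<Sum>i\<in>A. f i n)"
proof -
  have zero: "eventually_poly k 0 (\<lambda>_. 0)" by (rule eventually_polyI[of 0]) auto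
  show ?thesis using assms
  proof (induction A rule: infinite_finite_induct)
    case (insert i A)
    then have "eventually_poly k (0 + 0) (\<lambda>n. f i n + (\<Sum>i\<in>A. f i n))"
      by (intro eventually_poly_add) auto
    then show ?case using insert.hyps by simp
  qed (use zero in auto)
qed

lemma coeff_pcompose_shift:
  fixes F :: "real poly"
  assumes "degree F \<le> k"
  shows "coeff (pcompose F [:a, 1:]) k = coeff F k"
proof (cases "degree F = k")
  case True
  have "lead_coeff (pcompose F [:a, 1:]) = lead_coeff F"
    by (subst lead_coeff_comp) auto
  then show ?thesis using True by (simp add: degree_pcompose)
next
  case False
  then show ?thesis using assms by (simp add: coeff_eq_0 degree_pcompose)
qed

text \<open>The reindexing \<open>h\<close> stands for \<open>n \<mapsto> n + a\<close> as well as for truncated subtraction, where the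
  equation only holds for large \<open>n\<close>.\<close>

lemma eventually_poly_shift:
  assumes "eventually_poly k c f" and h: "\<And>n. n \<ge> M \<Longrightarrow> real (h n) = real n + a"
    and lim: "\<And>N. \<exists>M. \<forall>n\<ge>M. N \<le> h n"
  shows "eventually_poly k c (\<lambda>n. f (h n))"
proof -
  obtain F N where F: "degree F \<le> k" "coeff F k = c" "\<And>n. n \<ge> N \<Longrightarrow> f n = poly F (real n)"
    using assms(1) unfolding eventually_poly_def by blast
  obtain M' where M': "\<And>n. n \<ge> M' \<Longrightarrow> N \<le> h n" using lim by blast
  show ?thesis
  proof (rule eventually_polyI[of "pcompose F [:a, 1:]" _ _ "max M M'"])
    show "degree (pcompose F [:a, 1:]) \<le> k" using F(1) by (simp add: degree_pcompose)
    show "coeff (pcompose F [:a, 1:]) k = c" using F by (simp add: coeff_pcompose_shift)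
    fix n assume "max M M' \<le> n"
    then show "f (h n) = poly (pcompose F [:a, 1:]) (real n)"
      using F(3)[of "h n"] M'[of n] h[of n] by (simp add: poly_pcompose add.commute)
  qed
qed

text \<open>The difference of the monomial of degree \<open>k + 1\<close> has leading term \<open>(k + 1) x\<^sup>k\<close>, so a multiple of
  it reduces the degree of \<open>F\<close>.\<close>

lemma polynomial_antidifference:
  fixes F :: "real poly"
  assumes "degree F \<le> k"
  shows "\<exists>G. degree G \<le> Suc k \<and> coeff G (Suc k) = coeff F k / real (Suc k) \<and>
    (\<forall>x. poly G (x + 1) - poly G x = poly F x)"
  using assms
proof (induction k arbitrary: F)
  case 0
  then obtain c where "F = [:c:]" by (metis degree_eq_zeroE le_zero_eq)
  then show ?case by (intro exI[of _ "[:0, c:]"]) (auto simp: algebra_simps)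
next
  case (Suc k)
  define m :: "real poly" where "m = monom 1 (Suc (Suc k))"
  define D where "D = pcompose m [:1, 1:] - m"
  define e where "e = coeff F (Suc k) / real (Suc (Suc k))"
  have comp: "pcompose m [:1, 1:] = [:1, 1:] ^ Suc (Suc k)"
    by (rule poly_eq_poly_eq_iff[THEN iffD1], rule ext)
      (simp add: m_def poly_pcompose poly_monom del: power_Suc)
  have cD: "coeff D i = real (Suc (Suc k) choose i) - (if i = Suc (Suc k) then 1 else 0)" for i
  proof (cases "i \<le> Suc (Suc k)")
    case True
    then show ?thesis unfolding D_def comp coeff_diff coeff_linear_poly_power[OF True] by (auto simp: m_def)
  next
    case False
    then have "coeff ([:1, 1:] ^ Suc (Suc k) :: real poly) i = 0"
      by (intro coeff_eq_0) (simp add: degree_linear_power del: power_Suc)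
    then show ?thesis using False unfolding D_def comp coeff_diff
      by (simp add: m_def binomial_eq_0 del: power_Suc binomial_Suc_Suc)
  qed
  have "coeff (F - smult e D) i = 0" if "i > k" for i
  proof -
    consider "i = Suc k" | "i = Suc (Suc k)" | "i > Suc (Suc k)" using \<open>i > k\<close> by linarith
    then show ?thesis
    proof cases
      case 1
      have "Suc (Suc k) choose Suc k = Suc (Suc k)" by (metis binomial_Suc_n)
      then show ?thesis using 1 by (simp add: cD e_def del: binomial_Suc_Suc)
    qed (use Suc.prems in \<open>auto simp: cD coeff_eq_0 binomial_eq_0\<close>)
  qed
  then have "degree (F - smult e D) \<le> k" by (intro degree_le) auto
  then obtain G where G: "degree G \<le> Suc k" "\<And>x. poly G (x + 1) - poly G x = poly (F - smult e D) x"
    using Suc.IH by blast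
  have D: "poly D x = poly m (x + 1) - poly m x" for x
    by (simp add: D_def poly_pcompose add.commute)
  show ?case
  proof (intro exI[of _ "G + smult e m"] conjI allI)
    have "degree (smult e m) \<le> Suc (Suc k)" unfolding m_def
      by (meson degree_monom_le degree_smult_le order_trans)
    then show "degree (G + smult e m) \<le> Suc (Suc k)" using G(1) by (intro degree_add_le) auto
    show "coeff (G + smult e m) (Suc (Suc k)) = coeff F (Suc k) / real (Suc (Suc k))"
      using G(1) by (simp add: m_def coeff_eq_0 e_def)
    show "poly (G + smult e m) (x + 1) - poly (G + smult e m) x = poly F x" for x
      using G(2)[of x] D[of x] by (simp add: algebra_simps)
  qed
qed

lemma eventually_poly_partial_sums:
  assumes "eventually_poly k c f"
  shows "eventually_poly (Suc k) (c / real (Suc k)) (\<lambda>n. \<Sum>j<n. f j)"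
proof -
  obtain F N where F: "degree F \<le> k" "coeff F k = c" "\<And>n. n \<ge> N \<Longrightarrow> f n = poly F (real n)"
    using assms(1) unfolding eventually_poly_def by blast
  obtain G where G: "degree G \<le> Suc k" "coeff G (Suc k) = c / real (Suc k)"
      "\<And>x. poly G (x + 1) - poly G x = poly F x"
    using polynomial_antidifference[OF F(1)] F(2) by blast
  define e where "e = (\<Sum>j<N. f j) - poly G (real N)"
  show ?thesis
  proof (rule eventually_polyI[of "G + [:e:]" _ _ N])
    show "degree (G + [:e:]) \<le> Suc k" using G(1) by (intro degree_add_le) auto
    show "coeff (G + [:e:]) (Suc k) = c / real (Suc k)" using G(2) by simp
    fix n assume "N \<le> n"
    then show "(\<Sum>j<n. f j) = poly (G + [:e:]) (real n)"
    proof (induction n rule: dec_induct)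
      case base
      then show ?case by (simp add: e_def)
    next
      case (step n)
      have "(\<Sum>j<Suc n. f j) = poly (G + [:e:]) (real n) + f n" using step by simp
      also have "f n = poly G (real n + 1) - poly G (real n)" using F(3) G(3) step by simp
      finally show ?case by (simp add: add.commute)
    qed
  qed
qed

definition exponents :: "'v set \<Rightarrow> nat \<Rightarrow> ('v \<Rightarrow>\<^sub>0 nat) set"
  where "exponents V n = {\<alpha>. keys \<alpha> \<subseteq> V \<and> (\<Sum>v\<in>V. lookup \<alpha> v) = n}"

lemma finite_exponents:
  fixes V :: "'v set"
  assumes "finite V"
  shows "finite (exponents V n)"
proof (rule finite_subset)
  show "exponents V n \<subseteq> {\<alpha>. keys \<alpha> \<subseteq> V \<and> (\<forall>v. lookup \<alpha> v \<le> n)}"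
  proof (rule subsetI, intro CollectI conjI allI)
    fix \<alpha> assume \<alpha>: "\<alpha> \<in> exponents V n"
    then show "keys \<alpha> \<subseteq> V" by (simp add: exponents_def)
    show "lookup \<alpha> v \<le> n" for v
    proof (cases "v \<in> V")
      case True
      then have "lookup \<alpha> v \<le> (\<Sum>v\<in>V. lookup \<alpha> v)"
        using assms by (intro member_le_sum) auto
      then show ?thesis using \<alpha> by (simp add: exponents_def)
    next
      case False
      then have "v \<notin> keys \<alpha>" using \<alpha> by (auto simp: exponents_def)
      then show ?thesis by (simp add: in_keys_iff)
    qed
  qed
  show "finite {\<alpha>::'v \<Rightarrow>\<^sub>0 nat. keys \<alpha> \<subseteq> V \<and> (\<forall>v. lookup \<alpha> v \<le> n)}"
    by (rule finite_bounded_exponents[OF assms])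
qed

lemma sum_exponents_insert:
  fixes f :: "('v \<Rightarrow>\<^sub>0 nat) \<Rightarrow> 'c::comm_monoid_add"
  assumes V: "finite V" "x \<notin> V"
  shows "(\<Sum>\<alpha>\<in>exponents (insert x V) n. f \<alpha>) =
    (\<Sum>m\<le>n. \<Sum>\<beta>\<in>exponents V (n - m). f (\<beta> + single x m))"
proof -
  let ?h = "\<lambda>(m, \<beta>). \<beta> + single x m"
  have x0: "lookup \<beta> x = 0" if "keys \<beta> \<subseteq> V" for \<beta> :: "'v \<Rightarrow>\<^sub>0 nat"
    using that V(2) by (auto simp: in_keys_iff subset_iff)
  have sum_single: "(\<Sum>v\<in>V. lookup (\<beta> + single x m) v) = (\<Sum>v\<in>V. lookup \<beta> v)"
    for \<beta> :: "'v \<Rightarrow>\<^sub>0 nat" and m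
    using V(2) by (intro sum.cong) (auto simp: lookup_add lookup_single when_def)
  have "bij_betw ?h (SIGMA m:{..n}. exponents V (n - m)) (exponents (insert x V) n)"
  proof (rule bij_betw_imageI)
    show "inj_on ?h (SIGMA m:{..n}. exponents V (n - m))"
    proof (rule inj_onI, clarsimp simp: exponents_def)
      fix m \<beta> m' \<beta>'
      assume k: "keys (\<beta> :: 'v \<Rightarrow>\<^sub>0 nat) \<subseteq> V" "keys (\<beta>' :: 'v \<Rightarrow>\<^sub>0 nat) \<subseteq> V"
        and eq: "\<beta> + single x m = \<beta>' + single x m'"
      have "m = m'"
        using arg_cong[OF eq, of "\<lambda>\<gamma>. lookup \<gamma> x"] x0[OF k(1)] x0[OF k(2)]
        by (simp add: lookup_add)
      then show "m = m' \<and> \<beta> = \<beta>'" using eq by simp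
    qed
    show "?h ` (SIGMA m:{..n}. exponents V (n - m)) = exponents (insert x V) n"
    proof (intro equalityI subsetI)
      fix \<alpha> assume "\<alpha> \<in> ?h ` (SIGMA m:{..n}. exponents V (n - m))"
      then obtain m \<beta> where m: "m \<le> n" "\<beta> \<in> exponents V (n - m)" "\<alpha> = \<beta> + single x m"
        by auto
      then have k: "keys \<beta> \<subseteq> V" by (simp add: exponents_def)
      show "\<alpha> \<in> exponents (insert x V) n"
        using m k x0[OF k] V sum_single[of \<beta> m] by (auto simp: exponents_def keys_add_nat lookup_add)
    next
      fix \<alpha> assume \<alpha>: "\<alpha> \<in> exponents (insert x V) n"
      then have "keys \<alpha> \<subseteq> insert x V" by (simp add: exponents_def)
      then obtain \<beta> m where \<beta>: "keys \<beta> \<subseteq> V - {x}" "\<alpha> = \<beta> + single x m"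
        by (rule split_exponent)
      then have k: "keys \<beta> \<subseteq> V" by auto
      have "(\<Sum>v\<in>V. lookup \<beta> v) + m = n"
        using \<alpha> V x0[OF k] sum_single[of \<beta> m] by (simp add: exponents_def \<beta>(2) lookup_add)
      then have "(m, \<beta>) \<in> (SIGMA m:{..n}. exponents V (n - m))" using k by (auto simp: exponents_def)
      then show "\<alpha> \<in> ?h ` (SIGMA m:{..n}. exponents V (n - m))" using \<beta>(2) by force
    qed
  qed
  then have "(\<Sum>\<alpha>\<in>exponents (insert x V) n. f \<alpha>) = (\<Sum>z\<in>(SIGMA m:{..n}. exponents V (n - m)). f (?h z))"
    by (rule sum.reindex_bij_betw[symmetric])
  also have "\<dots> = (\<Sum>m\<le>n. \<Sum>\<beta>\<in>exponents V (n - m). f (\<beta> + single x m))"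
    by (subst sum.Sigma) (auto simp: finite_exponents V(1) intro!: sum.cong)
  finally show ?thesis .
qed

lemma truncate_add_right: "truncate N (\<alpha> + truncate N \<beta>) = truncate N (\<alpha> + \<beta>)"
  by (rule poly_mapping_eqI) (simp add: lookup_add min_def)

lemma truncate_add_left: "truncate N (truncate N \<alpha> + \<beta>) = truncate N (\<alpha> + \<beta>)"
  by (rule poly_mapping_eqI) (simp add: lookup_add min_def)

lemma exponents_singleton: "exponents {x} n = {single x n}"
proof (intro equalityI subsetI)
  fix \<alpha> assume \<alpha>: "\<alpha> \<in> exponents {x} n"
  have "\<alpha> = single x n"
  proof (rule poly_mapping_eqI)
    fix v show "lookup \<alpha> v = lookup (single x n) v"
      using \<alpha> by (cases "v = x") (auto simp: exponents_def lookup_single when_def in_keys_iff subset_iff)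
  qed
  then show "\<alpha> \<in> {single x n}" by simp
qed (auto simp: exponents_def)

text \<open>Split off the last variable \<open>x\<close> and sum over its exponent \<open>m\<close>. Each single \<open>m < N\<close> contributes a
  function of lower degree, while the values \<open>m \<ge> N\<close> all have the same summand and
  contribute its partial sums, which raises the degree by one and divides the top coefficient by the new
  degree. This produces the factorial, and the value at the corner of the box.\<close>

lemma eventually_poly_truncated_sum:
  fixes f :: "('v \<Rightarrow>\<^sub>0 nat) \<Rightarrow> real"
  assumes "finite V" "V \<noteq> {}"
    and "\<And>\<alpha>. keys \<alpha> \<subseteq> V \<Longrightarrow> f (truncate N \<alpha>) = f \<alpha>"
  shows "eventually_poly (card V - 1) (f (\<Sum>v\<in>V. single v N) / fact (card V - 1))
    (\<lambda>n. \<Sum>\<alpha>\<in>exponents V n. f \<alpha>)"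
  using assms
proof (induction V arbitrary: f rule: finite_ne_induct)
  case (singleton x)
  have eq: "f (single x n) = f (single x N)" if "n \<ge> N" for n
  proof -
    have "truncate N (single x n) = single x N"
      using that by (intro poly_mapping_eqI) (auto simp: lookup_single when_def)
    then show ?thesis using singleton[of "single x n"] by simp
  qed
  show ?case
  proof (rule eventually_polyI[of "[:f (single x N):]" _ _ N])
    show "(\<Sum>\<alpha>\<in>exponents {x} n. f \<alpha>) = poly [:f (single x N):] (real n)" if "N \<le> n" for n
      using eq[OF that] by (simp add: exponents_singleton)
  qed simp_all
next
  case (insert x V)
  let ?s = "\<lambda>m. single x m"
  define H where "H m n = (\<Sum>\<beta>\<in>exponents V n. f (\<beta> + ?s m))" for m n
  define c where "c m = f ((\<Sum>v\<in>V. single v N) + ?s m) / fact (card V - 1)" for m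
  have card: "card (insert x V) - 1 = Suc (card V - 1)"
    using insert.hyps by (simp add: card_gt_0_iff)
  have H: "eventually_poly (card V - 1) (c m) (H m)" for m
    unfolding H_def c_def
  proof (rule insert.IH)
    fix \<beta> :: "'v \<Rightarrow>\<^sub>0 nat" assume \<beta>: "keys \<beta> \<subseteq> V"
    have "f (truncate N \<beta> + ?s m) = f (truncate N (truncate N \<beta> + ?s m))"
      using \<beta> keys_truncate[of N \<beta>] by (intro insert.prems[symmetric]) (auto simp: keys_add_nat)
    also have "\<dots> = f (\<beta> + ?s m)"
      unfolding truncate_add_left using \<beta> by (intro insert.prems) (auto simp: keys_add_nat)
    finally show "f (truncate N \<beta> + ?s m) = f (\<beta> + ?s m)" .
  qed
  have stable: "H m n = H N n" if "m \<ge> N" for m n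
    unfolding H_def
  proof (rule sum.cong)
    fix \<beta> assume "\<beta> \<in> exponents V n"
    then have \<beta>: "keys \<beta> \<subseteq> V" by (simp add: exponents_def)
    have "truncate N (\<beta> + ?s m) = truncate N (\<beta> + ?s N)"
      using that by (intro poly_mapping_eqI) (auto simp: lookup_add lookup_single when_def)
    moreover have "f (truncate N (\<beta> + ?s m)) = f (\<beta> + ?s m)" for m
      using \<beta> by (intro insert.prems) (auto simp: keys_add_nat)
    ultimately show "f (\<beta> + ?s m) = f (\<beta> + ?s N)" by metis
  qed simp
  have "eventually_poly (Suc (card V - 1)) 0 (\<lambda>n. \<Sum>m<N. H m (n - m))"
  proof (rule eventually_poly_sum_zero)
    fix m
    show "eventually_poly (Suc (card V - 1)) 0 (\<lambda>n. H m (n - m))"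
    proof (rule eventually_poly_shift[where M = m and a = "- real m"])
      show "\<exists>M. \<forall>n\<ge>M. N \<le> n - m" for N by (rule exI[of _ "N + m"]) auto
    qed (use eventually_poly_raise_degree[OF H] in auto)
  qed
  moreover have "eventually_poly (Suc (card V - 1)) (c N / real (Suc (card V - 1))) (\<lambda>n. \<Sum>j<Suc n - N. H N j)"
  proof (rule eventually_poly_shift[where M = N and a = "1 - real N"])
    show "eventually_poly (Suc (card V - 1)) (c N / real (Suc (card V - 1))) (\<lambda>n. \<Sum>j<n. H N j)"
      by (rule eventually_poly_partial_sums[OF H])
    show "\<exists>M. \<forall>n\<ge>M. K \<le> Suc n - N" for K by (rule exI[of _ "N + K"]) auto
  qed auto
  ultimately have "eventually_poly (Suc (card V - 1)) (0 + c N / real (Suc (card V - 1)))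
      (\<lambda>n. (\<Sum>m<N. H m (n - m)) + (\<Sum>j<Suc n - N. H N j))"
    by (rule eventually_poly_add)
  then have "eventually_poly (Suc (card V - 1)) (0 + c N / real (Suc (card V - 1)))
      (\<lambda>n. \<Sum>\<alpha>\<in>exponents (insert x V) n. f \<alpha>)"
  proof (rule eventually_poly_cong[where M = N])
    fix n assume n: "N \<le> n"
    have "(\<Sum>\<alpha>\<in>exponents (insert x V) n. f \<alpha>) = (\<Sum>m\<le>n. H m (n - m))"
      unfolding H_def using insert.hyps by (intro sum_exponents_insert) auto
    also have "{..n} = {..<N} \<union> {N..n}" using n by auto
    also have "(\<Sum>m\<in>{..<N} \<union> {N..n}. H m (n - m)) = (\<Sum>m<N. H m (n - m)) + (\<Sum>m=N..n. H m (n - m))"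
      by (rule sum.union_disjoint) auto
    also have "(\<Sum>m=N..n. H m (n - m)) = (\<Sum>m=N..n. H N (n - m))"
      by (intro sum.cong refl stable) simp
    also have "\<dots> = (\<Sum>j<Suc n - N. H N j)"
      by (rule sum.reindex_bij_witness[of _ "\<lambda>j. n - j" "\<lambda>m. n - m"]) (use n in auto)
    finally show "(\<Sum>\<alpha>\<in>exponents (insert x V) n. f \<alpha>) = (\<Sum>m<N. H m (n - m)) + (\<Sum>j<Suc n - N. H N j)" .
  qed
  moreover have "0 + c N / real (Suc (card V - 1)) =
      f (\<Sum>v\<in>insert x V. single v N) / fact (card (insert x V) - 1)"
  proof -
    have "(\<Sum>v\<in>insert x V. single v N) = (\<Sum>v\<in>V. single v N) + ?s N"
      using insert.hyps by (simp add: add.commute)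
    moreover have "fact (Suc (card V - 1)) = fact (card V - 1) * real (Suc (card V - 1))"
      by (simp only: fact_Suc of_nat_mult mult.commute)
    ultimately show ?thesis unfolding card c_def by (simp only: add_0_left divide_divide_eq_left)
  qed
  ultimately show ?case unfolding card by (simp only:)
qed

section \<open>Eventually polynomial functions of two variables\<close>

text \<open>The way in which the Buchsbaum--Rim polynomial is evaluated in its definition.\<close>

definition poly2 :: "real poly poly \<Rightarrow> nat \<Rightarrow> nat \<Rightarrow> real"
  where "poly2 P p q = poly (poly P [:real p:]) (real q)"

definition eventually_poly2 :: "(nat \<Rightarrow> nat \<Rightarrow> real) \<Rightarrow> bool"
  where "eventually_poly2 h \<longleftrightarrow> (\<exists>P N. \<forall>p\<ge>N. \<forall>q\<ge>N. h p q = poly2 P p q)"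

lemma eventually_poly2I:
  "(\<And>p q. p \<ge> N \<Longrightarrow> q \<ge> N \<Longrightarrow> h p q = poly2 P p q) \<Longrightarrow> eventually_poly2 h"
  unfolding eventually_poly2_def by blast

lemma eventually_poly2_cong:
  assumes "eventually_poly2 f" "\<And>p q. q \<ge> M \<Longrightarrow> g p q = f p q"
  shows "eventually_poly2 g"
proof -
  obtain P N where P: "\<And>p q. p \<ge> N \<Longrightarrow> q \<ge> N \<Longrightarrow> f p q = poly2 P p q"
    using assms(1) unfolding eventually_poly2_def by blast
  show ?thesis by (rule eventually_poly2I[of "max M N" _ P]) (simp add: assms(2) P)
qed

lemma eventually_poly2_add:
  assumes "eventually_poly2 f" "eventually_poly2 g"
  shows "eventually_poly2 (\<lambda>p q. f p q + g p q)"
proof -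
  obtain P N where P: "\<And>p q. p \<ge> N \<Longrightarrow> q \<ge> N \<Longrightarrow> f p q = poly2 P p q"
    using assms(1) unfolding eventually_poly2_def by blast
  obtain Q M where Q: "\<And>p q. p \<ge> M \<Longrightarrow> q \<ge> M \<Longrightarrow> g p q = poly2 Q p q"
    using assms(2) unfolding eventually_poly2_def by blast
  show ?thesis by (rule eventually_poly2I[of "max M N" _ "P + Q"]) (simp add: P Q, simp add: poly2_def)
qed

lemma eventually_poly2_mult:
  assumes "eventually_poly2 f" "eventually_poly2 g"
  shows "eventually_poly2 (\<lambda>p q. f p q * g p q)"
proof -
  obtain P N where P: "\<And>p q. p \<ge> N \<Longrightarrow> q \<ge> N \<Longrightarrow> f p q = poly2 P p q"
    using assms(1) unfolding eventually_poly2_def by blast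
  obtain Q M where Q: "\<And>p q. p \<ge> M \<Longrightarrow> q \<ge> M \<Longrightarrow> g p q = poly2 Q p q"
    using assms(2) unfolding eventually_poly2_def by blast
  show ?thesis by (rule eventually_poly2I[of "max M N" _ "P * Q"]) (simp add: P Q, simp add: poly2_def)
qed

lemma eventually_poly2_const: "eventually_poly2 (\<lambda>_ _. c)"
  by (rule eventually_poly2I[of 0 _ "[:[:c:]:]"]) (simp add: poly2_def)

lemma eventually_poly2_sum:
  assumes "\<And>i. i \<in> A \<Longrightarrow> eventually_poly2 (f i)"
  shows "eventually_poly2 (\<lambda>p q. \<Sum>i\<in>A. f i p q)"
  using assms
proof (induction A rule: infinite_finite_induct)
  case (insert i A)
  then have "eventually_poly2 (\<lambda>p q. f i p q + (\<Sum>i\<in>A. f i p q))"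
    by (intro eventually_poly2_add) auto
  then show ?case using insert.hyps by simp
qed (use eventually_poly2_const[of 0] in auto)

lemma eventually_poly2_total_degree: "eventually_poly2 (\<lambda>p q. real (p + q))"
  by (rule eventually_poly2I[of 0 _ "[:[:0, 1:], 1:]"]) (simp add: poly2_def)

lemma eventually_poly2_of_eventually_poly:
  assumes "eventually_poly k c g"
  shows "eventually_poly2 (\<lambda>p q. g p)"
proof -
  obtain F N where F: "\<And>n. n \<ge> N \<Longrightarrow> g n = poly F (real n)"
    using assms(1) unfolding eventually_poly_def by blast
  have "poly (map_poly (\<lambda>c. [:c:]) F) [:x:] = [:poly F x:]" for x
    by (induction F) (simp_all add: map_poly_pCons)
  then show ?thesis
    by (intro eventually_poly2I[of N _ "map_poly (\<lambda>c. [:c:]) F"]) (simp add: poly2_def F)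
qed

lemma eventually_poly_times_index:
  assumes "eventually_poly k c b"
  shows "eventually_poly (Suc k) c (\<lambda>n. real n * b n)"
proof -
  obtain F N where F: "degree F \<le> k" "coeff F k = c" "\<And>n. n \<ge> N \<Longrightarrow> b n = poly F (real n)"
    using assms(1) unfolding eventually_poly_def by blast
  show ?thesis
    by (rule eventually_polyI[of "pCons 0 F" _ _ N]) (use F in \<open>auto intro: order_trans[OF degree_pCons_le]\<close>)
qed

text \<open>With \<open>n = p + q\<close>, write \<open>A(n - k) = a + (n - k) A'(n - k)\<close>. The factor \<open>n\<close> is a polynomial in
  \<open>p\<close> and \<open>q\<close>, and the factor \<open>k\<close> can be absorbed into \<open>b\<close>.\<close>

lemma eventually_poly2_convolution_poly:
  assumes "eventually_poly k c b"
  shows "eventually_poly2 (\<lambda>p q. \<Sum>k<p. poly A (real (p + q) - real k) * b k)"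
  using assms
proof (induction A arbitrary: k c b)
  case 0
  then show ?case using eventually_poly2_const[of 0] by simp
next
  case (pCons a A)
  define S where "S b p q = (\<Sum>k<p. poly A (real (p + q) - real k) * b k)" for b p q
  have S: "eventually_poly2 (S b')" if "eventually_poly k c b'" for k c b'
    unfolding S_def by (rule pCons.IH[OF that])
  have "eventually_poly2 (\<lambda>p q. a * (\<Sum>k<p. b k))"
    by (rule eventually_poly2_mult[OF eventually_poly2_const
          eventually_poly2_of_eventually_poly[OF eventually_poly_partial_sums[OF pCons.prems]]])
  moreover have "eventually_poly2 (\<lambda>p q. real (p + q) * S b p q)"
    by (rule eventually_poly2_mult[OF eventually_poly2_total_degree S[OF pCons.prems]])
  moreover have "eventually_poly2 (\<lambda>p q. (-1) * S (\<lambda>k. real k * b k) p q)"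
    by (rule eventually_poly2_mult[OF eventually_poly2_const S[OF eventually_poly_times_index[OF pCons.prems]]])
  ultimately have total: "eventually_poly2 (\<lambda>p q. a * (\<Sum>k<p. b k) +
      (real (p + q) * S b p q + (-1) * S (\<lambda>k. real k * b k) p q))"
    by (intro eventually_poly2_add)
  have expand: "(a + (n - m) * x) * y = a * y + (n * (x * y) + (-1) * (x * (m * y)))" for n m x y :: real
    by (simp add: algebra_simps)
  show ?case
  proof (rule eventually_poly2_cong[OF total, of 0])
    fix p q :: nat
    have "(\<Sum>k<p. poly (pCons a A) (real (p + q) - real k) * b k) =
        (\<Sum>k<p. a * b k + (real (p + q) * (poly A (real (p + q) - real k) * b k) +
          (-1) * (poly A (real (p + q) - real k) * (real k * b k))))"
      unfolding poly_pCons by (rule sum.cong[OF refl]) (rule expand)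
    also have "\<dots> = a * (\<Sum>k<p. b k) + (real (p + q) * S b p q + (-1) * S (\<lambda>k. real k * b k) p q)"
      unfolding S_def sum.distrib sum_distrib_left by (rule refl)
    finally show "(\<Sum>k<p. poly (pCons a A) (real (p + q) - real k) * b k) = \<dots>" .
  qed
qed

lemma eventually_poly2_convolution:
  assumes a: "eventually_poly k c a" and b: "eventually_poly k' c' b"
  shows "eventually_poly2 (\<lambda>p q. \<Sum>k<p. a (p + q - k) * b k)"
proof -
  obtain A N where A: "\<And>n. n \<ge> N \<Longrightarrow> a n = poly A (real n)"
    using a unfolding eventually_poly_def by blast
  show ?thesis
  proof (rule eventually_poly2_cong[OF eventually_poly2_convolution_poly[OF b, of A], of N])
    fix p q assume "N \<le> q"
    then have "a (p + q - k) = poly A (real (p + q) - real k)" if "k < p" for k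
      using A[of "p + q - k"] that by (simp add: of_nat_diff)
    then show "(\<Sum>k<p. a (p + q - k) * b k) = (\<Sum>k<p. poly A (real (p + q) - real k) * b k)"
      by simp
  qed
qed

lemma eventually_poly_truncated_sum_ex:
  fixes f :: "('v \<Rightarrow>\<^sub>0 nat) \<Rightarrow> real"
  assumes "finite V" and "\<And>\<alpha>. keys \<alpha> \<subseteq> V \<Longrightarrow> f (truncate N \<alpha>) = f \<alpha>"
  shows "\<exists>k c. eventually_poly k c (\<lambda>n. \<Sum>\<alpha>\<in>exponents V n. f \<alpha>)"
proof (cases "V = {}")
  case True
  have "eventually_poly 0 0 (\<lambda>n. \<Sum>\<alpha>\<in>exponents V n. f \<alpha>)"
    by (rule eventually_polyI[of 0 _ _ 1]) (auto simp: True exponents_def)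
  then show ?thesis by blast
next
  case False
  then show ?thesis using eventually_poly_truncated_sum[OF assms(1) False, of f N] assms(2) by blast
qed

text \<open>The weight of \<open>\<xi> + \<beta>\<close> depends on \<open>\<xi>\<close> only through its truncation \<open>c\<close>. Grouping the \<open>\<xi>\<close> by \<open>c\<close>, which
  takes finitely many values, makes the double sum a finite sum of products of a function of
  \<open>p + q - k\<close> and a function of \<open>k\<close>, and the sum over \<open>k\<close> a convolution.\<close>

lemma eventually_poly2_truncated_sum:
  fixes f :: "('v \<Rightarrow>\<^sub>0 nat) \<Rightarrow> real"
  assumes "finite X" "finite Y"
    and f: "\<And>\<alpha>. keys \<alpha> \<subseteq> X \<union> Y \<Longrightarrow> f (truncate N \<alpha>) = f \<alpha>"
  shows "eventually_poly2 (\<lambda>p q. \<Sum>k<p. \<Sum>\<xi>\<in>exponents X (p + q - k). \<Sum>\<beta>\<in>exponents Y k. f (\<xi> + \<beta>))"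
proof -
  define Box where "Box = {c::'v \<Rightarrow>\<^sub>0 nat. keys c \<subseteq> X \<and> (\<forall>v. lookup c v \<le> N)}"
  have "finite Box" unfolding Box_def by (rule finite_bounded_exponents[OF assms(1)])
  define a where "a c n = (\<Sum>\<xi>\<in>exponents X n. if truncate N \<xi> = c then 1 else 0 :: real)" for c n
  define b where "b c n = (\<Sum>\<beta>\<in>exponents Y n. f (c + \<beta>))" for c n
  have f_cong: "f \<alpha> = f \<beta>"
    if "keys \<alpha> \<subseteq> X \<union> Y" "keys \<beta> \<subseteq> X \<union> Y" "truncate N \<alpha> = truncate N \<beta>" for \<alpha> \<beta>
    using f[OF that(1)] f[OF that(2)] that(3) by simp
  have split: "(\<Sum>\<xi>\<in>exponents X m. \<Sum>\<beta>\<in>exponents Y k. f (\<xi> + \<beta>)) = (\<Sum>c\<in>Box. a c m * b c k)" for m k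
  proof -
    have "(\<Sum>\<xi>\<in>exponents X m. \<Sum>\<beta>\<in>exponents Y k. f (\<xi> + \<beta>)) =
        (\<Sum>\<xi>\<in>exponents X m. \<Sum>c\<in>Box. (if truncate N \<xi> = c then 1 else 0) * b c k)"
    proof (rule sum.cong[OF refl])
      fix \<xi> assume "\<xi> \<in> exponents X m"
      then have \<xi>: "keys \<xi> \<subseteq> X" by (simp add: exponents_def)
      have kt: "keys (truncate N \<xi>) \<subseteq> X" using keys_truncate \<xi> by (rule order_trans)
      then have "truncate N \<xi> \<in> Box" by (simp add: Box_def)
      have "(\<Sum>\<beta>\<in>exponents Y k. f (\<xi> + \<beta>)) = b (truncate N \<xi>) k"
        unfolding b_def
      proof (rule sum.cong[OF refl])
        fix \<beta> assume "\<beta> \<in> exponents Y k"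
        then have \<beta>: "keys \<beta> \<subseteq> Y" by (simp add: exponents_def)
        show "f (\<xi> + \<beta>) = f (truncate N \<xi> + \<beta>)"
          using \<xi> kt \<beta> by (intro f_cong) (auto simp: keys_add_nat truncate_add_left)
      qed
      also have "\<dots> = (\<Sum>c\<in>Box. if truncate N \<xi> = c then b c k else 0)"
        using \<open>finite Box\<close> \<open>truncate N \<xi> \<in> Box\<close> by simp
      also have "\<dots> = (\<Sum>c\<in>Box. (if truncate N \<xi> = c then 1 else 0) * b c k)"
        by (intro sum.cong) auto
      finally show "(\<Sum>\<beta>\<in>exponents Y k. f (\<xi> + \<beta>)) = \<dots>" .
    qed
    also have "\<dots> = (\<Sum>c\<in>Box. a c m * b c k)"
      unfolding a_def sum_distrib_right by (rule sum.swap)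
    finally show ?thesis .
  qed
  have conv: "eventually_poly2 (\<lambda>p q. \<Sum>k<p. a c (p + q - k) * b c k)" if c: "c \<in> Box" for c
  proof -
    have "\<exists>k d. eventually_poly k d (a c)"
      unfolding a_def by (rule eventually_poly_truncated_sum_ex[OF assms(1), of _ N]) simp
    moreover have "\<exists>k d. eventually_poly k d (b c)"
      unfolding b_def
    proof (rule eventually_poly_truncated_sum_ex[OF assms(2), of _ N])
      fix \<beta> :: "'v \<Rightarrow>\<^sub>0 nat" assume \<beta>: "keys \<beta> \<subseteq> Y"
      have kt: "keys (truncate N \<beta>) \<subseteq> Y" using keys_truncate \<beta> by (rule order_trans)
      show "f (c + truncate N \<beta>) = f (c + \<beta>)"
        using c kt \<beta> by (intro f_cong) (auto simp: Box_def keys_add_nat truncate_add_right)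
    qed
    ultimately show ?thesis using eventually_poly2_convolution by blast
  qed
  have "eventually_poly2 (\<lambda>p q. \<Sum>c\<in>Box. \<Sum>k<p. a c (p + q - k) * b c k)"
    by (rule eventually_poly2_sum[OF conv])
  then show ?thesis
    by (rule eventually_poly2_cong) (subst sum.swap, simp add: split)
qed

section \<open>A filtration indexed by monomials in generators\<close>

lemma exponent_induct [consumes 1, case_names zero add_single]:
  fixes \<alpha> :: "'v \<Rightarrow>\<^sub>0 nat"
  assumes "keys \<alpha> \<subseteq> V" and "P 0"
    and step: "\<And>\<beta> v. keys \<beta> \<subseteq> V \<Longrightarrow> v \<in> V \<Longrightarrow> P \<beta> \<Longrightarrow> P (\<beta> + single v 1)"
  shows "P \<alpha>"
  using assms(1)
proof (induction "\<Sum>v\<in>keys \<alpha>. lookup \<alpha> v" arbitrary: \<alpha>)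
  case 0
  then have "\<alpha> = 0" by (intro poly_mapping_eqI) (auto simp: in_keys_iff)
  then show ?case using assms(2) by simp
next
  case (Suc n)
  then obtain v where v: "v \<in> keys \<alpha>" by fastforce
  define \<beta> where "\<beta> = \<alpha> - single v 1"
  have \<alpha>: "\<alpha> = \<beta> + single v 1"
  proof (rule poly_mapping_eqI)
    fix w show "lookup \<alpha> w = lookup (\<beta> + single v 1) w"
      using v by (cases "w = v") (auto simp: \<beta>_def lookup_add lookup_minus lookup_single in_keys_iff)
  qed
  have k: "keys \<beta> \<subseteq> keys \<alpha>" unfolding \<beta>_def by (rule keys_diff_nat)
  have "(\<Sum>w\<in>keys \<alpha>. lookup \<alpha> w) =
      (\<Sum>w\<in>keys \<alpha>. lookup \<beta> w) + (\<Sum>w\<in>keys \<alpha>. if v = w then 1 else 0)"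
    unfolding sum.distrib[symmetric]
    by (rule sum.cong[OF refl], subst \<alpha>) (simp add: lookup_add lookup_single when_def)
  then have "n = (\<Sum>w\<in>keys \<alpha>. lookup \<beta> w)" using Suc.hyps(2) v by simp
  also have "\<dots> = (\<Sum>w\<in>keys \<beta>. lookup \<beta> w)"
    by (rule sum.mono_neutral_right) (use k in \<open>auto simp: in_keys_iff\<close>)
  finally have "P \<beta>" using k Suc.prems by (intro Suc.hyps(1)) auto
  then have "P (\<beta> + single v 1)" using k Suc.prems v by (intro step) auto
  then show ?case using \<alpha> by simp
qed

lemma mult_span_subset:
  fixes e :: "'a::comm_ring_1"
  assumes "x \<in> ideal_generated A" "\<And>y. y \<in> A \<Longrightarrow> e * y \<in> ideal_generated B"
  shows "e * x \<in> ideal_generated B"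
proof -
  have "is_ideal {x. e * x \<in> ideal_generated B}"
  proof (rule R.subspaceI)
    fix c x assume "x \<in> {x. e * x \<in> ideal_generated B}"
    then have "e * x \<in> ideal_generated B" by simp
    then have "c * (e * x) \<in> ideal_generated B" by (rule R.span_scale)
    then show "c * x \<in> {x. e * x \<in> ideal_generated B}" by (simp only: mem_Collect_eq mult.left_commute[of e])
  qed (auto simp: R.span_zero R.span_add distrib_left)
  then have "ideal_generated A \<subseteq> {x. e * x \<in> ideal_generated B}"
    using assms(2) by (intro R.span_minimal) auto
  then show ?thesis using assms(1) by auto
qed

text \<open>The variables in \<open>Y\<close> stand for generators of the ideals: \<open>y\<close> stands for the element \<open>a y\<close> of the ideal
  with index \<open>\<pi> y\<close>. The variables in \<open>X\<close> stand for the coordinates \<open>x\<^sub>1, \<dots>, x\<^sub>r\<close> of \<open>Sym(R\<^sup>r)\<close>; giving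
  them the value \<open>1\<close> treats both kinds alike. A monomial in all these variables maps to the
  element \<open>val \<alpha> \<cdot> x\<^bsup>wt \<alpha>\<^esup>\<close> of \<open>M\<^sup>k S\<close>, where \<open>k = Ydeg \<alpha>\<close>.\<close>

locale generator_system =
  fixes X Y :: "'v::linorder set" and \<pi> :: "'v \<Rightarrow> nat" and a :: "'v \<Rightarrow> 'a::comm_ring_1" and r :: nat
  assumes finite_X: "finite X" and finite_Y: "finite Y" and disjoint: "X \<inter> Y = {}"
    and \<pi>_range: "\<And>v. v \<in> X \<union> Y \<Longrightarrow> \<pi> v \<in> {1..r}"
    and \<pi>_surj: "\<And>i. i \<in> {1..r} \<Longrightarrow> \<exists>x\<in>X. \<pi> x = i"
    and a_X: "\<And>x. x \<in> X \<Longrightarrow> a x = 1"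
begin

definition gen_ideal :: "nat \<Rightarrow> 'a set"
  where "gen_ideal i = ideal_generated (a ` {y \<in> Y. \<pi> y = i})"

definition val :: "('v \<Rightarrow>\<^sub>0 nat) \<Rightarrow> 'a"
  where "val \<alpha> = (\<Prod>v\<in>X \<union> Y. a v ^ lookup \<alpha> v)"

definition wt :: "('v \<Rightarrow>\<^sub>0 nat) \<Rightarrow> (nat \<Rightarrow>\<^sub>0 nat)"
  where "wt \<alpha> = (\<Sum>v\<in>X \<union> Y. single (\<pi> v) (lookup \<alpha> v))"

definition Ydeg :: "('v \<Rightarrow>\<^sub>0 nat) \<Rightarrow> nat"
  where "Ydeg \<alpha> = (\<Sum>y\<in>Y. lookup \<alpha> y)"

definition E :: "nat \<Rightarrow> (nat \<Rightarrow>\<^sub>0 nat) \<Rightarrow> ('v \<Rightarrow>\<^sub>0 nat) set"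
  where "E k \<gamma> = {\<alpha>. keys \<alpha> \<subseteq> X \<union> Y \<and> wt \<alpha> = \<gamma> \<and> Ydeg \<alpha> = k}"

text \<open>Since \<open>X\<close>-variables have value \<open>1\<close> and fill up the multidegree, \<open>J k \<gamma>\<close> is generated by the products of
  \<open>k\<close> generators of which at most \<open>\<gamma>\<^sub>i\<close> come from the \<open>i\<close>-th ideal.\<close>

definition J :: "nat \<Rightarrow> (nat \<Rightarrow>\<^sub>0 nat) \<Rightarrow> 'a set"
  where "J k \<gamma> = ideal_generated (val ` E k \<gamma>)"

text \<open>The annihilator of the class of \<open>val \<alpha>\<close> in the quotient of \<open>J k \<gamma>\<close> by \<open>J (k + 1) \<gamma>\<close> and by the
  monomials that precede \<open>\<alpha>\<close> in lexicographic order. This is the ideal of leading coefficients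
  at \<open>\<alpha>\<close> of the relations in the associated graded module.\<close>

definition colon :: "('v \<Rightarrow>\<^sub>0 nat) \<Rightarrow> 'a set"
  where "colon \<alpha> = {c. c * val \<alpha> \<in>
    ideal_generated (J (Suc (Ydeg \<alpha>)) (wt \<alpha>) \<union> val ` {\<beta> \<in> E (Ydeg \<alpha>) (wt \<alpha>). \<beta> < \<alpha>})}"

lemma val_add: "val (\<alpha> + \<beta>) = val \<alpha> * val \<beta>"
  by (simp add: val_def lookup_add power_add prod.distrib)

lemma val_single: "v \<in> X \<union> Y \<Longrightarrow> val (single v n) = a v ^ n"
proof -
  assume v: "v \<in> X \<union> Y"
  have "val (single v n) = (\<Prod>w\<in>X \<union> Y. if v = w then a v ^ n else 1)"
    unfolding val_def by (rule prod.cong) (auto simp: lookup_single when_def)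
  then show ?thesis using v finite_X finite_Y by simp
qed

lemma wt_add: "wt (\<alpha> + \<beta>) = wt \<alpha> + wt \<beta>"
  by (simp add: wt_def lookup_add single_add sum.distrib)

lemma wt_zero [simp]: "wt 0 = 0"
  by (simp add: wt_def)

lemma wt_single: "v \<in> X \<union> Y \<Longrightarrow> wt (single v n) = single (\<pi> v) n"
proof -
  assume v: "v \<in> X \<union> Y"
  have "wt (single v n) = (\<Sum>w\<in>X \<union> Y. if v = w then single (\<pi> v) n else 0)"
    unfolding wt_def by (rule sum.cong) (auto simp: lookup_single when_def)
  then show ?thesis using v finite_X finite_Y by simp
qed

lemma Ydeg_add: "Ydeg (\<alpha> + \<beta>) = Ydeg \<alpha> + Ydeg \<beta>"
  by (simp add: Ydeg_def lookup_add sum.distrib)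

lemma Ydeg_single: "Ydeg (single v n) = (if v \<in> Y then n else 0)"
  using finite_Y by (simp add: Ydeg_def lookup_single when_def)

lemma keys_wt: "keys (wt \<alpha>) \<subseteq> {1..r}"
proof
  fix i assume "i \<in> keys (wt \<alpha>)"
  then have "(\<Sum>v\<in>X \<union> Y. lookup (single (\<pi> v) (lookup \<alpha> v)) i) \<noteq> 0"
    by (simp add: in_keys_iff wt_def lookup_sum)
  then obtain v where "v \<in> X \<union> Y" "lookup (single (\<pi> v) (lookup \<alpha> v)) i \<noteq> 0"
    by (rule sum.not_neutral_contains_not_neutral)
  then have "v \<in> X \<union> Y" "\<pi> v = i" by (auto simp: lookup_single when_def split: if_splits)
  then show "i \<in> {1..r}" using \<pi>_range by blast
qed

lemma total_degree_wt:
  "(\<Sum>i=1..r. lookup (wt \<alpha>) i) = (\<Sum>v\<in>X \<union> Y. lookup \<alpha> v)"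
proof -
  have "(\<Sum>i=1..r. lookup (wt \<alpha>) i) =
      (\<Sum>i=1..r. \<Sum>v\<in>X \<union> Y. lookup (single (\<pi> v) (lookup \<alpha> v)) i)"
    by (simp only: wt_def lookup_sum)
  also have "\<dots> = (\<Sum>v\<in>X \<union> Y. \<Sum>i=1..r. lookup (single (\<pi> v) (lookup \<alpha> v)) i)"
    by (rule sum.swap)
  also have "\<dots> = (\<Sum>v\<in>X \<union> Y. lookup \<alpha> v)"
  proof (rule sum.cong[OF refl])
    fix v assume v: "v \<in> X \<union> Y"
    have "(\<Sum>i=1..r. lookup (single (\<pi> v) (lookup \<alpha> v)) i) =
        (\<Sum>i=1..r. if \<pi> v = i then lookup \<alpha> v else 0)"
      by (rule sum.cong) (simp_all add: lookup_single when_def)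
    then show "(\<Sum>i=1..r. lookup (single (\<pi> v) (lookup \<alpha> v)) i) = lookup \<alpha> v"
      using \<pi>_range[OF v] by simp
  qed
  finally show ?thesis .
qed

lemma total_degree_split:
  "(\<Sum>v\<in>X \<union> Y. lookup \<alpha> v) = (\<Sum>x\<in>X. lookup \<alpha> x) + Ydeg \<alpha>"
  unfolding Ydeg_def using finite_X finite_Y disjoint by (rule sum.union_disjoint)

lemma val_X: "keys \<xi> \<subseteq> X \<Longrightarrow> val \<xi> = 1"
  and Ydeg_X: "keys \<xi> \<subseteq> X \<Longrightarrow> Ydeg \<xi> = 0"
proof -
  assume \<xi>: "keys \<xi> \<subseteq> X"
  have zero: "lookup \<xi> y = 0" if "y \<in> Y" for y
  proof -
    have "y \<notin> keys \<xi>" using \<xi> that disjoint by blast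
    then show ?thesis by (simp add: in_keys_iff)
  qed
  show "val \<xi> = 1" unfolding val_def by (rule prod.neutral) (auto simp: a_X zero)
  show "Ydeg \<xi> = 0" unfolding Ydeg_def by (rule sum.neutral) (auto simp: zero)
qed

lemma lift_weight:
  assumes "keys \<delta> \<subseteq> {1..r}"
  obtains \<xi> where "keys \<xi> \<subseteq> X" "wt \<xi> = \<delta>"
proof -
  have "\<exists>\<xi>. keys \<xi> \<subseteq> X \<and> wt \<xi> = \<delta>"
    using assms
  proof (induction rule: exponent_induct)
    case zero
    then show ?case by (intro exI[of _ 0]) simp
  next
    case (add_single \<beta> i)
    then obtain \<xi> where \<xi>: "keys \<xi> \<subseteq> X" "wt \<xi> = \<beta>" by blast
    obtain x where x: "x \<in> X" "\<pi> x = i" using \<pi>_surj[OF add_single(2)] by blast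
    show ?case
      using \<xi> x by (intro exI[of _ "\<xi> + single x 1"]) (simp add: keys_add_nat wt_add wt_single)
  qed
  then show ?thesis using that by blast
qed

lemma split_XY:
  fixes \<alpha> :: "'v \<Rightarrow>\<^sub>0 nat"
  assumes "keys \<alpha> \<subseteq> X \<union> Y"
  obtains \<xi> \<beta> where "keys \<xi> \<subseteq> X" "keys \<beta> \<subseteq> Y" "\<alpha> = \<xi> + \<beta>"
proof -
  have "\<exists>\<xi> \<beta>. keys \<xi> \<subseteq> X \<and> keys \<beta> \<subseteq> Y \<and> \<alpha> = \<xi> + \<beta>"
    using assms
  proof (induction rule: exponent_induct)
    case zero
    then show ?case by (intro exI[of _ 0]) simp
  next
    case (add_single \<alpha> v)
    then obtain \<xi> \<beta> where IH: "keys \<xi> \<subseteq> X" "keys \<beta> \<subseteq> Y" "\<alpha> = \<xi> + \<beta>" by blast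
    from add_single(2) show ?case
    proof
      assume "v \<in> X"
      then show ?thesis using IH
        by (intro exI[of _ "\<xi> + single v 1"] exI[of _ \<beta>]) (simp add: keys_add_nat ac_simps)
    next
      assume "v \<in> Y"
      then show ?thesis using IH
        by (intro exI[of _ \<xi>] exI[of _ "\<beta> + single v 1"]) (simp add: keys_add_nat ac_simps)
    qed
  qed
  then show ?thesis using that by blast
qed

lemma remove_variable:
  fixes \<alpha> :: "'v \<Rightarrow>\<^sub>0 nat"
  assumes "v \<in> X \<union> Y" "lookup \<alpha> v > 0" "keys \<alpha> \<subseteq> X \<union> Y"
  obtains \<beta> where "\<alpha> = \<beta> + single v 1" "keys \<beta> \<subseteq> X \<union> Y"
proof
  show "\<alpha> = (\<alpha> - single v 1) + single v 1"
  proof (rule poly_mapping_eqI)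
    fix w show "lookup \<alpha> w = lookup ((\<alpha> - single v 1) + single v 1) w"
      using assms(2) by (cases "w = v") (auto simp: lookup_add lookup_minus lookup_single)
  qed
  show "keys (\<alpha> - single v 1) \<subseteq> X \<union> Y"
    using keys_diff_nat assms(3) by (rule order_trans)
qed

lemma finite_E: "finite (E k \<gamma>)"
proof (rule finite_subset)
  show "E k \<gamma> \<subseteq> exponents (X \<union> Y) (\<Sum>i=1..r. lookup \<gamma> i)"
    using total_degree_wt by (auto simp: E_def exponents_def)
qed (simp add: finite_exponents finite_X finite_Y)

lemma J_ideal: "is_ideal (J k \<gamma>)"
  by (simp add: J_def)

lemma val_in_J: "\<alpha> \<in> E k \<gamma> \<Longrightarrow> val \<alpha> \<in> J k \<gamma>"
  unfolding J_def by (intro R.span_base imageI)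

lemma E_add: "\<alpha> \<in> E k \<gamma> \<Longrightarrow> keys \<beta> \<subseteq> X \<union> Y \<Longrightarrow> \<alpha> + \<beta> \<in> E (k + Ydeg \<beta>) (\<gamma> + wt \<beta>)"
  by (simp add: E_def keys_add_nat wt_add Ydeg_add)

lemma J_mult_val:
  assumes "s \<in> J k \<gamma>" "keys \<beta> \<subseteq> X \<union> Y"
  shows "val \<beta> * s \<in> J (k + Ydeg \<beta>) (\<gamma> + wt \<beta>)"
  using assms(1) unfolding J_def
proof (rule mult_span_subset)
  fix y assume "y \<in> val ` E k \<gamma>"
  then obtain \<alpha> where \<alpha>: "\<alpha> \<in> E k \<gamma>" "y = val \<alpha>" by blast
  then have "val \<beta> * y = val (\<alpha> + \<beta>)" by (simp add: val_add mult.commute)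
  then show "val \<beta> * y \<in> ideal_generated (val ` E (k + Ydeg \<beta>) (\<gamma> + wt \<beta>))"
    using val_in_J[OF E_add[OF \<alpha>(1) assms(2)]] by (simp add: J_def)
qed

lemma J_mono_weight:
  assumes "keys \<delta> \<subseteq> {1..r}"
  shows "J k \<gamma> \<subseteq> J k (\<gamma> + \<delta>)"
proof
  fix s assume s: "s \<in> J k \<gamma>"
  obtain \<xi> where \<xi>: "keys \<xi> \<subseteq> X" "wt \<xi> = \<delta>" using lift_weight[OF assms] .
  have "val \<xi> * s \<in> J (k + Ydeg \<xi>) (\<gamma> + wt \<xi>)" using \<xi>(1) by (intro J_mult_val s) auto
  then show "s \<in> J k (\<gamma> + \<delta>)" by (simp add: val_X[OF \<xi>(1)] Ydeg_X[OF \<xi>(1)] \<xi>(2))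
qed

text \<open>In a monomial of positive \<open>Y\<close>-degree, replace a \<open>Y\<close>-variable by an \<open>X\<close>-variable of the same weight.\<close>

lemma J_Suc_subset: "J (Suc k) \<gamma> \<subseteq> J k \<gamma>"
  unfolding J_def[of "Suc k"]
proof (intro R.span_minimal J_ideal subsetI)
  fix s assume "s \<in> val ` E (Suc k) \<gamma>"
  then obtain \<alpha> where \<alpha>: "\<alpha> \<in> E (Suc k) \<gamma>" "s = val \<alpha>" by blast
  then have "(\<Sum>y\<in>Y. lookup \<alpha> y) \<noteq> 0" by (simp add: E_def Ydeg_def del: sum_eq_0_iff)
  then obtain y where y: "y \<in> Y" "lookup \<alpha> y > 0" by (metis gr0I sum.neutral)
  obtain \<beta> where \<beta>: "\<alpha> = \<beta> + single y 1" "keys \<beta> \<subseteq> X \<union> Y"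
    using remove_variable[of y \<alpha>] y \<alpha>(1) by (auto simp: E_def)
  obtain x where x: "x \<in> X" "\<pi> x = \<pi> y" using \<pi>_surj[of "\<pi> y"] \<pi>_range y by blast
  have xY: "x \<notin> Y" using x disjoint by blast
  have "\<beta> + single x 1 \<in> E k \<gamma>"
    using \<alpha>(1) \<beta> x y xY by (simp add: E_def keys_add_nat wt_add wt_single Ydeg_add Ydeg_single)
  then have "a y * val (\<beta> + single x 1) \<in> J k \<gamma>"
    by (intro R.subspace_scale[OF J_ideal] val_in_J)
  then show "s \<in> J k \<gamma>"
    using x y by (simp add: \<alpha>(2) \<beta>(1) val_add val_single a_X mult.commute)
qed

lemma J_zero:
  assumes "keys \<gamma> \<subseteq> {1..r}"
  shows "J 0 \<gamma> = UNIV"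
proof -
  obtain \<xi> where \<xi>: "keys \<xi> \<subseteq> X" "wt \<xi> = \<gamma>" using lift_weight[OF assms] .
  then have "\<xi> \<in> E 0 \<gamma>" by (auto simp: E_def Ydeg_X)
  then have "1 \<in> J 0 \<gamma>" using val_in_J[of \<xi>] val_X[OF \<xi>(1)] by simp
  then have "c * 1 \<in> J 0 \<gamma>" for c by (rule R.subspace_scale[OF J_ideal])
  then show ?thesis by auto
qed

lemma colon_ideal: "is_ideal (colon \<alpha>)"
  unfolding colon_def by (rule R.subspace_colon) simp

text \<open>Multiplying a relation by a monomial gives a relation, and lexicographic order is compatible with
  addition of exponents.\<close>

lemma colon_mono:
  assumes "keys \<beta> \<subseteq> X \<union> Y"
  shows "colon \<alpha> \<subseteq> colon (\<alpha> + \<beta>)"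
proof
  fix c assume "c \<in> colon \<alpha>"
  then have c: "c * val \<alpha> \<in> ideal_generated (J (Suc (Ydeg \<alpha>)) (wt \<alpha>) \<union> val ` {\<delta> \<in> E (Ydeg \<alpha>) (wt \<alpha>). \<delta> < \<alpha>})"
    by (simp add: colon_def)
  have "val \<beta> * (c * val \<alpha>) \<in> ideal_generated (J (Suc (Ydeg (\<alpha> + \<beta>))) (wt (\<alpha> + \<beta>)) \<union>
      val ` {\<delta> \<in> E (Ydeg (\<alpha> + \<beta>)) (wt (\<alpha> + \<beta>)). \<delta> < \<alpha> + \<beta>})"
    using c
  proof (rule mult_span_subset)
    fix s assume "s \<in> J (Suc (Ydeg \<alpha>)) (wt \<alpha>) \<union> val ` {\<delta> \<in> E (Ydeg \<alpha>) (wt \<alpha>). \<delta> < \<alpha>}"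
    then show "val \<beta> * s \<in> ideal_generated (J (Suc (Ydeg (\<alpha> + \<beta>))) (wt (\<alpha> + \<beta>)) \<union>
        val ` {\<delta> \<in> E (Ydeg (\<alpha> + \<beta>)) (wt (\<alpha> + \<beta>)). \<delta> < \<alpha> + \<beta>})"
    proof
      assume "s \<in> J (Suc (Ydeg \<alpha>)) (wt \<alpha>)"
      then have "val \<beta> * s \<in> J (Suc (Ydeg (\<alpha> + \<beta>))) (wt (\<alpha> + \<beta>))"
        using J_mult_val[OF _ assms, of s "Suc (Ydeg \<alpha>)" "wt \<alpha>"] by (simp add: Ydeg_add wt_add)
      then show ?thesis by (intro R.span_base) simp
    next
      assume "s \<in> val ` {\<delta> \<in> E (Ydeg \<alpha>) (wt \<alpha>). \<delta> < \<alpha>}"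
      then obtain \<delta> where \<delta>: "\<delta> \<in> E (Ydeg \<alpha>) (wt \<alpha>)" "\<delta> < \<alpha>" "s = val \<delta>" by blast
      then have "\<delta> + \<beta> \<in> {\<delta> \<in> E (Ydeg (\<alpha> + \<beta>)) (wt (\<alpha> + \<beta>)). \<delta> < \<alpha> + \<beta>}"
        using E_add[OF \<delta>(1) assms] by (simp add: Ydeg_add wt_add)
      moreover have "val \<beta> * s = val (\<delta> + \<beta>)" by (simp add: \<delta>(3) val_add mult.commute)
      ultimately show ?thesis by (intro R.span_base) blast
    qed
  qed
  moreover have "val \<beta> * (c * val \<alpha>) = c * val (\<alpha> + \<beta>)" by (simp add: val_add ac_simps)
  ultimately show "c \<in> colon (\<alpha> + \<beta>)" unfolding colon_def by simp
qed

text \<open>Replacing an \<open>X\<close>-variable by a \<open>Y\<close>-variable of the same weight multiplies the value by a generator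
  and raises the \<open>Y\<close>-degree, so the product lies in the next layer.\<close>

lemma gen_ideal_subset_colon:
  assumes "x \<in> X" "lookup \<alpha> x > 0" "keys \<alpha> \<subseteq> X \<union> Y"
  shows "gen_ideal (\<pi> x) \<subseteq> colon \<alpha>"
  unfolding gen_ideal_def
proof (intro R.span_minimal colon_ideal subsetI)
  fix b assume "b \<in> a ` {y \<in> Y. \<pi> y = \<pi> x}"
  then obtain y where y: "y \<in> Y" "\<pi> y = \<pi> x" "b = a y" by blast
  obtain \<beta> where \<beta>: "\<alpha> = \<beta> + single x 1" "keys \<beta> \<subseteq> X \<union> Y"
    using remove_variable[of x \<alpha>] assms by auto
  have xY: "x \<notin> Y" using assms disjoint by blast
  have "\<beta> + single y 1 \<in> E (Suc (Ydeg \<alpha>)) (wt \<alpha>)"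
    using \<beta> y xY assms(1) by (simp add: E_def keys_add_nat wt_add wt_single Ydeg_add Ydeg_single)
  then have "val (\<beta> + single y 1) \<in> J (Suc (Ydeg \<alpha>)) (wt \<alpha>)" by (rule val_in_J)
  moreover have "val (\<beta> + single y 1) = b * val \<alpha>"
    using y assms(1) by (simp add: \<beta>(1) val_add val_single a_X mult.commute)
  ultimately show "b \<in> colon \<alpha>" unfolding colon_def by (simp add: R.span_base)
qed

lemma quotient_length_layer:
  "quotient_length (*) (J k \<gamma>) (J (Suc k) \<gamma>) = (\<Sum>\<alpha>\<in>E k \<gamma>. quotient_length (*) UNIV (colon \<alpha>))"
proof -
  have "J k \<gamma> = ideal_generated (J (Suc k) \<gamma> \<union> val ` E k \<gamma>)"
  proof
    show "J k \<gamma> \<subseteq> ideal_generated (J (Suc k) \<gamma> \<union> val ` E k \<gamma>)"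
      unfolding J_def[of k] by (rule R.span_mono) simp
    show "ideal_generated (J (Suc k) \<gamma> \<union> val ` E k \<gamma>) \<subseteq> J k \<gamma>"
      by (intro R.span_minimal J_ideal Un_least J_Suc_subset) (auto simp: val_in_J)
  qed
  then have "quotient_length (*) (J k \<gamma>) (J (Suc k) \<gamma>) = (\<Sum>\<alpha>\<in>E k \<gamma>. quotient_length (*) UNIV
      {c. c * val \<alpha> \<in> ideal_generated (J (Suc k) \<gamma> \<union> val ` {\<beta> \<in> E k \<gamma>. \<beta> < \<alpha>})})"
    using R.quotient_length_filtration[where g = val, OF finite_E[of k \<gamma>] J_ideal[of "Suc k" \<gamma>]] by simp
  also have "\<dots> = (\<Sum>\<alpha>\<in>E k \<gamma>. quotient_length (*) UNIV (colon \<alpha>))"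
    by (rule sum.cong) (auto simp: colon_def E_def)
  finally show ?thesis .
qed

lemma quotient_length_J:
  assumes "keys \<gamma> \<subseteq> {1..r}"
  shows "quotient_length (*) UNIV (J p \<gamma>) = (\<Sum>k<p. \<Sum>\<alpha>\<in>E k \<gamma>. quotient_length (*) UNIV (colon \<alpha>))"
proof (induction p)
  case 0
  show ?case using R.quotient_length_self[OF R.subspace_UNIV] by (simp add: J_zero[OF assms])
next
  case (Suc p)
  have "quotient_length (*) UNIV (J (Suc p) \<gamma>) =
      quotient_length (*) UNIV (J p \<gamma>) + quotient_length (*) (J p \<gamma>) (J (Suc p) \<gamma>)"
    by (rule R.quotient_length_additive) (auto simp: J_ideal J_Suc_subset)
  then show ?case using Suc.IH by (simp add: quotient_length_layer)
qed

text \<open>As the total degree of \<open>\<alpha>\<close> exceeds its \<open>Y\<close>-degree, some \<open>X\<close>-variable occurs in \<open>\<alpha>\<close>.\<close>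

lemma colon_finite_length:
  assumes "noetherian TYPE('a)" "maximal_ideal \<mm>" "\<And>i. i \<in> {1..r} \<Longrightarrow> \<mm> \<subseteq> radical_ideal (gen_ideal i)"
    and \<alpha>: "\<alpha> \<in> E k \<gamma>" "k < (\<Sum>i=1..r. lookup \<gamma> i)"
  shows "quotient_length (*) UNIV (colon \<alpha>) \<noteq> \<infinity>"
proof -
  have "(\<Sum>x\<in>X. lookup \<alpha> x) \<noteq> 0"
    using \<alpha> total_degree_wt[of \<alpha>] total_degree_split[of \<alpha>] by (auto simp: E_def simp del: sum_eq_0_iff)
  then obtain x where x: "x \<in> X" "lookup \<alpha> x > 0" by (metis gr0I sum.neutral)
  have "gen_ideal (\<pi> x) \<subseteq> colon \<alpha>" using x \<alpha>(1) by (intro gen_ideal_subset_colon) (auto simp: E_def)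
  then have "\<mm> \<subseteq> radical_ideal (colon \<alpha>)"
    using assms(3)[OF \<pi>_range] x(1) radical_ideal_mono by blast
  then show ?thesis using quotient_length_finite[OF assms(1,2) colon_ideal] by blast
qed

end

section \<open>The Buchsbaum--Rim function by multidegrees\<close>

lemma poly_mapping_sum_single: "f = (\<Sum>\<gamma>\<in>keys f. single \<gamma> (lookup f \<gamma>))"
proof (rule poly_mapping_eqI)
  fix \<delta>
  have "lookup (\<Sum>\<gamma>\<in>keys f. single \<gamma> (lookup f \<gamma>)) \<delta> =
      (\<Sum>\<gamma>\<in>keys f. if \<gamma> = \<delta> then lookup f \<gamma> else 0)"
    unfolding lookup_sum by (rule sum.cong) (simp_all add: lookup_single when_def)
  also have "\<dots> = lookup f \<delta>" by (simp add: in_keys_iff)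
  finally show "lookup f \<delta> = lookup
      (\<Sum>\<gamma>\<in>keys f. single \<gamma> (lookup f \<gamma>)) \<delta>" by simp
qed

lemma poly_scale_single: "poly_scale c (single \<gamma> b) = single \<gamma> (c * b)"
  by (simp add: poly_scale_def const_poly_def mult_single)

lemma lookup_poly_scale: "lookup (poly_scale c f) \<gamma> = c * lookup f \<gamma>"
  unfolding poly_scale_def const_poly_def mult_map_scale_conv_mult[symmetric]
  by (simp add: map.rep_eq when_def)

lemma module_poly_scale: "module (poly_scale :: 'a::comm_ring_1 \<Rightarrow> 'a mpoly \<Rightarrow> 'a mpoly)"
  by unfold_locales (simp_all add: poly_mapping_eq_iff fun_eq_iff lookup_poly_scale lookup_add algebra_simps)

interpretation S: module "poly_scale :: 'a::comm_ring_1 \<Rightarrow> 'a mpoly \<Rightarrow> 'a mpoly"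
  by (rule module_poly_scale)

declare S.scale_scale [simp del]

definition coefficients_in :: "('e \<Rightarrow> 'a set) \<Rightarrow> ('e \<Rightarrow>\<^sub>0 'a::comm_ring_1) set"
  where "coefficients_in K = {f. \<forall>\<gamma>. lookup f \<gamma> \<in> K \<gamma>}"

lemma coefficients_in_add:
  assumes "\<And>\<gamma>. is_ideal (K \<gamma>)" "f \<in> coefficients_in K" "g \<in> coefficients_in K"
  shows "f + g \<in> coefficients_in K"
  using assms by (auto simp: coefficients_in_def lookup_add R.subspace_add)

lemma coefficients_in_sum:
  assumes "\<And>\<gamma>. is_ideal (K \<gamma>)" "\<And>i. i \<in> A \<Longrightarrow> f i \<in> coefficients_in K"
  shows "(\<Sum>i\<in>A. f i) \<in> coefficients_in K"
  using assms by (auto simp: coefficients_in_def lookup_sum intro: R.subspace_sum)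

lemma coefficients_in_single:
  assumes "\<And>\<gamma>. is_ideal (K \<gamma>)" "c \<in> K \<gamma>"
  shows "single \<gamma> c \<in> coefficients_in K"
  using assms by (auto simp: coefficients_in_def lookup_single when_def R.subspace_0)

lemma coefficients_in_mult:
  fixes f g :: "'e::monoid_add \<Rightarrow>\<^sub>0 'a::comm_ring_1"
  assumes K: "\<And>\<gamma>. is_ideal (K \<gamma>)"
    and "\<And>\<gamma> \<delta>. \<gamma> \<in> keys f \<Longrightarrow> \<delta> \<in> keys g \<Longrightarrow>
      lookup f \<gamma> * lookup g \<delta> \<in> K (\<gamma> + \<delta>)"
  shows "f * g \<in> coefficients_in K"
proof -
  have "f * g = (\<Sum>\<gamma>\<in>keys f. single \<gamma> (lookup f \<gamma>)) *
      (\<Sum>\<delta>\<in>keys g. single \<delta> (lookup g \<delta>))"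
    using poly_mapping_sum_single[of f] poly_mapping_sum_single[of g] by argo
  also have "\<dots> = (\<Sum>\<gamma>\<in>keys f. \<Sum>\<delta>\<in>keys g.
      single (\<gamma> + \<delta>) (lookup f \<gamma> * lookup g \<delta>))"
    by (simp add: sum_product mult_single)
  also have "\<dots> \<in> coefficients_in K"
    by (intro coefficients_in_sum coefficients_in_single K assms(2))
  finally show ?thesis .
qed

lemma subspace_coefficients_in:
  fixes K :: "(nat \<Rightarrow>\<^sub>0 nat) \<Rightarrow> 'a::comm_ring_1 set"
  assumes "\<And>\<gamma>. is_ideal (K \<gamma>)"
  shows "S.subspace (coefficients_in K)"
  by (rule S.subspaceI)
    (auto simp: coefficients_in_def lookup_add lookup_poly_scale assms R.subspace_0 R.subspace_add R.subspace_scale)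

lemma sym_component_iff: "f \<in> sym_component r n \<longleftrightarrow> keys f \<subseteq> exponents {1..r} n"
  by (auto simp: sym_component_def exponents_def)

lemma sym_component_coefficients_in:
  "sym_component r n = coefficients_in (\<lambda>\<gamma>. if \<gamma> \<in> exponents {1..r} n then UNIV else {0})"
  by (auto simp: sym_component_iff coefficients_in_def in_keys_iff subset_iff)

lemma subspace_sym_component: "S.subspace (sym_component r n)"
  unfolding sym_component_coefficients_in by (rule subspace_coefficients_in) simp

lemma exponents_add:
  "\<gamma> \<in> exponents V m \<Longrightarrow> \<delta> \<in> exponents V n \<Longrightarrow> \<gamma> + \<delta> \<in> exponents V (m + n)"
  by (simp add: exponents_def keys_add_nat lookup_add sum.distrib)

lemma sym_component_mult:
  assumes "f \<in> sym_component r m" "g \<in> sym_component r n"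
  shows "f * g \<in> sym_component r (m + n)"
proof -
  have "keys (f * g) \<subseteq> exponents {1..r} (m + n)"
  proof
    fix \<epsilon> assume "\<epsilon> \<in> keys (f * g)"
    then obtain \<gamma> \<delta> where "\<gamma> \<in> keys f" "\<delta> \<in> keys g" "\<epsilon> = \<gamma> + \<delta>"
      using keys_mult[of f g] by blast
    then show "\<epsilon> \<in> exponents {1..r} (m + n)"
      using assms exponents_add unfolding sym_component_iff by blast
  qed
  then show ?thesis by (simp add: sym_component_iff)
qed

text \<open>Add the monomials of degree \<open>n\<close> one at a time. Since the coefficients are independent of each other, the
  annihilator of the class of \<open>x\<^sup>\<gamma>\<close> is \<open>K \<gamma>\<close> in whatever order they are added.\<close>

lemma quotient_length_coefficientwise:
  fixes K :: "(nat \<Rightarrow>\<^sub>0 nat) \<Rightarrow> 'a::comm_ring_1 set"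
  assumes K: "\<And>\<gamma>. is_ideal (K \<gamma>)"
  shows "quotient_length poly_scale (sym_component r n) (sym_component r n \<inter> coefficients_in K) =
    (\<Sum>\<gamma>\<in>exponents {1..r} n. quotient_length (*) UNIV (K \<gamma>))"
proof -
  let ?g = "\<lambda>\<gamma>. single \<gamma> (1::'a)"
  let ?A = "exponents {1..r} n"
  define N where "N = sym_component r n \<inter> coefficients_in K"
  have N: "S.subspace N"
    unfolding N_def by (intro S.subspace_inter subspace_sym_component subspace_coefficients_in K)
  have span: "S.span (N \<union> ?g ` ?A) = sym_component r n"
  proof
    show "S.span (N \<union> ?g ` ?A) \<subseteq> sym_component r n"
      by (intro S.span_minimal subspace_sym_component) (auto simp: N_def sym_component_iff)
    show "sym_component r n \<subseteq> S.span (N \<union> ?g ` ?A)"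
    proof
      fix f :: "'a mpoly" assume f: "f \<in> sym_component r n"
      have "(\<Sum>\<gamma>\<in>keys f. poly_scale (lookup f \<gamma>) (?g \<gamma>)) \<in> S.span (N \<union> ?g ` ?A)"
        using f unfolding sym_component_iff by (intro S.span_sum S.span_scale S.span_base) auto
      then show "f \<in> S.span (N \<union> ?g ` ?A)"
        using poly_mapping_sum_single[of f] by (simp add: poly_scale_single)
    qed
  qed
  have colon: "{c. poly_scale c (?g \<gamma>) \<in> S.span (N \<union> ?g ` {\<delta> \<in> ?A. \<delta> < \<gamma>})} = K \<gamma>" if \<gamma>: "\<gamma> \<in> ?A" for \<gamma>
  proof (intro equalityI subsetI)
    fix c assume "c \<in> K \<gamma>"
    then have "single \<gamma> c \<in> N"
      using \<gamma> coefficients_in_single[of K, OF K] by (simp add: N_def sym_component_iff)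
    then show "c \<in> {c. poly_scale c (?g \<gamma>) \<in> S.span (N \<union> ?g ` {\<delta> \<in> ?A. \<delta> < \<gamma>})}"
      by (simp add: poly_scale_single S.span_base)
  next
    fix c assume "c \<in> {c. poly_scale c (?g \<gamma>) \<in> S.span (N \<union> ?g ` {\<delta> \<in> ?A. \<delta> < \<gamma>})}"
    then have c: "single \<gamma> c \<in> S.span (N \<union> ?g ` {\<delta> \<in> ?A. \<delta> < \<gamma>})"
      by (simp add: poly_scale_single)
    have "S.span (N \<union> ?g ` {\<delta> \<in> ?A. \<delta> < \<gamma>}) \<subseteq> coefficients_in (\<lambda>\<delta>. if \<delta> = \<gamma> then K \<gamma> else UNIV)"
      by (intro S.span_minimal subspace_coefficients_in)
        (auto simp: K N_def coefficients_in_def lookup_single when_def R.subspace_0)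
    then have "single \<gamma> c \<in> coefficients_in (\<lambda>\<delta>. if \<delta> = \<gamma> then K \<gamma> else UNIV)"
      using c by blast
    then have "lookup (single \<gamma> c) \<gamma> \<in> K \<gamma>"
      by (auto simp: coefficients_in_def dest: spec[of _ \<gamma>])
    then show "c \<in> K \<gamma>" by simp
  qed
  have "quotient_length poly_scale (S.span (N \<union> ?g ` ?A)) N = (\<Sum>\<gamma>\<in>?A. quotient_length (*) UNIV
      {c. poly_scale c (?g \<gamma>) \<in> S.span (N \<union> ?g ` {\<delta> \<in> ?A. \<delta> < \<gamma>})})"
    by (rule S.quotient_length_filtration[OF finite_exponents N]) simp
  also have "\<dots> = (\<Sum>\<gamma>\<in>?A. quotient_length (*) UNIV (K \<gamma>))"
    by (rule sum.cong[OF refl], subst colon) simp_all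
  finally show ?thesis unfolding span by (simp only: N_def)
qed

lemma linear_form_eq: "linear_form r v = (\<Sum>i=1..r. single (single i 1) (v i))"
  by (simp add: linear_form_def var_poly_def poly_scale_single)

context generator_system
begin

text \<open>The coefficient ideal in multidegree \<open>\<gamma>\<close> of the subalgebra \<open>R[M]\<close>: here all variables come from
  \<open>Y\<close>, so that \<open>\<gamma>\<close> prescribes the number of factors from each ideal.\<close>

definition K :: "(nat \<Rightarrow>\<^sub>0 nat) \<Rightarrow> 'a set"
  where "K \<gamma> = ideal_generated (val ` {\<beta>. keys \<beta> \<subseteq> Y \<and> wt \<beta> = \<gamma>})"

lemma K_ideal: "is_ideal (K \<gamma>)"
  by (simp add: K_def)

lemma K_mult:
  assumes "c \<in> K \<gamma>" "d \<in> K \<delta>"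
  shows "c * d \<in> K (\<gamma> + \<delta>)"
  using assms(2) unfolding K_def[of \<delta>] K_def[of "\<gamma> + \<delta>"]
proof (rule mult_span_subset)
  fix y assume "y \<in> val ` {\<beta>. keys \<beta> \<subseteq> Y \<and> wt \<beta> = \<delta>}"
  then obtain \<beta> where \<beta>: "keys \<beta> \<subseteq> Y" "wt \<beta> = \<delta>" "y = val \<beta>" by blast
  have "y * c \<in> ideal_generated (val ` {\<beta>. keys \<beta> \<subseteq> Y \<and> wt \<beta> = \<gamma> + \<delta>})"
    using assms(1) unfolding K_def
  proof (rule mult_span_subset)
    fix z assume "z \<in> val ` {\<beta>. keys \<beta> \<subseteq> Y \<and> wt \<beta> = \<gamma>}"
    then obtain \<alpha> where \<alpha>: "keys \<alpha> \<subseteq> Y" "wt \<alpha> = \<gamma>" "z = val \<alpha>" by blast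
    have "val (\<alpha> + \<beta>) \<in> ideal_generated (val ` {\<beta>. keys \<beta> \<subseteq> Y \<and> wt \<beta> = \<gamma> + \<delta>})"
      using \<alpha> \<beta> by (intro R.span_base imageI) (simp add: keys_add_nat wt_add)
    then show "y * z \<in> ideal_generated (val ` {\<beta>. keys \<beta> \<subseteq> Y \<and> wt \<beta> = \<gamma> + \<delta>})"
      using \<alpha>(3) \<beta>(3) by (simp add: val_add mult.commute)
  qed
  then show "c * y \<in> ideal_generated (val ` {\<beta>. keys \<beta> \<subseteq> Y \<and> wt \<beta> = \<gamma> + \<delta>})"
    by (simp add: mult.commute)
qed

lemma K_subset_J:
  assumes "\<gamma> \<in> exponents {1..r} p"
  shows "K \<gamma> \<subseteq> J p \<gamma>"
  unfolding K_def J_def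
proof (rule R.span_mono, rule image_mono, rule subsetI)
  fix \<beta> assume "\<beta> \<in> {\<beta>. keys \<beta> \<subseteq> Y \<and> wt \<beta> = \<gamma>}"
  then have \<beta>: "keys \<beta> \<subseteq> Y" "wt \<beta> = \<gamma>" by auto
  have zero: "(\<Sum>x\<in>X. lookup \<beta> x) = 0"
  proof (rule sum.neutral, rule ballI)
    fix x assume "x \<in> X"
    then have "x \<notin> keys \<beta>" using \<beta>(1) disjoint by blast
    then show "lookup \<beta> x = 0" by (simp add: in_keys_iff)
  qed
  have "Ydeg \<beta> = p"
    using total_degree_wt[of \<beta>] total_degree_split[of \<beta>] zero \<beta>(2) assms by (simp add: exponents_def)
  then show "\<beta> \<in> E p \<gamma>" using \<beta> by (auto simp: E_def)
qed

lemma subalgebra_coefficients: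
  assumes "f \<in> subalgebra_generated (linear_form r ` ideal_direct_sum r gen_ideal)"
  shows "f \<in> coefficients_in K"
  using assms
proof induction
  case (const c)
  have "val 0 \<in> K 0" unfolding K_def by (intro R.span_base imageI) simp
  then have "c * val 0 \<in> K 0" by (rule R.subspace_scale[OF K_ideal])
  then have "c \<in> K 0" by (simp add: val_def)
  then show ?case unfolding const_poly_def by (intro coefficients_in_single K_ideal)
next
  case (gen g)
  then obtain v where v: "v \<in> ideal_direct_sum r gen_ideal" "g = linear_form r v" by blast
  show ?case unfolding v(2) linear_form_eq
  proof (intro coefficients_in_sum coefficients_in_single K_ideal)
    fix i assume i: "i \<in> {1..r}"
    then have "v i \<in> gen_ideal i" using v(1) by (auto simp: ideal_direct_sum_def)
    moreover have "gen_ideal i \<subseteq> K (single i 1)"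
      unfolding gen_ideal_def
    proof (intro R.span_minimal K_ideal subsetI)
      fix b assume "b \<in> a ` {y \<in> Y. \<pi> y = i}"
      then obtain y where y: "y \<in> Y" "\<pi> y = i" "b = a y" by blast
      then have "val (single y 1) \<in> K (single i 1)"
        unfolding K_def by (intro R.span_base imageI) (simp add: wt_single)
      then show "b \<in> K (single i 1)" using y by (simp add: val_single)
    qed
    ultimately show "v i \<in> K (single i 1)" by blast
  qed
next
  case (add f g)
  then show ?case by (intro coefficients_in_add K_ideal)
next
  case (mult f g)
  then show ?case by (intro coefficients_in_mult K_ideal K_mult) (simp_all add: coefficients_in_def)
qed

text \<open>The \<open>Y\<close>-part of \<open>\<alpha>\<close> gives a product of linear forms in \<open>M\<close>, the \<open>X\<close>-part a monomial in the coordinates.\<close>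

lemma monomial_factorization:
  assumes "keys \<alpha> \<subseteq> X \<union> Y"
  obtains f g where "f \<in> rees_component r (ideal_direct_sum r gen_ideal) (Ydeg \<alpha>)"
    "g \<in> sym_component r (\<Sum>x\<in>X. lookup \<alpha> x)"
    "single (wt \<alpha>) (val \<alpha>) = f * g"
proof -
  let ?G = "linear_form r ` ideal_direct_sum r gen_ideal"
  let ?m = "\<lambda>v. single (single (\<pi> v) 1) (a v)"
  have m_sym: "?m v \<in> sym_component r 1" if v: "v \<in> X \<union> Y" for v
    using \<pi>_range[OF v] by (auto simp: sym_component_iff exponents_def lookup_single when_def)
  have m_G: "?m y \<in> ?G" if y: "y \<in> Y" for y
  proof -
    define v where "v i = (if i = \<pi> y then a y else 0)" for i
    have "a y \<in> gen_ideal (\<pi> y)" unfolding gen_ideal_def using y by (intro R.span_base) auto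
    then have "v \<in> ideal_direct_sum r gen_ideal"
      using \<pi>_range[of y] y by (auto simp: ideal_direct_sum_def v_def gen_ideal_def R.span_zero)
    moreover have "linear_form r v = ?m y"
    proof -
      have "linear_form r v = (\<Sum>i=1..r. if i = \<pi> y then ?m y else 0)"
        unfolding linear_form_eq by (rule sum.cong) (auto simp: v_def)
      then show ?thesis using \<pi>_range[of y] y by simp
    qed
    ultimately show ?thesis by force
  qed
  have "\<exists>f g. f \<in> rees_component r (ideal_direct_sum r gen_ideal) (Ydeg \<alpha>) \<and>
    g \<in> sym_component r (\<Sum>x\<in>X. lookup \<alpha> x) \<and> single (wt \<alpha>) (val \<alpha>) = f * g"
    using assms
  proof (induction rule: exponent_induct)
    case zero
    have one: "(1 :: 'a mpoly) \<in> sym_component r 0" by (simp add: sym_component_iff exponents_def)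
    have "const_poly 1 \<in> subalgebra_generated ?G" by (rule subalgebra_generated.const)
    then have "(1 :: 'a mpoly) \<in> rees_component r (ideal_direct_sum r gen_ideal) 0"
      using one by (simp add: rees_component_def const_poly_def)
    then show ?case using one by (intro exI[of _ 1]) (simp add: Ydeg_def val_def)
  next
    case (add_single \<beta> v)
    then obtain f g where fg: "f \<in> rees_component r (ideal_direct_sum r gen_ideal) (Ydeg \<beta>)"
        "g \<in> sym_component r (\<Sum>x\<in>X. lookup \<beta> x)" "single (wt \<beta>) (val \<beta>) = f * g"
      by blast
    have f: "f \<in> subalgebra_generated ?G" "f \<in> sym_component r (Ydeg \<beta>)"
      using fg(1) by (auto simp: rees_component_def)
    have eq: "single (wt (\<beta> + single v 1)) (val (\<beta> + single v 1)) = f * g * ?m v"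
      using add_single(2) by (simp add: wt_add val_add wt_single val_single fg(3)[symmetric] mult_single)
    have X: "(\<Sum>x\<in>X. lookup (\<beta> + single v 1) x) =
        (\<Sum>x\<in>X. lookup \<beta> x) + (if v \<in> X then 1 else 0)"
      using finite_X by (simp add: lookup_add sum.distrib lookup_single when_def)
    show ?case
    proof (cases "v \<in> Y")
      case True
      then have vX: "v \<notin> X" using disjoint by blast
      have "f * ?m v \<in> rees_component r (ideal_direct_sum r gen_ideal) (Ydeg (\<beta> + single v 1))"
        using sym_component_mult[OF f(2) m_sym[OF add_single(2)]] True
          subalgebra_generated.mult[OF f(1) subalgebra_generated.gen[OF m_G[OF True]]]
        by (simp add: rees_component_def Ydeg_add Ydeg_single)
      then show ?thesis using fg(2) vX unfolding X eq
        by (intro exI[of _ "f * ?m v"] exI[of _ g]) (simp add: ac_simps)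
    next
      case False
      then have vX: "v \<in> X" using add_single(2) by blast
      have "g * ?m v \<in> sym_component r (\<Sum>x\<in>X. lookup (\<beta> + single v 1) x)"
        unfolding X using sym_component_mult[OF fg(2) m_sym[OF add_single(2)]] vX by simp
      then show ?thesis using fg(1) False unfolding eq
        by (intro exI[of _ f] exI[of _ "g * ?m v"]) (simp add: ac_simps Ydeg_add Ydeg_single)
    qed
  qed
  then show ?thesis using that by blast
qed

text \<open>A coefficient of a product of an element of \<open>M\<^sup>p\<close> and a form of degree \<open>q\<close> lies in \<open>J p\<close> because a
  coordinate variable only raises the multidegree. Conversely, the generators of \<open>J p \<gamma>\<close> are the coefficients of
  such products by \<open>monomial_factorization\<close>.\<close>

lemma rees_sym_product_eq:
  "rees_sym_product r (ideal_direct_sum r gen_ideal) p q = sym_component r (p + q) \<inter> coefficients_in (J p)"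
  (is "?L = ?R")
proof
  show "?L \<subseteq> ?R"
    unfolding rees_sym_product_def
  proof (rule S.span_minimal)
    show "S.subspace ?R"
      by (intro S.subspace_inter subspace_sym_component subspace_coefficients_in J_ideal)
    show "{f * g | f g. f \<in> rees_component r (ideal_direct_sum r gen_ideal) p \<and> g \<in> sym_component r q} \<subseteq> ?R"
    proof clarify
      fix f g assume f: "f \<in> rees_component r (ideal_direct_sum r gen_ideal) p"
        and g: "(g :: 'a mpoly) \<in> sym_component r q"
      have fK: "f \<in> coefficients_in K" and fs: "f \<in> sym_component r p"
        using f subalgebra_coefficients by (auto simp: rees_component_def)
      have "f * g \<in> coefficients_in (J p)"
      proof (rule coefficients_in_mult[OF J_ideal])
        fix \<gamma> \<delta> assume "\<gamma> \<in> keys f" "\<delta> \<in> keys g"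
        then have \<gamma>: "\<gamma> \<in> exponents {1..r} p" and \<delta>: "\<delta> \<in> exponents {1..r} q"
          using fs g unfolding sym_component_iff by blast+
        have "lookup f \<gamma> \<in> J p \<gamma>"
          using fK K_subset_J[OF \<gamma>] by (auto simp: coefficients_in_def)
        moreover have "keys \<delta> \<subseteq> {1..r}" using \<delta> by (simp add: exponents_def)
        ultimately have "lookup f \<gamma> \<in> J p (\<gamma> + \<delta>)" using J_mono_weight by blast
        then have "lookup g \<delta> * lookup f \<gamma> \<in> J p (\<gamma> + \<delta>)"
          by (rule R.subspace_scale[OF J_ideal])
        then show "lookup f \<gamma> * lookup g \<delta> \<in> J p (\<gamma> + \<delta>)"
          by (simp add: mult.commute)
      qed
      then show "f * g \<in> ?R" using sym_component_mult[OF fs g] by simp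
    qed
  qed
  show "?R \<subseteq> ?L"
  proof
    fix f :: "'a mpoly" assume f: "f \<in> ?R"
    have L: "S.subspace ?L" unfolding rees_sym_product_def by (rule S.subspace_span)
    have "single \<gamma> (lookup f \<gamma>) \<in> ?L" if "\<gamma> \<in> keys f" for \<gamma>
    proof -
      have \<gamma>: "\<gamma> \<in> exponents {1..r} (p + q)" using f that by (auto simp: sym_component_iff)
      have "is_ideal {c. poly_scale c (single \<gamma> 1) \<in> ?L}" by (rule S.subspace_colon[OF L])
      moreover have "val ` E p \<gamma> \<subseteq> {c. poly_scale c (single \<gamma> 1) \<in> ?L}"
      proof clarify
        fix \<alpha> assume \<alpha>: "\<alpha> \<in> E p \<gamma>"
        then have k: "keys \<alpha> \<subseteq> X \<union> Y" "Ydeg \<alpha> = p" "wt \<alpha> = \<gamma>" by (auto simp: E_def)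
        have q: "(\<Sum>x\<in>X. lookup \<alpha> x) = q"
          using \<gamma> total_degree_wt[of \<alpha>] total_degree_split[of \<alpha>] k by (simp add: exponents_def)
        obtain h g where hg: "h \<in> rees_component r (ideal_direct_sum r gen_ideal) p"
          "g \<in> sym_component r q" "single \<gamma> (val \<alpha>) = h * g"
          using monomial_factorization[OF k(1)] unfolding k(2,3) q by blast
        then have "single \<gamma> (val \<alpha>) \<in> ?L"
          unfolding rees_sym_product_def by (intro S.span_base) blast
        then show "poly_scale (val \<alpha>) (single \<gamma> 1) \<in> ?L" by (simp add: poly_scale_single)
      qed
      ultimately have "J p \<gamma> \<subseteq> {c. poly_scale c (single \<gamma> 1) \<in> ?L}"
        unfolding J_def by (intro R.span_minimal)
      moreover have "lookup f \<gamma> \<in> J p \<gamma>" using f by (simp add: coefficients_in_def)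
      ultimately show ?thesis by (auto simp: poly_scale_single)
    qed
    then have "(\<Sum>\<gamma>\<in>keys f. single \<gamma> (lookup f \<gamma>)) \<in> ?L"
      by (rule S.subspace_sum[OF L])
    then show "f \<in> ?L" by (simp only: poly_mapping_sum_single[symmetric])
  qed
qed

lemma buchsbaum_rim_function_eq:
  "buchsbaum_rim_function r (ideal_direct_sum r gen_ideal) p q =
    (\<Sum>\<gamma>\<in>exponents {1..r} (p + q). quotient_length (*) UNIV (J p \<gamma>))"
  unfolding buchsbaum_rim_function_def rees_sym_product_eq
  by (rule quotient_length_coefficientwise[OF J_ideal])

end

section \<open>The multiplicities\<close>

lemma poly_eq_of_eventually_eq:
  fixes F G :: "'b::idom poly"
  assumes "inj f" "\<And>n::nat. n \<ge> N \<Longrightarrow> poly F (f n) = poly G (f n)"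
  shows "F = G"
proof (rule ccontr)
  assume "F \<noteq> G"
  then have "finite {x. poly (F - G) x = 0}" by (intro poly_roots_finite) simp
  moreover have "f ` {N..} \<subseteq> {x. poly (F - G) x = 0}" using assms(2) by auto
  ultimately have "finite (f ` {N..})" by (rule finite_subset[rotated])
  then have "finite {N..}" using assms(1) by (meson finite_imageD inj_on_subset subset_UNIV)
  then show False by (simp add: infinite_Ici)
qed

lemma poly2_eq_of_eventually_eq:
  assumes "\<And>p q. p \<ge> N \<Longrightarrow> q \<ge> N \<Longrightarrow> poly2 P p q = poly2 Q p q"
  shows "P = Q"
proof (rule poly_eq_of_eventually_eq)
  show "inj (\<lambda>p::nat. [:real p:])" by (simp add: inj_on_def)
  fix p :: nat assume p: "N \<le> p"
  show "poly P [:real p:] = poly Q [:real p:]"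
  proof (rule poly_eq_of_eventually_eq)
    show "inj real" by (simp add: inj_on_def)
    show "poly (poly P [:real p:]) (real q) = poly (poly Q [:real p:]) (real q)" if "N \<le> q" for q
      using assms[OF p that] by (simp add: poly2_def)
  qed
qed

lemma coeff_poly_constant: "coeff (poly P [:x:]) j = poly (map_poly (\<lambda>c. coeff c j) P) x"
  by (induction P) (simp_all add: map_poly_pCons)

lemma sum_enat_finite:
  assumes "\<And>i. i \<in> A \<Longrightarrow> f i \<noteq> (\<infinity>::enat)"
  shows "(\<Sum>i\<in>A. f i) = enat (\<Sum>i\<in>A. the_enat (f i))"
  using assms
proof (induction A rule: infinite_finite_induct)
  case (insert i A)
  then obtain n where "f i = enat n" by auto
  then show ?case using insert by simp
qed (simp_all add: zero_enat_def)

text \<open>An infinite length is sent to an unspecified number, so the value is meaningful only for ideals of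
  finite colength.\<close>

definition colength :: "'a::comm_ring_1 set \<Rightarrow> real"
  where "colength Q = real (the_enat (quotient_length (*) UNIV Q))"

lemma ereal_colength:
  "quotient_length (*) UNIV Q \<noteq> \<infinity> \<Longrightarrow> ereal_of_enat (quotient_length (*) UNIV Q) = ereal (colength Q)"
  by (auto simp: colength_def)

lemma ideal_direct_sum_cong: "(\<And>i. i \<in> {1..r} \<Longrightarrow> I i = I' i) \<Longrightarrow> ideal_direct_sum r I = ideal_direct_sum r I'"
  by (simp add: ideal_direct_sum_def)

lemma ideal_sum_cong: "(\<And>i. i \<in> {1..r} \<Longrightarrow> I i = I' i) \<Longrightarrow> ideal_sum r I = ideal_sum r I'"
  by (simp add: ideal_sum_def)

lemma ideal_sum_ideal:
  assumes "\<And>i. i \<in> {1..r} \<Longrightarrow> is_ideal (I i)"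
  shows "is_ideal (ideal_sum r I)"
proof (rule R.subspaceI)
  show "0 \<in> ideal_sum r I" unfolding ideal_sum_def
    using assms by (intro CollectI exI[of _ "\<lambda>_. 0"]) (simp add: R.subspace_0)
next
  fix s t assume "s \<in> ideal_sum r I" "t \<in> ideal_sum r I"
  then obtain x y where "s = (\<Sum>i=1..r. x i)" "\<forall>i\<in>{1..r}. x i \<in> I i"
      "t = (\<Sum>i=1..r. y i)" "\<forall>i\<in>{1..r}. y i \<in> I i"
    by (auto simp: ideal_sum_def)
  then show "s + t \<in> ideal_sum r I" unfolding ideal_sum_def
    using assms by (intro CollectI exI[of _ "\<lambda>i. x i + y i"]) (simp add: sum.distrib R.subspace_add)
next
  fix c s assume "s \<in> ideal_sum r I"
  then obtain x where "s = (\<Sum>i=1..r. x i)" "\<forall>i\<in>{1..r}. x i \<in> I i"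
    by (auto simp: ideal_sum_def)
  then show "c * s \<in> ideal_sum r I" unfolding ideal_sum_def
    using assms by (intro CollectI exI[of _ "\<lambda>i. c * x i"]) (simp add: sum_distrib_left R.subspace_scale)
qed

lemma subset_ideal_sum:
  assumes "\<And>i. i \<in> {1..r} \<Longrightarrow> is_ideal (I i)" "j \<in> {1..r}"
  shows "I j \<subseteq> ideal_sum r I"
proof
  fix b assume "b \<in> I j"
  then show "b \<in> ideal_sum r I" unfolding ideal_sum_def
    using assms by (intro CollectI exI[of _ "\<lambda>i. if i = j then b else 0"]) (auto simp: R.subspace_0)
qed

lemma ideal_sum_eq_largest:
  assumes "\<And>i. i \<in> {1..r} \<Longrightarrow> is_ideal (I i)" "j \<in> {1..r}" "\<And>i. i \<in> {1..r} \<Longrightarrow> I i \<subseteq> I j"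
  shows "ideal_sum r I = I j"
proof
  show "ideal_sum r I \<subseteq> I j"
  proof
    fix s assume "s \<in> ideal_sum r I"
    then obtain x where x: "s = (\<Sum>i=1..r. x i)" "\<forall>i\<in>{1..r}. x i \<in> I i" by (auto simp: ideal_sum_def)
    show "s \<in> I j" unfolding x(1) using x(2) assms by (intro R.subspace_sum) blast+
  qed
qed (rule subset_ideal_sum[OF assms(1,2)])

lemma ideal_generated_products:
  fixes A B :: "'a::comm_ring_1 set"
  shows "ideal_generated {x * y | x y. x \<in> ideal_generated A \<and> y \<in> ideal_generated B} =
    ideal_generated {x * y | x y. x \<in> A \<and> y \<in> B}" (is "?L = ?R")
proof
  show "?R \<subseteq> ?L" by (rule R.span_mono) (auto intro: R.span_base)
  have step: "x * y \<in> ?R" if x: "x \<in> ideal_generated A" and y: "y \<in> ideal_generated B" for x y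
    using y
  proof (rule mult_span_subset)
    fix b assume b: "b \<in> B"
    have "b * x \<in> ?R"
      using x
    proof (rule mult_span_subset)
      fix c assume "c \<in> A"
      then have "c * b \<in> ?R" using b by (intro R.span_base) blast
      then show "b * c \<in> ?R" by (simp add: mult.commute)
    qed
    then show "x * b \<in> ?R" by (simp add: mult.commute)
  qed
  show "?L \<subseteq> ?R" by (rule R.span_minimal) (auto simp: step)
qed

context generator_system
begin

lemma ideal_sum_gen_ideal: "ideal_sum r gen_ideal = ideal_generated (a ` Y)"
proof
  show "ideal_sum r gen_ideal \<subseteq> ideal_generated (a ` Y)"
  proof
    fix s assume "s \<in> ideal_sum r gen_ideal"
    then obtain x where x: "s = (\<Sum>i=1..r. x i)" "\<forall>i\<in>{1..r}. x i \<in> gen_ideal i"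
      by (auto simp: ideal_sum_def)
    have "gen_ideal i \<subseteq> ideal_generated (a ` Y)" for i
      unfolding gen_ideal_def by (rule R.span_mono) auto
    then show "s \<in> ideal_generated (a ` Y)" unfolding x(1) using x(2) by (intro R.span_sum) blast
  qed
  have gen: "is_ideal (gen_ideal i)" for i by (simp add: gen_ideal_def)
  have "a ` Y \<subseteq> ideal_sum r gen_ideal"
  proof clarify
    fix y assume y: "y \<in> Y"
    then have "a y \<in> gen_ideal (\<pi> y)" unfolding gen_ideal_def by (intro R.span_base) auto
    then show "a y \<in> ideal_sum r gen_ideal"
      using subset_ideal_sum[of r gen_ideal "\<pi> y"] gen \<pi>_range[of y] y by blast
  qed
  then show "ideal_generated (a ` Y) \<subseteq> ideal_sum r gen_ideal"
    by (rule R.span_minimal) (rule ideal_sum_ideal[OF gen])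
qed

lemma ideal_power_generators:
  "ideal_power (ideal_generated (a ` Y)) p =
    ideal_generated (val ` {\<beta>. keys \<beta> \<subseteq> Y \<and> Ydeg \<beta> = p})"
proof (induction p)
  case 0
  have "1 \<in> val ` {\<beta>. keys \<beta> \<subseteq> Y \<and> Ydeg \<beta> = 0}"
    by (rule image_eqI[of _ _ 0]) (simp_all add: val_def Ydeg_def)
  then have "c * 1 \<in> ideal_generated (val ` {\<beta>. keys \<beta> \<subseteq> Y \<and> Ydeg \<beta> = 0})" for c
    by (intro R.span_scale R.span_base)
  then show ?case by auto
next
  case (Suc p)
  have "{x * y | x y. x \<in> a ` Y \<and> y \<in> val ` {\<beta>. keys \<beta> \<subseteq> Y \<and> Ydeg \<beta> = p}} =
      val ` {\<beta>. keys \<beta> \<subseteq> Y \<and> Ydeg \<beta> = Suc p}"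
  proof (intro equalityI subsetI)
    fix z assume "z \<in> {x * y | x y. x \<in> a ` Y \<and> y \<in> val ` {\<beta>. keys \<beta> \<subseteq> Y \<and> Ydeg \<beta> = p}}"
    then obtain y \<beta> where y: "y \<in> Y" "keys \<beta> \<subseteq> Y" "Ydeg \<beta> = p" "z = a y * val \<beta>" by blast
    then show "z \<in> val ` {\<beta>. keys \<beta> \<subseteq> Y \<and> Ydeg \<beta> = Suc p}"
      by (intro image_eqI[of _ _ "\<beta> + single y 1"])
        (simp_all add: val_add val_single Ydeg_add Ydeg_single keys_add_nat mult.commute)
  next
    fix z assume "z \<in> val ` {\<beta>. keys \<beta> \<subseteq> Y \<and> Ydeg \<beta> = Suc p}"
    then obtain \<beta> where \<beta>: "keys \<beta> \<subseteq> Y" "Ydeg \<beta> = Suc p" "z = val \<beta>" by blast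
    then have "(\<Sum>y\<in>Y. lookup \<beta> y) \<noteq> 0" by (simp add: Ydeg_def del: sum_eq_0_iff)
    then obtain y where y: "y \<in> Y" "lookup \<beta> y > 0" by (metis gr0I sum.neutral)
    obtain \<delta> where \<delta>: "\<beta> = \<delta> + single y 1"
      using remove_variable[of y \<beta>] y \<beta>(1) by auto
    then have "keys \<delta> \<subseteq> Y" "Ydeg \<delta> = p"
      using \<beta> y by (auto simp: keys_add_nat Ydeg_add Ydeg_single)
    moreover have "z = a y * val \<delta>"
      using \<delta> \<beta>(3) y by (simp add: val_add val_single mult.commute)
    ultimately show "z \<in> {x * y | x y. x \<in> a ` Y \<and> y \<in> val ` {\<beta>. keys \<beta> \<subseteq> Y \<and> Ydeg \<beta> = p}}"
      using y(1) by blast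
  qed
  then show ?case unfolding ideal_power.simps Suc.IH ideal_generated_products by (simp only:)
qed

text \<open>If all entries of \<open>\<gamma>\<close> are at least \<open>p\<close>, the restriction on the number of factors from each ideal
  is void.\<close>

lemma J_eq_ideal_power:
  assumes \<gamma>: "keys \<gamma> \<subseteq> {1..r}" "\<And>i. i \<in> {1..r} \<Longrightarrow> p \<le> lookup \<gamma> i"
  shows "J p \<gamma> = ideal_power (ideal_sum r gen_ideal) p"
proof -
  have "val ` E p \<gamma> = val ` {\<beta>. keys \<beta> \<subseteq> Y \<and> Ydeg \<beta> = p}"
  proof (intro equalityI subsetI)
    fix z assume "z \<in> val ` E p \<gamma>"
    then obtain \<alpha> where \<alpha>: "\<alpha> \<in> E p \<gamma>" "z = val \<alpha>" by blast
    obtain \<xi> \<beta> where s: "keys \<xi> \<subseteq> X" "keys \<beta> \<subseteq> Y" "\<alpha> = \<xi> + \<beta>"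
      using split_XY[of \<alpha>] \<alpha>(1) by (auto simp: E_def)
    have "z = val \<beta>" "Ydeg \<beta> = p"
      using \<alpha> s by (auto simp: E_def val_add val_X Ydeg_add Ydeg_X)
    then show "z \<in> val ` {\<beta>. keys \<beta> \<subseteq> Y \<and> Ydeg \<beta> = p}" using s(2) by blast
  next
    fix z assume "z \<in> val ` {\<beta>. keys \<beta> \<subseteq> Y \<and> Ydeg \<beta> = p}"
    then obtain \<beta> where \<beta>: "keys \<beta> \<subseteq> Y" "Ydeg \<beta> = p" "z = val \<beta>" by blast
    have zero: "(\<Sum>x\<in>X. lookup \<beta> x) = 0"
    proof (rule sum.neutral, rule ballI)
      fix x assume "x \<in> X"
      then have "x \<notin> keys \<beta>" using \<beta>(1) disjoint by blast
      then show "lookup \<beta> x = 0" by (simp add: in_keys_iff)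
    qed
    have total: "(\<Sum>i=1..r. lookup (wt \<beta>) i) = p"
      using total_degree_wt[of \<beta>] total_degree_split[of \<beta>] zero \<beta>(2) by simp
    have le: "lookup (wt \<beta>) i \<le> lookup \<gamma> i" for i
    proof (cases "i \<in> {1..r}")
      case True
      have "lookup (wt \<beta>) i \<le> p"
        unfolding total[symmetric] using True by (intro member_le_sum) auto
      then show ?thesis using \<gamma>(2)[OF True] by simp
    next
      case False
      then have "i \<notin> keys (wt \<beta>)" using keys_wt[of \<beta>] by blast
      then show ?thesis by (simp add: in_keys_iff)
    qed
    have "keys (\<gamma> - wt \<beta>) \<subseteq> {1..r}" using keys_diff_nat \<gamma>(1) by (rule order_trans)
    then obtain \<xi> where \<xi>: "keys \<xi> \<subseteq> X" "wt \<xi> = \<gamma> - wt \<beta>" by (rule lift_weight)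
    have "wt \<beta> + (\<gamma> - wt \<beta>) = \<gamma>"
      by (rule poly_mapping_eqI) (simp add: lookup_add lookup_minus le)
    then have "\<beta> + \<xi> \<in> E p \<gamma>"
      using \<beta> \<xi> by (auto simp: E_def keys_add_nat wt_add Ydeg_add Ydeg_X)
    moreover have "z = val (\<beta> + \<xi>)" using \<beta>(3) by (simp add: val_add val_X[OF \<xi>(1)])
    ultimately show "z \<in> val ` E p \<gamma>" by blast
  qed
  then show ?thesis unfolding ideal_sum_gen_ideal ideal_power_generators J_def by (simp only:)
qed

text \<open>Summing over all \<open>\<gamma>\<close> of a given total degree forgets the multigrading; what remains of the degree of
  \<open>\<alpha>\<close> is the number of its \<open>X\<close>-variables and of its \<open>Y\<close>-variables.\<close>

lemma sum_E_exponents: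
  fixes h :: "('v \<Rightarrow>\<^sub>0 nat) \<Rightarrow> 'c::comm_monoid_add"
  assumes "k \<le> n"
  shows "(\<Sum>\<gamma>\<in>exponents {1..r} n. \<Sum>\<alpha>\<in>E k \<gamma>. h \<alpha>) =
    (\<Sum>\<xi>\<in>exponents X (n - k). \<Sum>\<beta>\<in>exponents Y k. h (\<xi> + \<beta>))"
proof -
  define U where "U = {\<alpha> \<in> exponents (X \<union> Y) n. Ydeg \<alpha> = k}"
  have "finite U" unfolding U_def using finite_exponents[of "X \<union> Y" n] finite_X finite_Y by simp
  have wtU: "wt ` U \<subseteq> exponents {1..r} n"
    using keys_wt total_degree_wt by (auto simp: U_def exponents_def)
  have zero: "lookup \<alpha> v = 0" if "keys \<alpha> \<subseteq> S" "v \<notin> S" for \<alpha> :: "'v \<Rightarrow>\<^sub>0 nat" and v S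
    using that by (metis in_keys_iff subsetD)
  have "(\<Sum>\<gamma>\<in>exponents {1..r} n. \<Sum>\<alpha>\<in>E k \<gamma>. h \<alpha>) = (\<Sum>\<gamma>\<in>exponents {1..r} n. \<Sum>\<alpha>\<in>{\<alpha> \<in> U. wt \<alpha> = \<gamma>}. h \<alpha>)"
  proof (intro sum.cong refl)
    fix \<gamma> assume "\<gamma> \<in> exponents {1..r} n"
    then show "E k \<gamma> = {\<alpha> \<in> U. wt \<alpha> = \<gamma>}"
      using total_degree_wt by (auto simp: E_def U_def exponents_def)
  qed
  also have "\<dots> = (\<Sum>\<alpha>\<in>U. h \<alpha>)"
    by (rule sum.group[OF \<open>finite U\<close> finite_exponents wtU]) simp
  also have "\<dots> = (\<Sum>z\<in>exponents X (n - k) \<times> exponents Y k. h (case z of (\<xi>, \<beta>) \<Rightarrow> \<xi> + \<beta>))"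
  proof (rule sum.reindex_bij_betw[symmetric], rule bij_betw_imageI)
    show "inj_on (\<lambda>(\<xi>, \<beta>). \<xi> + \<beta>) (exponents X (n - k) \<times> exponents Y k)"
    proof (rule inj_onI, clarify)
      fix \<xi> \<beta> \<xi>' \<beta>'
      assume "\<xi> \<in> exponents X (n - k)" "\<beta> \<in> exponents Y k" "\<xi>' \<in> exponents X (n - k)" "\<beta>' \<in> exponents Y k"
      then have k: "keys \<xi> \<subseteq> X" "keys \<beta> \<subseteq> Y" "keys \<xi>' \<subseteq> X" "keys \<beta>' \<subseteq> Y"
        by (simp_all add: exponents_def)
      assume eq: "\<xi> + \<beta> = \<xi>' + \<beta>'"
      have "\<xi> = \<xi>'"
      proof (rule poly_mapping_eqI)
        fix v
        have "lookup \<xi> v + lookup \<beta> v = lookup \<xi>' v + lookup \<beta>' v"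
          using eq by (simp add: lookup_add[symmetric])
        then show "lookup \<xi> v = lookup \<xi>' v"
          using disjoint zero[OF k(1), of v] zero[OF k(2), of v] zero[OF k(3), of v] zero[OF k(4), of v]
          by (cases "v \<in> X"; cases "v \<in> Y") auto
      qed
      then show "\<xi> = \<xi>' \<and> \<beta> = \<beta>'" using eq by simp
    qed
    have degs: "(\<Sum>x\<in>X. lookup (\<xi> + \<beta>) x) = (\<Sum>x\<in>X. lookup \<xi> x)"
      "Ydeg (\<xi> + \<beta>) = (\<Sum>y\<in>Y. lookup \<beta> y)"
      if "keys \<xi> \<subseteq> X" "keys \<beta> \<subseteq> Y" for \<xi> \<beta>
    proof -
      show "(\<Sum>x\<in>X. lookup (\<xi> + \<beta>) x) = (\<Sum>x\<in>X. lookup \<xi> x)"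
        using disjoint zero[OF that(2)] by (intro sum.cong) (auto simp: lookup_add)
      show "Ydeg (\<xi> + \<beta>) = (\<Sum>y\<in>Y. lookup \<beta> y)"
        unfolding Ydeg_add Ydeg_X[OF that(1)] by (simp add: Ydeg_def)
    qed
    show "(\<lambda>(\<xi>, \<beta>). \<xi> + \<beta>) ` (exponents X (n - k) \<times> exponents Y k) = U"
    proof (intro equalityI subsetI)
      fix \<alpha> assume "\<alpha> \<in> (\<lambda>(\<xi>, \<beta>). \<xi> + \<beta>) ` (exponents X (n - k) \<times> exponents Y k)"
      then obtain \<xi> \<beta> where s: "\<xi> \<in> exponents X (n - k)" "\<beta> \<in> exponents Y k" "\<alpha> = \<xi> + \<beta>" by auto
      then have k: "keys \<xi> \<subseteq> X" "keys \<beta> \<subseteq> Y" by (simp_all add: exponents_def)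
      show "\<alpha> \<in> U"
        using degs[OF k] s k assms total_degree_split[of \<alpha>] by (auto simp: U_def exponents_def keys_add_nat)
    next
      fix \<alpha> assume \<alpha>: "\<alpha> \<in> U"
      obtain \<xi> \<beta> where s: "keys \<xi> \<subseteq> X" "keys \<beta> \<subseteq> Y" "\<alpha> = \<xi> + \<beta>"
        using split_XY[of \<alpha>] \<alpha> by (auto simp: U_def exponents_def)
      have "\<xi> \<in> exponents X (n - k)" "\<beta> \<in> exponents Y k"
        using degs[OF s(1,2)] \<alpha> s total_degree_split[of \<alpha>] by (auto simp: U_def exponents_def)
      then show "\<alpha> \<in> (\<lambda>(\<xi>, \<beta>). \<xi> + \<beta>) ` (exponents X (n - k) \<times> exponents Y k)" using s(3) by force
    qed
  qed
  also have "\<dots> = (\<Sum>\<xi>\<in>exponents X (n - k). \<Sum>\<beta>\<in>exponents Y k. h (\<xi> + \<beta>))"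
    by (simp add: sum.cartesian_product split_def)
  finally show ?thesis .
qed

end

locale primary_generator_system = generator_system X Y \<pi> a r
  for X Y :: "'v::linorder set" and \<pi> :: "'v \<Rightarrow> nat" and a :: "'v \<Rightarrow> 'a::comm_ring_1" and r :: nat +
  fixes \<mm> :: "'a set"
  assumes noeth: "noetherian TYPE('a)" and maximal: "maximal_ideal \<mm>"
    and radical: "\<And>i. i \<in> {1..r} \<Longrightarrow> \<mm> \<subseteq> radical_ideal (gen_ideal i)"
    and r_pos: "r \<ge> 1"
begin

lemma colength_J:
  assumes \<gamma>: "\<gamma> \<in> exponents {1..r} n" "p \<le> n"
  shows "quotient_length (*) UNIV (J p \<gamma>) \<noteq> \<infinity>"
    and "colength (J p \<gamma>) = (\<Sum>k<p. \<Sum>\<alpha>\<in>E k \<gamma>. colength (colon \<alpha>))"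
proof -
  have k: "keys \<gamma> \<subseteq> {1..r}" using \<gamma>(1) by (simp add: exponents_def)
  have fin: "quotient_length (*) UNIV (colon \<alpha>) \<noteq> \<infinity>" if "k < p" "\<alpha> \<in> E k \<gamma>" for k \<alpha>
    using that \<gamma> by (intro colon_finite_length[OF noeth maximal radical]) (auto simp: exponents_def)
  have layer: "(\<Sum>\<alpha>\<in>E k \<gamma>. quotient_length (*) UNIV (colon \<alpha>)) =
      enat (\<Sum>\<alpha>\<in>E k \<gamma>. the_enat (quotient_length (*) UNIV (colon \<alpha>)))" if "k < p" for k
    by (rule sum_enat_finite) (rule fin[OF that])
  have "(\<Sum>k<p. \<Sum>\<alpha>\<in>E k \<gamma>. quotient_length (*) UNIV (colon \<alpha>)) =
      (\<Sum>k<p. enat (\<Sum>\<alpha>\<in>E k \<gamma>. the_enat (quotient_length (*) UNIV (colon \<alpha>))))"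
    by (rule sum.cong) (simp_all add: layer)
  also have "\<dots> = enat (\<Sum>k<p. \<Sum>\<alpha>\<in>E k \<gamma>. the_enat (quotient_length (*) UNIV (colon \<alpha>)))"
    by (subst sum_enat_finite) simp_all
  finally have eq: "quotient_length (*) UNIV (J p \<gamma>) =
      enat (\<Sum>k<p. \<Sum>\<alpha>\<in>E k \<gamma>. the_enat (quotient_length (*) UNIV (colon \<alpha>)))"
    by (simp only: quotient_length_J[OF k])
  show "quotient_length (*) UNIV (J p \<gamma>) \<noteq> \<infinity>" by (simp add: eq)
  show "colength (J p \<gamma>) = (\<Sum>k<p. \<Sum>\<alpha>\<in>E k \<gamma>. colength (colon \<alpha>))"
    by (simp add: colength_def eq)
qed

definition \<Lambda> :: "nat \<Rightarrow> nat \<Rightarrow> real"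
  where "\<Lambda> p q = (\<Sum>\<gamma>\<in>exponents {1..r} (p + q). colength (J p \<gamma>))"

lemma buchsbaum_rim_function_real:
  "ereal_of_enat (buchsbaum_rim_function r (ideal_direct_sum r gen_ideal) p q) = ereal (\<Lambda> p q)"
proof -
  have "quotient_length (*) UNIV (J p \<gamma>) \<noteq> \<infinity>" if "\<gamma> \<in> exponents {1..r} (p + q)" for \<gamma>
    by (rule colength_J(1)[OF that]) simp
  then have "buchsbaum_rim_function r (ideal_direct_sum r gen_ideal) p q =
      enat (\<Sum>\<gamma>\<in>exponents {1..r} (p + q). the_enat (quotient_length (*) UNIV (J p \<gamma>)))"
    unfolding buchsbaum_rim_function_eq by (rule sum_enat_finite)
  then show ?thesis by (simp add: \<Lambda>_def colength_def)
qed

lemma \<Lambda>_eventually_poly2: "eventually_poly2 \<Lambda>"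
proof -
  obtain N where N: "\<And>\<alpha>. keys \<alpha> \<subseteq> X \<union> Y \<Longrightarrow> colon \<alpha> = colon (truncate N \<alpha>)"
    using noetherian_truncation[OF noeth, of "X \<union> Y" colon] finite_X finite_Y colon_ideal colon_mono by auto
  have "eventually_poly2 (\<lambda>p q. \<Sum>k<p. \<Sum>\<xi>\<in>exponents X (p + q - k). \<Sum>\<beta>\<in>exponents Y k. colength (colon (\<xi> + \<beta>)))"
    by (rule eventually_poly2_truncated_sum[OF finite_X finite_Y, of _ N]) (simp only: N[symmetric])
  moreover have "\<Lambda> p q = (\<Sum>k<p. \<Sum>\<xi>\<in>exponents X (p + q - k). \<Sum>\<beta>\<in>exponents Y k. colength (colon (\<xi> + \<beta>)))" for p q
  proof -
    have "\<Lambda> p q = (\<Sum>\<gamma>\<in>exponents {1..r} (p + q). \<Sum>k<p. \<Sum>\<alpha>\<in>E k \<gamma>. colength (colon \<alpha>))"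
      unfolding \<Lambda>_def by (rule sum.cong[OF refl], rule colength_J(2), assumption, rule le_add1)
    also have "\<dots> = (\<Sum>k<p. \<Sum>\<gamma>\<in>exponents {1..r} (p + q). \<Sum>\<alpha>\<in>E k \<gamma>. colength (colon \<alpha>))"
      by (rule sum.swap)
    also have "\<dots> = (\<Sum>k<p. \<Sum>\<xi>\<in>exponents X (p + q - k). \<Sum>\<beta>\<in>exponents Y k. colength (colon (\<xi> + \<beta>)))"
      by (intro sum.cong refl sum_E_exponents) simp
    finally show ?thesis .
  qed
  ultimately show ?thesis by presburger
qed

lemma corner: "J p (\<Sum>i=1..r. single i N) = ideal_power (ideal_sum r gen_ideal) p" if "p \<le> N"
proof -
  have l: "lookup (\<Sum>i=1..r. single i N) j = (if j \<in> {1..r} then N else 0)" for j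
    unfolding lookup_sum lookup_single when_def by simp
  show ?thesis
    by (rule J_eq_ideal_power) (use that in \<open>auto simp: in_keys_iff l simp del: One_nat_def split: if_splits\<close>)
qed

lemma ideal_power_finite_length: "quotient_length (*) UNIV (ideal_power (ideal_sum r gen_ideal) p) \<noteq> \<infinity>"
proof -
  have l: "lookup (\<Sum>i=1..r. single i p) j = (if j \<in> {1..r} then p else 0)" for j
    unfolding lookup_sum lookup_single when_def by simp
  have "(\<Sum>i=1..r. single i p) \<in> exponents {1..r} (r * p)"
    by (auto simp: exponents_def in_keys_iff l simp del: One_nat_def split: if_splits)
  then show ?thesis
    using colength_J(1)[of _ "r * p" p] r_pos unfolding corner[OF order_refl, symmetric] by simp
qed

text \<open>For fixed \<open>p\<close>, the ideals \<open>J p \<gamma>\<close> are determined by truncations of \<open>\<gamma>\<close>. The top coefficient is governed by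
  the corner of the box, where \<open>J p \<gamma>\<close> is the \<open>p\<close>-th power of the sum of the ideals.\<close>

lemma \<Lambda>_fixed_p:
  "eventually_poly (r - 1) (colength (ideal_power (ideal_sum r gen_ideal) p) / fact (r - 1)) (\<lambda>q. \<Lambda> p q)"
proof -
  obtain N0 where N0: "\<And>\<gamma>. keys \<gamma> \<subseteq> {1..r} \<Longrightarrow> J p \<gamma> = J p (truncate N0 \<gamma>)"
    using noetherian_truncation[OF noeth, of "{1..r}" "J p"] J_ideal J_mono_weight by auto
  \<comment> \<open>a bound at least \<open>p\<close> makes the corner of the box a full power\<close>
  define N where "N = max N0 p"
  have N: "J p (truncate N \<gamma>) = J p \<gamma>" if "keys \<gamma> \<subseteq> {1..r}" for \<gamma>
  proof -
    have "keys (truncate N \<gamma>) \<subseteq> {1..r}" using keys_truncate that by (rule order_trans)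
    then have "J p (truncate N \<gamma>) = J p (truncate N0 (truncate N \<gamma>))" by (rule N0)
    also have "\<dots> = J p (truncate N0 \<gamma>)" by (simp add: N_def)
    also have "\<dots> = J p \<gamma>" by (rule N0[OF that, symmetric])
    finally show ?thesis .
  qed
  have "eventually_poly (card {1..r} - 1)
      (colength (J p (\<Sum>i=1..r. single i N)) / fact (card {1..r} - 1))
      (\<lambda>n. \<Sum>\<gamma>\<in>exponents {1..r} n. colength (J p \<gamma>))"
    by (rule eventually_poly_truncated_sum) (use r_pos N in auto)
  then have "eventually_poly (r - 1) (colength (ideal_power (ideal_sum r gen_ideal) p) / fact (r - 1))
      (\<lambda>n. \<Sum>\<gamma>\<in>exponents {1..r} n. colength (J p \<gamma>))"
    unfolding N_def corner[OF max.cobounded2] by simp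
  then show ?thesis
    unfolding \<Lambda>_def
    by (rule eventually_poly_shift[where M = 0 and a = "real p"]) (auto intro: trans_le_add2)
qed

lemma buchsbaum_rim_poly_coefficient:
  "\<exists>N. \<forall>p\<ge>N. fact (r - 1) * coeff (poly (buchsbaum_rim_poly r (ideal_direct_sum r gen_ideal)) [:real p:]) (r - 1) =
    colength (ideal_power (ideal_sum r gen_ideal) p)"
proof -
  obtain P N where P: "\<And>p q. p \<ge> N \<Longrightarrow> q \<ge> N \<Longrightarrow> \<Lambda> p q = poly2 P p q"
    using \<Lambda>_eventually_poly2 unfolding eventually_poly2_def by blast
  have "buchsbaum_rim_poly r (ideal_direct_sum r gen_ideal) = P"
    unfolding buchsbaum_rim_poly_def buchsbaum_rim_function_real poly2_def[symmetric] ereal.inject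
  proof (rule the_equality)
    show "\<exists>N. \<forall>p\<ge>N. \<forall>q\<ge>N. \<Lambda> p q = poly2 P p q" using P by blast
    fix Q assume "\<exists>N. \<forall>p\<ge>N. \<forall>q\<ge>N. \<Lambda> p q = poly2 Q p q"
    then obtain M where M: "\<And>p q. p \<ge> M \<Longrightarrow> q \<ge> M \<Longrightarrow> \<Lambda> p q = poly2 Q p q" by blast
    show "Q = P"
    proof (rule poly2_eq_of_eventually_eq[of "max M N"])
      fix p q assume "max M N \<le> p" "max M N \<le> q"
      then show "poly2 Q p q = poly2 P p q" using M[of p q] P[of p q] by simp
    qed
  qed
  moreover have "fact (r - 1) * coeff (poly P [:real p:]) (r - 1) = colength (ideal_power (ideal_sum r gen_ideal) p)"
    if p: "p \<ge> N" for p
  proof -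
    obtain F M where F: "coeff F (r - 1) = colength (ideal_power (ideal_sum r gen_ideal) p) / fact (r - 1)"
        "\<And>q. q \<ge> M \<Longrightarrow> \<Lambda> p q = poly F (real q)"
      using \<Lambda>_fixed_p[of p] unfolding eventually_poly_def by blast
    have "poly P [:real p:] = F"
    proof (rule poly_eq_of_eventually_eq[of real "max M N"])
      fix q assume "max M N \<le> q"
      then show "poly (poly P [:real p:]) (real q) = poly F (real q)"
        using F(2)[of q] P[OF p, of q] by (simp add: poly2_def)
    qed (simp add: inj_on_def)
    then show ?thesis using F(1) by simp
  qed
  ultimately show ?thesis by blast
qed

text \<open>The coefficient of the Buchsbaum--Rim polynomial at \<open>q\<^sup>r\<^sup>-\<^sup>1\<close>, multiplied by \<open>(r - 1)!\<close>, interpolates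
  the colengths of the powers, so it is the Hilbert--Samuel polynomial. In particular that
  polynomial exists.\<close>

lemma buchsbaum_rim_mult_eq:
  "buchsbaum_rim_mult d r (ideal_direct_sum r gen_ideal) (r - 1) = hilbert_samuel_mult d (ideal_sum r gen_ideal)"
proof -
  define P where "P = buchsbaum_rim_poly r (ideal_direct_sum r gen_ideal)"
  define H where "H = smult (fact (r - 1)) (map_poly (\<lambda>c. coeff c (r - 1)) P)"
  obtain N where N: "\<And>p. p \<ge> N \<Longrightarrow> poly H (real p) = colength (ideal_power (ideal_sum r gen_ideal) p)"
    using buchsbaum_rim_poly_coefficient unfolding H_def P_def poly_smult coeff_poly_constant by blast
  have "hilbert_samuel_poly (ideal_sum r gen_ideal) = H"
    unfolding hilbert_samuel_poly_def ereal_colength[OF ideal_power_finite_length] ereal.inject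
  proof (rule the_equality)
    show "\<exists>N. \<forall>p\<ge>N. colength (ideal_power (ideal_sum r gen_ideal) p) = poly H (real p)"
      using N by (intro exI[of _ N]) simp
    fix G assume "\<exists>N. \<forall>p\<ge>N. colength (ideal_power (ideal_sum r gen_ideal) p) = poly G (real p)"
    then obtain M where M: "\<And>p. p \<ge> M \<Longrightarrow> colength (ideal_power (ideal_sum r gen_ideal) p) = poly G (real p)"
      by blast
    show "G = H"
      by (rule poly_eq_of_eventually_eq[of real "max M N"]) (simp_all add: inj_on_def M[symmetric] N)
  qed
  then have "hilbert_samuel_mult d (ideal_sum r gen_ideal) = fact d * (fact (r - 1) * coeff (coeff P d) (r - 1))"
    by (simp add: hilbert_samuel_mult_def H_def coeff_map_poly)
  moreover have "d + r - 1 - (r - 1) = d" using r_pos by simp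
  ultimately show ?thesis by (simp add: buchsbaum_rim_mult_def P_def)
qed

end

text \<open>The pairs \<open>(i, None)\<close> serve as coordinate variables and the pairs \<open>(i, Some b)\<close>, for \<open>b\<close> in a finite
  generating set of \<open>I i\<close>, as generator variables; they are numbered to obtain a linearly
  ordered index type.\<close>

lemma generator_system_exists:
  fixes I :: "nat \<Rightarrow> 'a::comm_ring_1 set"
  assumes noeth: "noetherian TYPE('a)" and ideal: "\<And>i. i \<in> {1..r} \<Longrightarrow> is_ideal (I i)"
  obtains X Y :: "nat set" and \<pi> :: "nat \<Rightarrow> nat" and a :: "nat \<Rightarrow> 'a"
  where "generator_system X Y \<pi> a r" "\<And>i. i \<in> {1..r} \<Longrightarrow> generator_system.gen_ideal Y \<pi> a i = I i"
proof -
  have "\<forall>i\<in>{1..r}. \<exists>B. finite B \<and> I i = ideal_generated B"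
    using noeth ideal unfolding noetherian_def by simp
  from bchoice[OF this] obtain B
    where B: "\<And>i. i \<in> {1..r} \<Longrightarrow> finite (B i)" "\<And>i. i \<in> {1..r} \<Longrightarrow> I i = ideal_generated (B i)"
    by blast
  define W where "W = (\<Union>i\<in>{1..r}. insert (i, None) ((\<lambda>b. (i, Some b)) ` B i))"
  have "finite W" unfolding W_def using B(1) by simp
  then obtain h where h: "bij_betw h {0..<card W} W" using ex_bij_betw_nat_finite by blast
  have hW: "h ` {0..<card W} = W" using h by (simp add: bij_betw_def)
  define X where "X = {v \<in> {0..<card W}. snd (h v) = None}"
  define Y where "Y = {v \<in> {0..<card W}. snd (h v) \<noteq> None}"
  define \<pi> where "\<pi> v = fst (h v)" for v
  define a where "a v = (case snd (h v) of None \<Rightarrow> 1 | Some b \<Rightarrow> b)" for v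
  have range: "h v \<in> W" if "v \<in> {0..<card W}" for v using hW that by blast
  have surj: "\<exists>v\<in>{0..<card W}. h v = w" if "w \<in> W" for w
    using subst[OF hW[symmetric], of "\<lambda>S. w \<in> S", OF that] by (elim imageE) auto
  have sys: "generator_system X Y \<pi> a r"
  proof
    show "finite X" "finite Y" "X \<inter> Y = {}" by (auto simp: X_def Y_def)
    show "\<pi> v \<in> {1..r}" if "v \<in> X \<union> Y" for v
      using that range[of v] by (auto simp: X_def Y_def W_def \<pi>_def)
    show "\<exists>x\<in>X. \<pi> x = i" if "i \<in> {1..r}" for i
    proof -
      have "(i, None) \<in> W" using that by (auto simp: W_def)
      then show ?thesis using surj by (fastforce simp: X_def \<pi>_def)
    qed
    show "a x = 1" if "x \<in> X" for x using that by (simp add: X_def a_def)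
  qed
  have "a ` {y \<in> Y. \<pi> y = i} = B i" if i: "i \<in> {1..r}" for i
  proof (intro equalityI subsetI)
    fix b assume "b \<in> a ` {y \<in> Y. \<pi> y = i}"
    then show "b \<in> B i" using range by (fastforce simp: Y_def \<pi>_def a_def W_def)
  next
    fix b assume "b \<in> B i"
    then have "(i, Some b) \<in> W" using i by (auto simp: W_def)
    then obtain v where v: "v \<in> {0..<card W}" "h v = (i, Some b)" using surj by blast
    then show "b \<in> a ` {y \<in> Y. \<pi> y = i}" by (intro image_eqI[of _ _ v]) (auto simp: Y_def \<pi>_def a_def)
  qed
  then have "generator_system.gen_ideal Y \<pi> a i = I i" if "i \<in> {1..r}" for i
    using B(2)[OF that] that by (simp add: generator_system.gen_ideal_def[OF sys])
  with sys show ?thesis by (rule that)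
qed

lemma buchsbaum_rim_mult_direct_sum:
  fixes I :: "nat \<Rightarrow> 'a::comm_ring_1 set"
  assumes "noetherian TYPE('a)" "maximal_ideal \<mm>" "r \<ge> 1"
    and I: "\<And>i. i \<in> {1..r} \<Longrightarrow> is_ideal (I i)" "\<And>i. i \<in> {1..r} \<Longrightarrow> \<mm> \<subseteq> radical_ideal (I i)"
  shows "buchsbaum_rim_mult d r (ideal_direct_sum r I) (r - 1) = hilbert_samuel_mult d (ideal_sum r I)"
proof -
  obtain X Y :: "nat set" and \<pi> :: "nat \<Rightarrow> nat" and a :: "nat \<Rightarrow> 'a"
    where sys: "generator_system X Y \<pi> a r" and gen: "\<And>i. i \<in> {1..r} \<Longrightarrow> generator_system.gen_ideal Y \<pi> a i = I i"
    using generator_system_exists[where r = r and I = I, OF assms(1) I(1)] by blast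
  have "primary_generator_system X Y \<pi> a r \<mm>"
    by (intro primary_generator_system.intro primary_generator_system_axioms.intro sys assms(1,2,3))
      (simp add: gen I(2))
  then show ?thesis
    using primary_generator_system.buchsbaum_rim_mult_eq[of X Y \<pi> a r \<mm> d]
      ideal_direct_sum_cong[of r, OF gen] ideal_sum_cong[of r, OF gen] by simp
qed

corollary cyclic_buchsbaum_rim_mult_eq:
  fixes Q :: "'a::comm_ring_1 set"
  assumes "noetherian TYPE('a)" "maximal_ideal \<mm>" "is_ideal Q" "\<mm> \<subseteq> radical_ideal Q"
  shows "cyclic_buchsbaum_rim_mult d Q = hilbert_samuel_mult d Q"
proof -
  have "ideal_sum 1 (\<lambda>_. Q) = Q" using assms(3) by (intro ideal_sum_eq_largest[where j = 1]) auto
  then show ?thesis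
    using buchsbaum_rim_mult_direct_sum[OF assms(1,2), of 1 "\<lambda>_. Q" d] assms(3,4)
    by (simp add: cyclic_buchsbaum_rim_mult_def)
qed

theorem theorem1p3:
  fixes \<mm> :: "'a::comm_ring_1 set"
    and I :: "nat \<Rightarrow> 'a set"
    and d r :: nat
  assumes "noetherian TYPE('a)"
    and "local_ring \<mm>"
    and "krull_dim TYPE('a) = enat d"
    and "d > 0"
    and "r \<ge> 1"
    and "\<forall>i\<in>{1..r}. primary_to \<mm> (I i)"
  shows "buchsbaum_rim_mult d r (ideal_direct_sum r I) (r - 1) =
           cyclic_buchsbaum_rim_mult d (ideal_sum r I) \<and>
         cyclic_buchsbaum_rim_mult d (ideal_sum r I) = hilbert_samuel_mult d (ideal_sum r I) \<and>
         ((\<forall>i\<in>{1..r - 1}. I i \<subseteq> I r) \<longrightarrow>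
           buchsbaum_rim_mult d r (ideal_direct_sum r I) (r - 1) =
             cyclic_buchsbaum_rim_mult d (I r) \<and>
           cyclic_buchsbaum_rim_mult d (I r) = hilbert_samuel_mult d (I r))"
proof -
  have max: "maximal_ideal \<mm>" using assms(2) by (simp add: local_ring_def)
  have ideal: "is_ideal (I i)" and rad: "\<mm> \<subseteq> radical_ideal (I i)" if "i \<in> {1..r}" for i
    using assms(6) that by (auto simp: primary_to_def primary_ideal_def)
  have r: "r \<in> {1..r}" using assms(5) by simp
  have sum: "is_ideal (ideal_sum r I)" by (rule ideal_sum_ideal[OF ideal])
  have "\<mm> \<subseteq> radical_ideal (ideal_sum r I)"
    using rad[OF r] radical_ideal_mono[OF subset_ideal_sum[of r I r, OF ideal r]] by blast
  then have cyclic: "cyclic_buchsbaum_rim_mult d (ideal_sum r I) = hilbert_samuel_mult d (ideal_sum r I)"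
    by (rule cyclic_buchsbaum_rim_mult_eq[OF assms(1) max sum])
  have mult: "buchsbaum_rim_mult d r (ideal_direct_sum r I) (r - 1) = hilbert_samuel_mult d (ideal_sum r I)"
    by (rule buchsbaum_rim_mult_direct_sum[OF assms(1) max assms(5) ideal rad])
  have "ideal_sum r I = I r" if sub: "\<forall>i\<in>{1..r - 1}. I i \<subseteq> I r"
  proof (rule ideal_sum_eq_largest[OF ideal r])
    fix i assume "i \<in> {1..r}"
    then show "I i \<subseteq> I r" using sub by (cases "i = r") auto
  qed
  then show ?thesis using cyclic mult by auto
qed

end
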